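(* Let $\mathbb{G}$ be a pseudo-orientable ribbon graph and let $Q\subseteq E(\mathbb{G})$. For $i\ge0$ let $q^Q_i$ be the number of quasi-trees $X$ of $\mathbb{G}$ with $|Q\triangle X|\in\{2i-1,2i\}$. Then the sequence $(q^Q_i)_{i\ge0}$ is ultra-log-concave with no internal zeros. In particular, the sequence $(q_i:=q^{\emptyset}_i)_{i\ge0}$ counting quasi-trees of size $2i-1$ or $2i$ is ultra-log-concave with no internal zeros.
   Context: A ribbon graph $\mathbb{G}$ is a surface with boundary written as the union of vertex discs and edge discs $E(\mathbb{G})$ meeting in disjoint line segments, each on the boundary of exactly one vertex and one edge, with each edge containing exactly two such segments. For connected $\mathbb{G}$, a quasi-tree is $F\subseteq E(\mathbb{G})$ such that the spanning ribbon subgraph $(V(\mathbb{G}),F)$ has exactly one boundary component; in general, a union of quasi-trees of the components. The partial dual $\mathbb{G}^X$ has the same edges and as vertices discs glued along the boundary components of $(V(\mathbb{G}),X)$. A bouquet is a ribbon graph with one vertex; a loop is orientable if with the vertex it forms an annulus, non-orientable if a Möbius band. A bouquet is pseudo-orientable if its vertex boundary circle is the union of two closed arcs $S_1,S_2$ meeting in exactly two points such that both ends of each orientable loop lie in the interior of one $S_i$ and each non-orientable loop has one end in the interior of each of $S_1,S_2$. A connected ribbon graph is pseudo-orientable if $\mathbb{G}^X$ is a pseudo-orientable bouquet for some quasi-tree $X$; a general one is pseudo-orientable if one component is pseudo-orientable and all others are orientable. For a finitely supported sequence $(a_i)_{i\in\mathbb{Z}}$ of nonnegative reals with $\ell=\min\{i:a_i\ne0\}$,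 $u=\max\{i:a_i\neq0\}$: it has no internal zeros if $a_i\ne0$ for all $\ell\le i\le u$; it is log-concave if $a_i^2\ge a_{i-1}a_{i+1}$ for all $i$; it is ultra-log-concave if $\bigl(a_i/\binom{u-\ell}{i-\ell}\bigr)_{i}$ is log-concave. *)

theory Defs
  imports Complex_Main
begin

(* Combinatorial model of ribbon graphs (graph-encoded maps / flag model).
   A flag is an endpoint of an attaching segment of an edge end on a vertex boundary.
   alph : pairs the two endpoints of an arc of a vertex boundary between consecutive ends
   sg   : pairs the two endpoints of one attaching (end) segment
   bt   : pairs the two endpoints of one long side of an edge disc
   edg  : the edge a flag belongs to
   iso  : number of isolated (edgeless) vertices, which carry no flags. *)
record ('f, 'e) rg =
  flags :: "'f set"
  alph  :: "'f \<Rightarrow> 'f"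
  sg    :: "'f \<Rightarrow> 'f"
  bt    :: "'f \<Rightarrow> 'f"
  edg   :: "'f \<Rightarrow> 'e"
  iso   :: nat

definition fpf_inv :: "'f set \<Rightarrow> ('f \<Rightarrow> 'f) \<Rightarrow> bool" where
  "fpf_inv S f \<longleftrightarrow> (\<forall>x\<in>S. f x \<in> S \<and> f (f x) = x \<and> f x \<noteq> x)"

definition ribbon_graph :: "('f, 'e) rg \<Rightarrow> bool" where
  "ribbon_graph G \<longleftrightarrow> finite (flags G)
     \<and> fpf_inv (flags G) (alph G) \<and> fpf_inv (flags G) (sg G) \<and> fpf_inv (flags G) (bt G)
     \<and> (\<forall>x\<in>flags G. sg G (bt G x) = bt G (sg G x) \<and> sg G x \<noteq> bt G x)
     \<and> (\<forall>x\<in>flags G. \<forall>y\<in>flags G.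
          edg G x = edg G y \<longleftrightarrow> y \<in> {x, sg G x, bt G x, sg G (bt G x)})"

definition edges :: "('f, 'e) rg \<Rightarrow> 'e set" where
  "edges G = edg G ` flags G"

(* adjacency used for tracing boundary components of the spanning ribbon subgraph (V(G),A):
   around vertex arcs, and along long sides of edges in A, and across end segments of edges not in A *)
definition bstep :: "('f, 'e) rg \<Rightarrow> 'e set \<Rightarrow> ('f \<times> 'f) set" where
  "bstep G A = {(x, y). x \<in> flags G \<and>
      (y = alph G x \<or> y = (if edg G x \<in> A then bt G x else sg G x))}"

(* number of boundary components of the spanning ribbon subgraph (V(G), A) *)
definition num_bc :: "('f, 'e) rg \<Rightarrow> 'e set \<Rightarrow> nat" where
  "num_bc G A = card (flags G // (bstep G A)\<^sup>*) + iso G"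

(* connectivity of flags *)
definition cstep :: "('f, 'e) rg \<Rightarrow> ('f \<times> 'f) set" where
  "cstep G = {(x, y). x \<in> flags G \<and> (y = alph G x \<or> y = sg G x \<or> y = bt G x)}"

(* the non-trivial components (those containing edges); the remaining components are the
   iso G isolated vertices *)
definition flag_comps :: "('f, 'e) rg \<Rightarrow> 'f set set" where
  "flag_comps G = flags G // (cstep G)\<^sup>*"

definition restrict_rg :: "('f, 'e) rg \<Rightarrow> 'f set \<Rightarrow> ('f, 'e) rg" where
  "restrict_rg G K = G\<lparr>flags := K, iso := 0\<rparr>"

(* quasi-tree of a connected ribbon graph *)
definition quasi_tree_conn :: "('f, 'e) rg \<Rightarrow> 'e set \<Rightarrow> bool" where
  "quasi_tree_conn H X \<longleftrightarrow> X \<subseteq> edges H \<and> num_bc H X = 1"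

(* general quasi-tree: union of quasi-trees of the components
   (an isolated vertex component has the single quasi-tree {}) *)
definition quasi_tree :: "('f, 'e) rg \<Rightarrow> 'e set \<Rightarrow> bool" where
  "quasi_tree G X \<longleftrightarrow> X \<subseteq> edges G \<and>
     (\<forall>K\<in>flag_comps G. quasi_tree_conn (restrict_rg G K) (X \<inter> edges (restrict_rg G K)))"

(* partial dual G^A: swaps the roles of end segments and long sides on the edges of A *)
definition pdual :: "('f, 'e) rg \<Rightarrow> 'e set \<Rightarrow> ('f, 'e) rg" where
  "pdual G A = G\<lparr>sg := (\<lambda>x. if edg G x \<in> A then bt G x else sg G x),
                 bt := (\<lambda>x. if edg G x \<in> A then sg G x else bt G x)\<rparr>"

(* vertex boundaries: alternating vertex arcs and end segments *)
definition vstep :: "('f, 'e) rg \<Rightarrow> ('f \<times> 'f) set" where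
  "vstep G = {(x, y). x \<in> flags G \<and> (y = alph G x \<or> y = sg G x)}"

definition num_vertices :: "('f, 'e) rg \<Rightarrow> nat" where
  "num_vertices G = card (flags G // (vstep G)\<^sup>*) + iso G"

definition bouquet :: "('f, 'e) rg \<Rightarrow> bool" where
  "bouquet G \<longleftrightarrow> num_vertices G = 1"

(* the spanning ribbon subgraph (V(G), F) is orientable: consistent local orientations
   (two-colouring of flags, each of the involutions in use swaps colours) *)
definition orientable_sub :: "('f, 'e) rg \<Rightarrow> 'e set \<Rightarrow> bool" where
  "orientable_sub G F \<longleftrightarrow> (\<exists>c :: 'f \<Rightarrow> bool. \<forall>x\<in>flags G.
      c (alph G x) \<noteq> c x \<and> c (sg G x) \<noteq> c x \<and> (edg G x \<in> F \<longrightarrow> c (bt G x) \<noteq> c x))"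

definition orientable :: "('f, 'e) rg \<Rightarrow> bool" where
  "orientable G \<longleftrightarrow> orientable_sub G (edges G)"

(* loop e of a bouquet is orientable iff vertex + e is orientable (annulus) *)
definition orientable_loop :: "('f, 'e) rg \<Rightarrow> 'e \<Rightarrow> bool" where
  "orientable_loop G e \<longleftrightarrow> orientable_sub G {e}"

(* pseudo-orientable bouquet: the vertex circle splits into two arcs S1 (label True) and
   S2 (label False) cut at two points lying on vertex arcs {a, alph a} and {b, alph b};
   every end segment {x, sg x} lies inside one arc; the ends {x, sg x} and {bt x, sg (bt x)}
   of the loop through x lie in the same arc iff the loop is orientable *)
definition pseudo_orientable_bouquet :: "('f, 'e) rg \<Rightarrow> bool" where
  "pseudo_orientable_bouquet G \<longleftrightarrow> bouquet G \<and>
     (\<exists>(lab :: 'f \<Rightarrow> bool) a b.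
        (\<forall>x\<in>flags G. lab (sg G x) = lab x) \<and>
        (\<forall>x\<in>flags G. lab (alph G x) \<noteq> lab x \<longrightarrow> x \<in> {a, alph G a, b, alph G b}) \<and>
        (\<forall>x\<in>flags G. (lab (bt G x) = lab x) \<longleftrightarrow> orientable_loop G (edg G x)))"

definition pseudo_orientable_conn :: "('f, 'e) rg \<Rightarrow> bool" where
  "pseudo_orientable_conn H \<longleftrightarrow>
     (\<exists>X. quasi_tree H X \<and> pseudo_orientable_bouquet (pdual H X))"

(* one component pseudo-orientable, all others orientable; isolated vertices are orientable
   components which are (trivially) pseudo-orientable bouquets *)
definition pseudo_orientable :: "('f, 'e) rg \<Rightarrow> bool" where
  "pseudo_orientable G \<longleftrightarrow>
     (\<exists>K\<in>flag_comps G. pseudo_orientable_conn (restrict_rg G K) \<and>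
        (\<forall>K'\<in>flag_comps G. K' \<noteq> K \<longrightarrow> orientable (restrict_rg G K')))
   \<or> (iso G \<ge> 1 \<and> (\<forall>K\<in>flag_comps G. orientable (restrict_rg G K)))"

(* sequences indexed by the integers *)
definition supp_seq :: "(int \<Rightarrow> real) \<Rightarrow> int set" where
  "supp_seq a = {i. a i \<noteq> 0}"

definition no_internal_zeros :: "(int \<Rightarrow> real) \<Rightarrow> bool" where
  "no_internal_zeros a \<longleftrightarrow>
     (\<forall>i. Min (supp_seq a) \<le> i \<and> i \<le> Max (supp_seq a) \<longrightarrow> a i \<noteq> 0)"

definition log_concave :: "(int \<Rightarrow> real) \<Rightarrow> bool" where
  "log_concave a \<longleftrightarrow> (\<forall>i. (a i)\<^sup>2 \<ge> a (i - 1) * a (i + 1))"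

definition ultra_log_concave :: "(int \<Rightarrow> real) \<Rightarrow> bool" where
  "ultra_log_concave a \<longleftrightarrow>
     (let l = Min (supp_seq a); u = Max (supp_seq a) in
      log_concave (\<lambda>i. a i / real (nat (u - l) choose nat (i - l))))"

definition qt_seq :: "('f, 'e) rg \<Rightarrow> 'e set \<Rightarrow> int \<Rightarrow> real" where
  "qt_seq G Q i = (if i < 0 then 0 else
      real (card {X. quasi_tree G X \<and> int (card ((Q - X) \<union> (X - Q))) \<in> {2 * i - 1, 2 * i}}))"

end

theory Submission
  imports Defs "Jordan_Normal_Form.Determinant" "HOL-Combinatorics.Orbits"
    "HOL-Computational_Algebra.Fundamental_Theorem_Algebra"
begin

text \<open>
  Colour the flags so that both kinds of edge sides alternate.  If the vertex arcs alternate too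
  (the orientable case), tracing the boundary of \<open>(V, X)\<close> is a permutation of one colour class,
  equal to a fixed permutation composed with the transpositions of the edges in \<open>X\<close>, and \<open>X\<close> is a
  quasi-tree iff its orbits are the components.  Replacing each transposition \<open>\<tau>\<close> by
  \<open>(1 - x) I + x \<tau>\<close> gives a matrix \<open>M(x)\<close> for which \<open>det (I - M(x) + J)\<close>, with \<open>J\<close> the indicator of
  equal components, is multiaffine and a nonzero multiple of the quasi-tree generating function.
  It does not vanish when all \<open>\<bar>1 - 2x\<bar> < 1\<close>, because \<open>M(x)\<close> is then a contraction.  The
  substitution \<open>x = z / (1 + z)\<close>, or \<open>1 / (1 + z)\<close> on \<open>Q\<close>, shows that the generating polynomial of
  the distances to \<open>Q\<close> has no zero with \<open>Re z > 0\<close>.  All distances have the same parity, so in terms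
  of \<open>z\<^sup>2\<close> it is real-rooted, and Newton's inequalities apply.

  In a pseudo-orientable graph exactly two vertex arcs fail to alternate.  They can be rerouted in two
  ways, which differ by a transposition; taking this transposition as an extra edge gives an
  orientable situation, and \<open>X\<close> is a quasi-tree iff exactly one of \<open>X\<close> and \<open>X\<close> plus the extra edge
  is feasible there.
\<close>

subsection \<open>Determinants indexed by a finite set\<close>

text \<open>The factor \<open>(1 - x) I + x \<tau>\<close> fixes symmetric vectors and scales
  antisymmetric ones by \<open>1 - 2x\<close>; this is where the region comes from. The map
  \<open>z\<close> to \<open>(1 - z) / (1 + z)\<close> takes the right half-plane into the unit
  disc, and equating \<open>1 - 2x\<close> with plus or minus this number yields the two
  substitutions. No determinant is ever evaluated. At a 0/1 point the matrix belongs to a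
  permutation: if its cycles are the components, it is conjugate to any other such permutation
  within the components, so all quasi-trees share one value; otherwise an invariant function that is
  not constant on components gives a kernel vector and the value 0. Conjugacy also explains the
  common parity, by comparing signs. Connectivity is expressed by invariant functions rather than by
  cycles or paths, because such functions restrict to a colour class, extend back to all flags, and
  serve directly as kernel vectors. In the pseudo-orientable case quasi-trees of both parities may
  occur. The extra edge absorbs the difference, which is why distances \<open>2 * i - 1\<close> and
  \<open>2 * i\<close> are counted together.\<close>

definition enum_set :: "'v set \<Rightarrow> nat \<Rightarrow> 'v" where
  "enum_set V = (SOME h. bij_betw h {0..<card V} V)"

lemma bij_enum_set: "finite V \<Longrightarrow> bij_betw (enum_set V) {0..<card V} V"
  unfolding enum_set_def by (rule someI_ex[OF ex_bij_betw_nat_finite])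

definition mat_on :: "'v set \<Rightarrow> ('v \<Rightarrow> 'v \<Rightarrow> 'a) \<Rightarrow> 'a mat" where
  "mat_on V A = mat (card V) (card V) (\<lambda>(i, j). A (enum_set V i) (enum_set V j))"

definition det_on :: "'v set \<Rightarrow> ('v \<Rightarrow> 'v \<Rightarrow> 'a :: comm_ring_1) \<Rightarrow> 'a" where
  "det_on V A = det (mat_on V A)"

lemma mat_on_carrier [simp]: "mat_on V A \<in> carrier_mat (card V) (card V)"
  by (simp add: mat_on_def)

lemma det_on_cong:
  assumes "finite V" "\<And>i j. i \<in> V \<Longrightarrow> j \<in> V \<Longrightarrow> A i j = B i j"
  shows "det_on V A = det_on V B"
proof -
  have "enum_set V k \<in> V" if "k < card V" for k
    using bij_betwE[OF bij_enum_set[OF assms(1)]] that by auto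
  then have "mat_on V A = mat_on V B"
    by (intro eq_matI) (auto simp: mat_on_def assms(2))
  then show ?thesis by (simp add: det_on_def)
qed

text \<open>Carries the kernel criterion from vectors to functions on \<open>V\<close>, so that
  later arguments never see the enumeration.\<close>

lemma det_on_eq_0_iff:
  fixes A :: "'v \<Rightarrow> 'v \<Rightarrow> 'a :: field"
  assumes "finite V"
  shows "det_on V A = 0 \<longleftrightarrow>
    (\<exists>v. (\<exists>i\<in>V. v i \<noteq> 0) \<and> (\<forall>i\<in>V. (\<Sum>j\<in>V. A i j * v j) = 0))"
proof -
  let ?n = "card V" and ?h = "enum_set V"
  note bij = bij_enum_set[OF assms]
  have hV: "?h k \<in> V" if "k < ?n" for k
    using bij_betwE[OF bij] that by auto
  have sums: "(mat_on V A *\<^sub>v w) $ k = (\<Sum>j\<in>V. A (?h k) j * v j)"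
    if "k < ?n" "w \<in> carrier_vec ?n" "\<And>l. l < ?n \<Longrightarrow> w $ l = v (?h l)" for k w v
  proof -
    have "(mat_on V A *\<^sub>v w) $ k = (\<Sum>l = 0..<?n. A (?h k) (?h l) * v (?h l))"
      using that by (auto simp: mat_on_def scalar_prod_def intro!: sum.cong)
    also have "\<dots> = (\<Sum>j\<in>V. A (?h k) j * v j)"
      by (rule sum.reindex_bij_betw[OF bij])
    finally show ?thesis .
  qed
  show ?thesis
  proof
    assume "det_on V A = 0"
    then obtain w where w: "w \<in> carrier_vec ?n" "w \<noteq> 0\<^sub>v ?n" "mat_on V A *\<^sub>v w = 0\<^sub>v ?n"
      unfolding det_on_def det_0_iff_vec_prod_zero_field[OF mat_on_carrier] by auto
    define v where "v = (\<lambda>j. w $ inv_into {0..<?n} ?h j)"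
    have v: "w $ l = v (?h l)" if "l < ?n" for l
      using bij that by (simp add: v_def bij_betw_def inv_into_f_f)
    obtain l where l: "l < ?n" "w $ l \<noteq> 0"
      using w(1,2) by (metis eq_vecI carrier_vecD index_zero_vec(1) index_zero_vec(2))
    have "\<exists>i\<in>V. v i \<noteq> 0" using l v hV by force
    moreover have "(\<Sum>j\<in>V. A i j * v j) = 0" if i: "i \<in> V" for i
    proof -
      obtain k where k: "k < ?n" "i = ?h k"
        using i bij by (force simp: bij_betw_def)
      then show ?thesis using sums[OF k(1) w(1) v] w(3) by simp
    qed
    ultimately show "\<exists>v. (\<exists>i\<in>V. v i \<noteq> 0) \<and> (\<forall>i\<in>V. (\<Sum>j\<in>V. A i j * v j) = 0)" by blast
  next
    assume "\<exists>v. (\<exists>i\<in>V. v i \<noteq> 0) \<and> (\<forall>i\<in>V. (\<Sum>j\<in>V. A i j * v j) = 0)"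
    then obtain v i where v: "i \<in> V" "v i \<noteq> 0" "\<And>i. i \<in> V \<Longrightarrow> (\<Sum>j\<in>V. A i j * v j) = 0"
      by blast
    define w where "w = vec ?n (\<lambda>k. v (?h k))"
    have w: "w \<in> carrier_vec ?n" by (simp add: w_def)
    obtain k where k: "k < ?n" "i = ?h k"
      using v(1) bij by (force simp: bij_betw_def)
    have "w \<noteq> 0\<^sub>v ?n"
    proof
      assume "w = 0\<^sub>v ?n"
      then have "w $ k = 0" using k by simp
      then show False using k v(2) by (simp add: w_def)
    qed
    moreover have "mat_on V A *\<^sub>v w = 0\<^sub>v ?n"
    proof (rule eq_vecI)
      fix k assume "k < dim_vec (0\<^sub>v ?n)"
      then have k: "k < ?n" by simp
      have "(mat_on V A *\<^sub>v w) $ k = (\<Sum>j\<in>V. A (?h k) j * v j)"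
        by (rule sums[OF k w]) (simp add: w_def)
      then show "(mat_on V A *\<^sub>v w) $ k = 0\<^sub>v ?n $ k" using v(3)[OF hV[OF k]] k by simp
    qed (simp add: mat_on_def)
    ultimately show "det_on V A = 0"
      unfolding det_on_def det_0_iff_vec_prod_zero_field[OF mat_on_carrier] using w by blast
  qed
qed

text \<open>The sign of \<open>p\<close> enters once through the rows and once, after transposing,
  through the columns; its square is 1.\<close>

lemma det_permute_rows_cols:
  assumes A: "A \<in> carrier_mat n n" and p: "p permutes {0..<n}"
  shows "det (mat n n (\<lambda>(i, j). A $$ (p i, p j))) = det A"
proof -
  have lt: "p i < n" if "i < n" for i
    using permutes_in_image[OF p, of i] that by simp
  define B where "B = mat n n (\<lambda>(i, j). A $$ (p i, j))"
  have B: "B \<in> carrier_mat n n" by (simp add: B_def)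
  have "mat n n (\<lambda>(i, j). A $$ (p i, p j))
      = transpose_mat (mat n n (\<lambda>(i, j). transpose_mat B $$ (p i, j)))"
    using A by (intro eq_matI) (auto simp: B_def lt)
  then have "det (mat n n (\<lambda>(i, j). A $$ (p i, p j)))
      = det (mat n n (\<lambda>(i, j). transpose_mat B $$ (p i, j)))"
    by (simp add: det_transpose[of _ n])
  also have "\<dots> = signof p * det (transpose_mat B)"
    by (rule det_permute_rows[OF _ p]) (use B in simp)
  also have "det (transpose_mat B) = signof p * det A"
    unfolding det_transpose[OF B] unfolding B_def by (rule det_permute_rows[OF A p])
  also have "signof p * (signof p * det A) = det A"
    by (simp add: sign_def)
  finally show ?thesis .
qed

lemma det_on_conjugate:
  assumes "finite V" and p: "p permutes V"
  shows "det_on V (\<lambda>i j. A (p i) (p j)) = det_on V A"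
proof -
  let ?n = "card V" and ?h = "enum_set V"
  note bij = bij_enum_set[OF assms(1)]
  \<comment> \<open>\<open>q\<close> is \<open>p\<close> read through the enumeration, as a
    permutation of indices.\<close>
  define q where "q = (\<lambda>k. if k < ?n then inv_into {0..<?n} ?h (p (?h k)) else k)"
  have hV: "?h k \<in> V" if "k < ?n" for k
    using bij_betwE[OF bij] that by auto
  have "bij_betw (inv_into {0..<?n} ?h \<circ> (p \<circ> ?h)) {0..<?n} {0..<?n}"
    by (rule bij_betw_trans[OF bij_betw_trans[OF bij permutes_imp_bij[OF p]] bij_betw_inv_into[OF bij]])
  then have "bij_betw q {0..<?n} {0..<?n}"
    by (rule bij_betw_cong[THEN iffD1, rotated]) (simp add: q_def)
  then have q: "q permutes {0..<?n}"
    by (rule bij_imp_permutes) (simp add: q_def)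
  have hq: "?h (q k) = p (?h k)" if "k < ?n" for k
    using bij permutes_in_image[OF p] hV[OF that] that
    by (simp add: q_def bij_betw_def f_inv_into_f)
  have qlt: "q k < ?n" if "k < ?n" for k
    using permutes_in_image[OF q, of k] that by simp
  have "mat_on V (\<lambda>i j. A (p i) (p j)) = mat ?n ?n (\<lambda>(i, j). mat_on V A $$ (q i, q j))"
    by (intro eq_matI) (auto simp: mat_on_def hq qlt)
  then show ?thesis
    unfolding det_on_def using det_permute_rows_cols[OF mat_on_carrier q] by metis
qed

text \<open>A rank-one update is a bordered determinant, whose expansion along the border is affine.\<close>

lemma det_rank_one_affine:
  fixes C :: "nat \<Rightarrow> nat \<Rightarrow> 'a :: idom"
  shows "\<exists>\<alpha> \<beta>. \<forall>z. det (mat n n (\<lambda>(i, j). C i j + z * (p i * q j))) = \<alpha> + z * \<beta>"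
proof -
  \<comment> \<open>\<open>C\<close> bordered by the column \<open>p\<close>, the row
    \<open>- z * q\<close> and the corner 1. The parameter \<open>z\<close> occurs only in the last
    row, so the cofactors along that row do not depend on it.\<close>
  define W where "W = (\<lambda>z. mat (Suc n) (Suc n) (\<lambda>(i, j).
     if i < n then (if j < n then C i j else p i) else (if j < n then - z * q j else 1)))"
  define L where "L = (\<lambda>z. mat 1 n (\<lambda>(_ :: nat, j). z * q j))"
  define P where "P = mat n 1 (\<lambda>(i, _ :: nat). p i)"
  have W: "W z \<in> carrier_mat (Suc n) (Suc n)" for z by (simp add: W_def)
  have cof: "cofactor (W z) n j = cofactor (W 0) n j" if "j < Suc n" for z j
  proof -
    have "mat_delete (W z) n j = mat_delete (W 0) n j"
      using that by (intro eq_matI) (auto simp: mat_delete_def W_def)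
    then show ?thesis by (simp add: cofactor_def)
  qed
  have exp: "det (W z) = cofactor (W 0) n n + z * (\<Sum>j<n. - q j * cofactor (W 0) n j)" for z
  proof -
    have "det (W z) = (\<Sum>j<Suc n. W z $$ (n, j) * cofactor (W z) n j)"
      by (rule laplace_expansion_row[OF W]) simp
    also have "\<dots> = (\<Sum>j<Suc n. W z $$ (n, j) * cofactor (W 0) n j)"
      by (intro sum.cong) (auto simp: cof[where z = z])
    also have "\<dots> = (\<Sum>j<n. - z * q j * cofactor (W 0) n j) + cofactor (W 0) n n"
      by (simp add: W_def)
    finally show ?thesis by (simp add: sum_distrib_left mult.assoc)
  qed
  have "det (W z) = det (mat n n (\<lambda>(i, j). C i j + z * (p i * q j)))" for z
  proof -
    let ?M = "mat n n (\<lambda>(i, j). C i j + z * (p i * q j))"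
    have Weq: "W z = four_block_mat (mat n n (\<lambda>(i, j). C i j)) P (L (- z)) (1\<^sub>m 1)"
      by (intro eq_matI) (auto simp: W_def P_def L_def)
    \<comment> \<open>Adding \<open>z * q j\<close> times the last column to column \<open>j\<close>
      clears the border row and produces the rank-one update in the main block.\<close>
    have "W z * four_block_mat (1\<^sub>m n) (0\<^sub>m n 1) (L z) (1\<^sub>m 1)
        = four_block_mat ?M P (0\<^sub>m 1 n) (1\<^sub>m 1)"
      unfolding Weq
      by (subst mult_four_block_mat[of _ n n _ 1 _ 1 _ _ n _ 1])
         (auto simp: P_def L_def scalar_prod_def intro!: cong_four_block_mat eq_matI)
    then have "det (W z) * det (four_block_mat (1\<^sub>m n) (0\<^sub>m n 1) (L z) (1\<^sub>m 1))
        = det (four_block_mat ?M P (0\<^sub>m 1 n) (1\<^sub>m 1))"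
      by (subst det_mult[symmetric, of _ "Suc n"]) (auto simp: W L_def)
    moreover have "det (four_block_mat (1\<^sub>m n) (0\<^sub>m n 1) (L z) (1\<^sub>m 1)) = 1"
      by (subst det_four_block_mat_upper_right_zero[of _ n _ 1]) (auto simp: L_def)
    moreover have "det (four_block_mat ?M P (0\<^sub>m 1 n) (1\<^sub>m 1)) = det ?M"
      by (subst det_four_block_mat_lower_left_zero[of _ n _ 1]) (auto simp: P_def)
    ultimately show ?thesis by simp
  qed
  then show ?thesis using exp by metis
qed

lemma det_on_rank_one_affine:
  fixes C :: "'v \<Rightarrow> 'v \<Rightarrow> 'a :: idom"
  shows "\<exists>\<alpha> \<beta>. \<forall>z. det_on V (\<lambda>i j. C i j + z * (p i * q j)) = \<alpha> + z * \<beta>"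
  unfolding det_on_def mat_on_def
  using det_rank_one_affine[of "card V" "\<lambda>i j. C (enum_set V i) (enum_set V j)"
    "\<lambda>i. p (enum_set V i)" "\<lambda>j. q (enum_set V j)"] by simp

subsection \<open>Permutations whose orbits are the fibres of a map\<close>

text \<open>For a permutation that preserves the fibres of \<open>cl\<close>, this says that each
  fibre in \<open>V\<close> is a single cycle. The complex-valued form makes a failure yield a
  kernel vector.\<close>

definition ergodic_on :: "'v set \<Rightarrow> ('v \<Rightarrow> 'k) \<Rightarrow> ('v \<Rightarrow> 'v) \<Rightarrow> bool" where
  "ergodic_on V cl p \<longleftrightarrow> (\<forall>v :: 'v \<Rightarrow> complex. (\<forall>i\<in>V. v (p i) = v i) \<longrightarrow>
     (\<forall>i\<in>V. \<forall>j\<in>V. cl i = cl j \<longrightarrow> v i = v j))"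

text \<open>Iterates of \<open>r\<close> repeat with period the size of the orbit. Hence two
  permutations with the same orbit of \<open>r\<close> have the same coincidences among iterates,
  which makes the conjugation below well defined and injective.\<close>

lemma funpow_eq_iff_mod_card_orbit:
  assumes "permutation p"
  shows "(p ^^ k) r = (p ^^ l) r \<longleftrightarrow> k mod card (orbit p r) = l mod card (orbit p r)"
proof -
  let ?n = "funpow_dist1 p r r"
  have r: "r \<in> orbit p r" by (rule permutation_self_in_orbit[OF assms])
  have inj: "inj_on (\<lambda>n. (p ^^ n) r) {0..<?n}" by (rule inj_on_funpow_dist1[OF r])
  have card: "card (orbit p r) = ?n"
    using card_image[OF inj] orbit_conv_funpow_dist1[OF r] by simp
  have eq: "(p ^^ (m mod ?n)) r = (p ^^ m) r" for m
    by (rule funpow_mod_eq[OF funpow_dist1_prop[OF r]])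
  have "(p ^^ k) r = (p ^^ l) r \<longleftrightarrow> (p ^^ (k mod ?n)) r = (p ^^ (l mod ?n)) r"
    unfolding eq ..
  also have "\<dots> \<longleftrightarrow> k mod ?n = l mod ?n"
    using inj_onD[OF inj, of "k mod ?n" "l mod ?n"] by auto
  finally show ?thesis unfolding card .
qed

text \<open>The indicator function of an orbit is invariant, so it must be constant on the fibre
  containing the orbit.\<close>

lemma orbit_ergodic_on:
  assumes V: "finite V" and p: "p permutes V"
    and cl: "\<And>i. i \<in> V \<Longrightarrow> cl (p i) = cl i"
    and erg: "ergodic_on V cl p" and i: "i \<in> V"
  shows "orbit p i = {j \<in> V. cl j = cl i}"
proof -
  have perm: "permutation p" using V p permutation_permutes by blast
  have self: "i \<in> orbit p i" by (rule permutation_self_in_orbit[OF perm])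
  have sub: "j \<in> V \<and> cl j = cl i" if "j \<in> orbit p i" for j
    using that by induction (auto simp: permutes_in_image[OF p] cl i)
  define v where "v = (\<lambda>j. if j \<in> orbit p i then 1 else 0 :: complex)"
  have "v (p j) = v j" for j
  proof -
    have "p j \<in> orbit p i \<longleftrightarrow> j \<in> orbit p i"
      by (metis orbit.step orbit_trans orbit_swap permutation_orbit_step permutation_self_in_orbit perm)
    then show ?thesis by (simp add: v_def)
  qed
  then have const: "v j = v i" if "j \<in> V" "cl j = cl i" for j
    using erg that i unfolding ergodic_on_def by blast
  have "j \<in> orbit p i" if "j \<in> V" "cl j = cl i" for j
  proof (rule ccontr)
    assume "j \<notin> orbit p i"
    with const[OF that] self show False by (simp add: v_def)
  qed
  with sub show ?thesis by blast
qed

text \<open>Both permutations run through each fibre in one cycle of the same length. Starting from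
  a common base point \<open>r\<close> of the fibre, \<open>\<tau>\<close> sends the iterate under
  \<open>p\<close> to the iterate under \<open>q\<close> with the same exponent.\<close>

lemma ergodic_on_conjugate:
  assumes V: "finite V" and p: "p permutes V" and q: "q permutes V"
    and cl: "\<And>i. i \<in> V \<Longrightarrow> cl (p i) = cl i" "\<And>i. i \<in> V \<Longrightarrow> cl (q i) = cl i"
    and erg: "ergodic_on V cl p" "ergodic_on V cl q"
  obtains \<tau> where "\<tau> permutes V" "\<And>i. i \<in> V \<Longrightarrow> cl (\<tau> i) = cl i" "\<tau> \<circ> p = q \<circ> \<tau>"
proof -
  have perm: "permutation p" "permutation q" using V p q permutation_permutes by blast+
  have orb: "orbit p i = {j \<in> V. cl j = cl i}" "orbit q i = {j \<in> V. cl j = cl i}" if "i \<in> V" for i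
    using orbit_ergodic_on[of V p cl i] orbit_ergodic_on[of V q cl i] V p q cl erg that by simp_all
  define r where "r = (\<lambda>i. SOME j. j \<in> V \<and> cl j = cl i)"
  have r: "r i \<in> V" "cl (r i) = cl i" if "i \<in> V" for i
    using someI[of "\<lambda>j. j \<in> V \<and> cl j = cl i" i] that by (simp_all add: r_def)
  have r_cong: "r i = r j" if "cl i = cl j" for i j
    using that by (simp add: r_def)
  define k where "k = (\<lambda>i. SOME k. (p ^^ k) (r i) = i)"
  have k: "(p ^^ k i) (r i) = i" if "i \<in> V" for i
  proof -
    have "i \<in> orbit p (r i)" using orb(1)[OF r(1)[OF that]] r[OF that] that by simp
    then obtain n where "i = (p ^^ n) (r i)"
      unfolding orbit_altdef_permutation[OF perm(1)] by blast
    then have "\<exists>n. (p ^^ n) (r i) = i" by metis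
    then show ?thesis unfolding k_def by (rule someI_ex)
  qed
  \<comment> \<open>This makes the result independent of which exponent \<open>k i\<close> was
    chosen.\<close>
  have same: "(p ^^ m) (r i) = (p ^^ n) (r i) \<longleftrightarrow> (q ^^ m) (r i) = (q ^^ n) (r i)"
    if "i \<in> V" for i m n
    unfolding funpow_eq_iff_mod_card_orbit[OF perm(1)] funpow_eq_iff_mod_card_orbit[OF perm(2)]
    using orb[OF r(1)[OF that]] by simp
  define \<tau> where "\<tau> = (\<lambda>i. if i \<in> V then (q ^^ k i) (r i) else i)"
  have in_orbit: "\<tau> i \<in> {j \<in> V. cl j = cl i}" if "i \<in> V" for i
  proof -
    have "(q ^^ k i) (r i) \<in> orbit q (r i)"
      unfolding orbit_altdef_permutation[OF perm(2)] by blast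
    then show ?thesis
      using that orb(2)[OF r(1)[OF that]] r[OF that] by (simp add: \<tau>_def)
  qed
  have "inj_on \<tau> V"
  proof (rule inj_onI)
    fix i j assume ij: "i \<in> V" "j \<in> V" "\<tau> i = \<tau> j"
    then have "cl i = cl j" using in_orbit[of i] in_orbit[of j] by simp
    then have rij: "r i = r j" by (rule r_cong)
    then have "(q ^^ k i) (r i) = (q ^^ k j) (r i)" using ij by (simp add: \<tau>_def)
    then have "(p ^^ k i) (r i) = (p ^^ k j) (r i)" using same[OF ij(1)] by blast
    then show "i = j" using k[OF ij(1)] k[OF ij(2)] rij by metis
  qed
  moreover have "\<tau> ` V \<subseteq> V" using in_orbit by auto
  ultimately have "bij_betw \<tau> V V"
    using V by (simp add: bij_betw_def endo_inj_surj)
  then have perm\<tau>: "\<tau> permutes V" by (rule bij_imp_permutes) (simp add: \<tau>_def)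
  have "\<tau> (p i) = q (\<tau> i)" for i
  proof (cases "i \<in> V")
    case True
    then have pi: "p i \<in> V" by (simp add: permutes_in_image[OF p])
    have rp: "r (p i) = r i" by (rule r_cong) (simp add: cl True)
    have "(p ^^ k (p i)) (r i) = (p ^^ Suc (k i)) (r i)"
      using k[OF pi] k[OF True] rp by simp
    then have "(q ^^ k (p i)) (r i) = (q ^^ Suc (k i)) (r i)" using same[OF True] by blast
    then show ?thesis using True pi rp by (simp add: \<tau>_def)
  next
    case False
    then show ?thesis by (simp add: \<tau>_def permutes_not_in[OF p] permutes_not_in[OF q])
  qed
  then have "\<tau> \<circ> p = q \<circ> \<tau>" by (simp add: fun_eq_iff)
  then show thesis using that[of \<tau>] perm\<tau> in_orbit by auto
qed

subsection \<open>Multiaffine functions\<close>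

text \<open>Interpolation between 0 and 1, one variable at a time: an affine function of
  \<open>x\<close> is \<open>1 - x\<close> times its value at 0 plus \<open>x\<close> times its
  value at 1. Variables outside \<open>E\<close> keep their values, so that the induction can
  release them singly.\<close>

lemma multiaffine_expansion:
  fixes f :: "('e \<Rightarrow> 'a :: comm_ring_1) \<Rightarrow> 'a"
  assumes "finite E"
    and "\<And>e x. e \<in> E \<Longrightarrow> \<exists>\<alpha> \<beta>. \<forall>z. f (x(e := z)) = \<alpha> + z * \<beta>"
  shows "f x = (\<Sum>X\<in>Pow E. (\<Prod>e\<in>X. x e) * (\<Prod>e\<in>E - X. 1 - x e) *
    f (\<lambda>e. if e \<in> E then of_bool (e \<in> X) else x e))"
  using assms
proof (induction E arbitrary: x rule: finite_induct)
  case empty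
  then show ?case by simp
next
  case (insert a E)
  let ?term = "\<lambda>E x X. (\<Prod>e\<in>X. x e) * (\<Prod>e\<in>E - X. 1 - x e) *
    f (\<lambda>e. if e \<in> E then of_bool (e \<in> X) else x e)"
  have IH: "f y = (\<Sum>X\<in>Pow E. ?term E y X)" for y
    by (rule insert.IH) (use insert.prems in auto)
  obtain \<alpha> \<beta> where ab: "\<And>z. f (x(a := z)) = \<alpha> + z * \<beta>"
    using insert.prems by blast
  have "f x = (1 - x a) * f (x(a := 0)) + x a * f (x(a := 1))"
    using ab[of "x a"] ab[of 0] ab[of 1] by (simp add: algebra_simps)
  moreover have "(1 - x a) * f (x(a := 0)) = (\<Sum>X\<in>Pow E. ?term (insert a E) x X)"
  proof -
    have "(1 - x a) * ?term E (x(a := 0)) X = ?term (insert a E) x X" if "X \<in> Pow E" for X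
    proof -
      have X: "X \<subseteq> E" "a \<notin> X" "finite (E - X)" using that insert.hyps by auto
      have "(\<Prod>e\<in>X. (x(a := 0)) e) = (\<Prod>e\<in>X. x e)"
        by (rule prod.cong) (use X in auto)
      moreover have "(\<Prod>e\<in>E - X. 1 - (x(a := 0)) e) = (\<Prod>e\<in>E - X. 1 - x e)"
        by (rule prod.cong) (use insert.hyps in auto)
      moreover have "insert a E - X = insert a (E - X)" using X by auto
      moreover have "(\<lambda>e. if e \<in> E then of_bool (e \<in> X) else (x(a := 0)) e)
          = (\<lambda>e. if e \<in> insert a E then of_bool (e \<in> X) else x e)"
        using X insert.hyps by (auto simp: fun_eq_iff)
      ultimately show ?thesis using X insert.hyps by (simp add: ac_simps)
    qed
    then show ?thesis by (subst IH) (simp add: sum_distrib_left)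
  qed
  moreover have "x a * f (x(a := 1)) = (\<Sum>X\<in>insert a ` Pow E. ?term (insert a E) x X)"
  proof -
    have "x a * ?term E (x(a := 1)) X = ?term (insert a E) x (insert a X)" if "X \<in> Pow E" for X
    proof -
      have X: "X \<subseteq> E" "a \<notin> X" "finite X"
        using that insert.hyps finite_subset by auto
      have "(\<Prod>e\<in>X. (x(a := 1)) e) = (\<Prod>e\<in>X. x e)"
        by (rule prod.cong) (use X in auto)
      moreover have "(\<Prod>e\<in>E - X. 1 - (x(a := 1)) e) = (\<Prod>e\<in>E - X. 1 - x e)"
        by (rule prod.cong) (use insert.hyps in auto)
      moreover have "insert a E - insert a X = E - X" using insert.hyps by auto
      moreover have "(\<lambda>e. if e \<in> E then of_bool (e \<in> X) else (x(a := 1)) e)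
          = (\<lambda>e. if e \<in> insert a E then of_bool (e \<in> insert a X) else x e)"
        using X insert.hyps by (auto simp: fun_eq_iff)
      ultimately show ?thesis using X insert.hyps by (simp add: ac_simps)
    qed
    moreover have "inj_on (insert a) (Pow E)"
      using insert.hyps by (auto simp: inj_on_def)
    ultimately show ?thesis by (subst IH) (simp add: sum_distrib_left sum.reindex)
  qed
  moreover have "(\<Sum>X\<in>Pow (insert a E). ?term (insert a E) x X)
      = (\<Sum>X\<in>Pow E. ?term (insert a E) x X) + (\<Sum>X\<in>insert a ` Pow E. ?term (insert a E) x X)"
    unfolding Pow_insert by (rule sum.union_disjoint) (use insert.hyps in auto)
  ultimately show ?case by simp
qed

subsection \<open>Mixing along transpositions\<close>

context
  fixes s t :: "'e \<Rightarrow> 'v"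
begin

text \<open>The product, in list order, of the matrices \<open>(1 - x e) I + x e T\<close>, with
  \<open>T\<close> the transposition of \<open>s e\<close> and \<open>t e\<close>, written as an
  operator on functions. Functions are pulled back, so in the matching permutation
  \<open>twist\<close> the head of the list acts first.\<close>

primrec mix :: "('e \<Rightarrow> complex) \<Rightarrow> 'e list \<Rightarrow> ('v \<Rightarrow> complex) \<Rightarrow> 'v \<Rightarrow> complex" where
  "mix x [] w = w"
| "mix x (e # es) w = (\<lambda>i. (1 - x e) * mix x es w i
     + x e * mix x es w (Transposition.transpose (s e) (t e) i))"

primrec twist :: "'e set \<Rightarrow> 'e list \<Rightarrow> 'v \<Rightarrow> 'v" where
  "twist X [] = id"
| "twist X (e # es) = twist X es \<circ> (if e \<in> X then Transposition.transpose (s e) (t e) else id)"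

lemma mix_of_bool: "mix (\<lambda>e. of_bool (e \<in> X)) es w i = w (twist X es i)"
  by (induction es arbitrary: i) auto

lemma mix_cong_weights: "(\<And>e. e \<in> set es \<Longrightarrow> x e = y e) \<Longrightarrow> mix x es w = mix y es w"
  by (induction es) auto

lemma transpose_in_iff:
  "a \<in> V \<Longrightarrow> b \<in> V \<Longrightarrow> Transposition.transpose a b i \<in> V \<longleftrightarrow> i \<in> V"
  by (metis permutes_in_image permutes_swap_id)

lemma mix_cong:
  assumes "\<And>i. i \<in> V \<Longrightarrow> w i = w' i" "\<And>e. e \<in> set es \<Longrightarrow> s e \<in> V \<and> t e \<in> V" "i \<in> V"
  shows "mix x es w i = mix x es w' i"
  using assms(2,3) by (induction es arbitrary: i) (simp_all add: assms(1) transpose_in_iff)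

lemma sum_mix:
  "(\<Sum>j\<in>A. mix x es (\<lambda>k. f j k) i * v j) = mix x es (\<lambda>k. \<Sum>j\<in>A. f j k * v j) i"
proof (induction es arbitrary: i)
  case (Cons e es)
  show ?case
    by (simp add: Cons[symmetric] sum_distrib_left distrib_right sum.distrib mult.assoc)
qed simp

text \<open>The entries of \<open>es\<close> being distinct, at most one factor contains
  \<open>x e\<close>, namely as \<open>z\<close> times the transposition minus the identity, which
  has rank at most one. The remaining factors preserve this shape.\<close>

lemma mix_rank_one:
  fixes f :: "'j \<Rightarrow> 'v \<Rightarrow> complex"
  assumes "distinct es"
  shows "\<exists>C p q. \<forall>z i j. mix (x(e := z)) es (f j) i = C i j + z * (p i * q j)"
  using assms
proof (induction es)
  case Nil
  show ?case
    by (intro exI[of _ "\<lambda>i j. f j i"] exI[of _ "\<lambda>_. 0"]) simp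
next
  case (Cons a es)
  let ?T = "Transposition.transpose (s a) (t a)"
  show ?case
  proof (cases "a = e")
    case True
    with Cons.prems have fresh: "mix (x(e := z)) es w = mix x es w" for z w
      by (intro mix_cong_weights) auto
    define q where "q = (\<lambda>j. mix x es (f j) (t a) - mix x es (f j) (s a))"
    \<comment> \<open>Transposing adds the jump \<open>q j\<close> at \<open>s a\<close> and
      subtracts it at \<open>t a\<close>.\<close>
    define p where "p = (\<lambda>i. if s a = t a then 0 else if i = s a then 1
      else if i = t a then - 1 else (0 :: complex))"
    have "mix (x(e := z)) (a # es) (f j) i = mix x es (f j) i + z * (p i * q j)" for z i j
    proof -
      have "mix x es (f j) (?T i) = mix x es (f j) i + p i * q j"
        by (auto simp: p_def q_def transpose_def)
      then have "mix (x(e := z)) (a # es) (f j) i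
          = (1 - z) * mix x es (f j) i + z * (mix x es (f j) i + p i * q j)"
        using True fresh by simp
      then show ?thesis by (simp add: algebra_simps)
    qed
    then show ?thesis by (intro exI[of _ "\<lambda>i j. mix x es (f j) i"] exI[of _ p] exI[of _ q]) blast
  next
    case False
    have "distinct es" using Cons.prems by simp
    then obtain C p q where
      C: "\<And>z i j. mix (x(e := z)) es (f j) i = C i j + z * (p i * q j)"
      using Cons.IH by blast
    define C' where "C' = (\<lambda>i j. (1 - x a) * C i j + x a * C (?T i) j)"
    define p' where "p' = (\<lambda>i. (1 - x a) * p i + x a * p (?T i))"
    have "mix (x(e := z)) (a # es) (f j) i = C' i j + z * (p' i * q j)" for z i j
      using False by (simp add: C C'_def p'_def algebra_simps)
    then show ?thesis by blast
  qed
qed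

text \<open>Each factor combines, with weights adding up to 1, the identity and a permutation that
  maps \<open>K\<close> onto itself.\<close>

lemma sum_mix_invariant:
  assumes "\<And>e. e \<in> set es \<Longrightarrow> s e \<in> K \<longleftrightarrow> t e \<in> K"
  shows "(\<Sum>i\<in>K. mix x es w i) = (\<Sum>i\<in>K. w i)"
  using assms
proof (induction es)
  case (Cons e es)
  let ?T = "Transposition.transpose (s e) (t e)"
  have "bij_betw ?T K K"
  proof (cases "s e \<in> K")
    case True
    then have "?T permutes K" using Cons.prems by (simp add: permutes_swap_id)
    then show ?thesis by (rule permutes_imp_bij)
  next
    case False
    then have "i \<in> K \<Longrightarrow> ?T i = id i" for i using Cons.prems by (auto simp: transpose_def)
    then show ?thesis using bij_betw_id by (subst bij_betw_cong)
  qed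
  then have "(\<Sum>i\<in>K. mix x es w (?T i)) = (\<Sum>i\<in>K. mix x es w i)"
    by (rule sum.reindex_bij_betw)
  moreover have "(\<Sum>i\<in>K. mix x (e # es) w i)
      = (1 - x e) * (\<Sum>i\<in>K. mix x es w i) + x e * (\<Sum>i\<in>K. mix x es w (?T i))"
    by (simp add: sum.distrib sum_distrib_left)
  ultimately show ?case using Cons by (simp add: algebra_simps)
qed simp

text \<open>In the coordinates \<open>a + b\<close> and \<open>a - b\<close> the map is diagonal
  with entries 1 and \<open>1 - 2 * x\<close>; the loss of squared norm comes from the second
  coordinate alone.\<close>

lemma norm_mix_pair:
  fixes x a b :: complex
  shows "(cmod ((1 - x) * a + x * b))\<^sup>2 + (cmod ((1 - x) * b + x * a))\<^sup>2
    = (cmod a)\<^sup>2 + (cmod b)\<^sup>2 - (1 - (cmod (1 - 2 * x))\<^sup>2) / 2 * (cmod (a - b))\<^sup>2"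
  unfolding cmod_power2 by (simp add: power2_eq_square field_simps)

lemma sum_norm_mix_step:
  fixes y :: "'v \<Rightarrow> complex"
  assumes "finite V" "a \<in> V" "b \<in> V" "a \<noteq> b"
  shows "(\<Sum>i\<in>V. (cmod ((1 - z) * y i + z * y (Transposition.transpose a b i)))\<^sup>2)
    = (\<Sum>i\<in>V. (cmod (y i))\<^sup>2) - (1 - (cmod (1 - 2 * z))\<^sup>2) / 2 * (cmod (y a - y b))\<^sup>2"
proof -
  let ?g = "\<lambda>i. (cmod ((1 - z) * y i + z * y (Transposition.transpose a b i)))\<^sup>2"
  have V: "V = insert a (insert b (V - {a, b}))" using assms by auto
  have split: "(\<Sum>i\<in>V. h i) = h a + h b + (\<Sum>i\<in>V - {a, b}. h i)" for h :: "'v \<Rightarrow> real"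
    using assms by (subst V) simp
  have "(\<Sum>i\<in>V - {a, b}. ?g i) = (\<Sum>i\<in>V - {a, b}. (cmod (y i))\<^sup>2)"
    by (intro sum.cong) (auto simp: algebra_simps)
  then show ?thesis
    unfolding split[of ?g] split[of "\<lambda>i. (cmod (y i))\<^sup>2"]
    using norm_mix_pair[of z "y a" "y b"] by simp
qed

text \<open>Every factor loses a positive multiple of the squared jump across its pair. Equality
  overall therefore forces all jumps to vanish, and then every factor acts as the identity on
  \<open>w\<close>.\<close>

lemma mix_contraction:
  assumes V: "finite V" and st: "\<And>e. e \<in> set es \<Longrightarrow> s e \<in> V \<and> t e \<in> V \<and> s e \<noteq> t e"
    and x: "\<And>e. e \<in> set es \<Longrightarrow> cmod (1 - 2 * x e) < 1"
  shows "(\<Sum>i\<in>V. (cmod (mix x es w i))\<^sup>2) \<le> (\<Sum>i\<in>V. (cmod (w i))\<^sup>2) \<and>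
    ((\<Sum>i\<in>V. (cmod (mix x es w i))\<^sup>2) = (\<Sum>i\<in>V. (cmod (w i))\<^sup>2) \<longrightarrow>
      (\<forall>i\<in>V. mix x es w i = w i) \<and> (\<forall>e\<in>set es. w (s e) = w (t e)))"
  using st x
proof (induction es)
  case (Cons e es)
  let ?y = "mix x es w"
  let ?d = "(1 - (cmod (1 - 2 * x e))\<^sup>2) / 2 * (cmod (?y (s e) - ?y (t e)))\<^sup>2"
  have IH: "(\<Sum>i\<in>V. (cmod (?y i))\<^sup>2) \<le> (\<Sum>i\<in>V. (cmod (w i))\<^sup>2) \<and>
    ((\<Sum>i\<in>V. (cmod (?y i))\<^sup>2) = (\<Sum>i\<in>V. (cmod (w i))\<^sup>2) \<longrightarrow>
      (\<forall>i\<in>V. ?y i = w i) \<and> (\<forall>e\<in>set es. w (s e) = w (t e)))"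
    by (rule Cons.IH) (use Cons.prems in auto)
  have e: "s e \<in> V" "t e \<in> V" "s e \<noteq> t e" using Cons.prems by auto
  have step: "(\<Sum>i\<in>V. (cmod (mix x (e # es) w i))\<^sup>2) = (\<Sum>i\<in>V. (cmod (?y i))\<^sup>2) - ?d"
    using sum_norm_mix_step[OF V e, of "x e" ?y] by simp
  have "(cmod (1 - 2 * x e))\<^sup>2 < 1"
    using Cons.prems(2)[of e] by (simp add: power_less_one_iff)
  then have pos: "0 < (1 - (cmod (1 - 2 * x e))\<^sup>2) / 2" by simp
  then have d: "?d \<ge> 0" by simp
  show ?case
  proof (intro conjI impI)
    show "(\<Sum>i\<in>V. (cmod (mix x (e # es) w i))\<^sup>2) \<le> (\<Sum>i\<in>V. (cmod (w i))\<^sup>2)"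
      using step d IH by linarith
  next
    assume "(\<Sum>i\<in>V. (cmod (mix x (e # es) w i))\<^sup>2) = (\<Sum>i\<in>V. (cmod (w i))\<^sup>2)"
    with step d IH have "?d = 0" "(\<Sum>i\<in>V. (cmod (?y i))\<^sup>2) = (\<Sum>i\<in>V. (cmod (w i))\<^sup>2)"
      by linarith+
    with IH pos have y: "?y (s e) = ?y (t e)" "\<And>i. i \<in> V \<Longrightarrow> ?y i = w i"
      "\<forall>e\<in>set es. w (s e) = w (t e)" by auto
    then have "w (s e) = w (t e)" using e by metis
    with y(3) show "\<forall>e\<in>set (e # es). w (s e) = w (t e)" by simp
    have "mix x (e # es) w i = w i" if "i \<in> V" for i
    proof -
      have "?y (Transposition.transpose (s e) (t e) i) = ?y i"
        using y(1) by (auto simp: transpose_def)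
      then show ?thesis using y(2)[OF that] by (simp add: algebra_simps)
    qed
    then show "\<forall>i\<in>V. mix x (e # es) w i = w i" by blast
  qed
qed simp

lemma twist_permutes:
  "(\<And>e. e \<in> set es \<Longrightarrow> s e \<in> V \<and> t e \<in> V) \<Longrightarrow> twist X es permutes V"
  by (induction es) (auto simp: permutes_id intro!: permutes_compose permutes_swap_id)

lemma twist_invariant:
  "(\<And>e. e \<in> set es \<Longrightarrow> cl (s e) = cl (t e)) \<Longrightarrow> cl (twist X es i) = cl i"
  by (induction es arbitrary: i) (auto simp: transpose_def)

lemma sign_twist:
  assumes "finite V" "distinct es" "\<And>e. e \<in> set es \<Longrightarrow> s e \<in> V \<and> t e \<in> V \<and> s e \<noteq> t e"
  shows "sign (twist X es) = (- 1) ^ card (X \<inter> set es)"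
  using assms(2,3)
proof (induction es)
  case (Cons e es)
  have "twist X es permutes V" by (rule twist_permutes) (use Cons.prems in auto)
  then have perm: "permutation (twist X es)" using assms(1) permutation_permutes by blast
  have IH: "sign (twist X es) = (- 1) ^ card (X \<inter> set es)"
    by (rule Cons.IH) (use Cons.prems in auto)
  show ?case
  proof (cases "e \<in> X")
    case True
    have "sign (twist X (e # es)) = sign (twist X es) * sign (Transposition.transpose (s e) (t e))"
      unfolding twist.simps using True perm by (simp add: sign_compose permutation_swap_id)
    moreover have "card (X \<inter> set (e # es)) = Suc (card (X \<inter> set es))"
      using True Cons.prems(1) by simp
    ultimately show ?thesis using Cons.prems(2)[of e]
      by (simp only: IH) (simp add: sign_swap_id)
  qed (simp add: IH)
qed simp

end

subsection \<open>The stable determinant of a family of transpositions\<close>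

text \<open>The common abstraction of the orientable and the pseudo-orientable case.
  \<open>cl_p0\<close> and \<open>cl_ends\<close> say that \<open>p0\<close> and the transpositions
  stay inside the fibres of \<open>cl\<close>; \<open>cl_generated\<close> says, in terms of
  functions, that together they connect each fibre.\<close>

locale swap_family =
  fixes V :: "'v set" and p0 :: "'v \<Rightarrow> 'v" and es :: "'e list" and s t :: "'e \<Rightarrow> 'v"
    and cl :: "'v \<Rightarrow> 'k"
  assumes finite_V: "finite V" and p0: "p0 permutes V" and distinct_es: "distinct es"
    and ends: "\<And>e. e \<in> set es \<Longrightarrow> s e \<in> V \<and> t e \<in> V \<and> s e \<noteq> t e"
    and cl_p0: "\<And>i. i \<in> V \<Longrightarrow> cl (p0 i) = cl i"
    and cl_ends: "\<And>e. e \<in> set es \<Longrightarrow> cl (s e) = cl (t e)"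
    and cl_generated: "\<And>v :: 'v \<Rightarrow> complex. \<lbrakk>\<And>i. i \<in> V \<Longrightarrow> v (p0 i) = v i;
      \<And>e. e \<in> set es \<Longrightarrow> v (s e) = v (t e)\<rbrakk> \<Longrightarrow> \<forall>i\<in>V. \<forall>j\<in>V. cl i = cl j \<longrightarrow> v i = v j"
begin

definition perm :: "'e set \<Rightarrow> 'v \<Rightarrow> 'v" where
  "perm X = p0 \<circ> twist s t X es"

definition feasible :: "'e set \<Rightarrow> bool" where
  "feasible X \<longleftrightarrow> X \<subseteq> set es \<and> ergodic_on V cl (perm X)"

text \<open>Without the last summand the matrices of interest would always be singular, since
  functions constant on classes are fixed. Adding the indicator of equal classes removes exactly
  this kernel and still annihilates functions with zero class sums.\<close>

definition laplacian :: "('v \<Rightarrow> 'v \<Rightarrow> complex) \<Rightarrow> 'v \<Rightarrow> 'v \<Rightarrow> complex" where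
  "laplacian M i j = of_bool (i = j) - M i j + of_bool (cl i = cl j)"

text \<open>The matrix of the operator that first composes with \<open>p0\<close> and then mixes;
  column \<open>j\<close> is the image of the indicator of \<open>j\<close>. At 0/1 weights it is
  the permutation matrix of \<open>perm X\<close>.\<close>

definition mix_mat :: "('e \<Rightarrow> complex) \<Rightarrow> 'v \<Rightarrow> 'v \<Rightarrow> complex" where
  "mix_mat x i j = mix s t x es (\<lambda>k. of_bool (j = p0 k)) i"

definition stable_det :: "('e \<Rightarrow> complex) \<Rightarrow> complex" where
  "stable_det x = det_on V (laplacian (mix_mat x))"

lemma perm_permutes: "perm X permutes V"
  unfolding perm_def using ends by (intro permutes_compose twist_permutes p0) auto

lemma cl_perm: "i \<in> V \<Longrightarrow> cl (perm X i) = cl i"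
  using twist_permutes[of es s V t X] ends cl_p0 twist_invariant[of es cl s t X i, OF cl_ends]
  by (simp add: perm_def permutes_in_image)

lemma sign_perm: "X \<subseteq> set es \<Longrightarrow> sign (perm X) = sign p0 * (- 1) ^ card X"
proof -
  assume X: "X \<subseteq> set es"
  have tw: "twist s t X es permutes V" using ends by (intro twist_permutes) auto
  have "sign (perm X) = sign p0 * sign (twist s t X es)"
    unfolding perm_def using tw p0 finite_V permutation_permutes by (blast intro: sign_compose)
  also have "sign (twist s t X es) = (- 1) ^ card (X \<inter> set es)"
    by (rule sign_twist[OF finite_V distinct_es ends])
  also have "X \<inter> set es = X" using X by blast
  finally show ?thesis .
qed

lemma feasible_conjugate:
  assumes "feasible X" "feasible Y"
  obtains \<tau> where "\<tau> permutes V" "\<And>i. i \<in> V \<Longrightarrow> cl (\<tau> i) = cl i" "\<tau> \<circ> perm X = perm Y \<circ> \<tau>"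
proof -
  have "ergodic_on V cl (perm X)" "ergodic_on V cl (perm Y)"
    using assms by (simp_all add: feasible_def)
  then show ?thesis
    by (rule ergodic_on_conjugate[OF finite_V perm_permutes perm_permutes, rotated 2])
      (use cl_perm that in auto)
qed

text \<open>Feasible sets give conjugate permutations, hence equal signs, and each element of the
  set contributes a factor -1.\<close>

lemma feasible_parity:
  assumes "feasible X" "feasible Y"
  shows "even (card X) \<longleftrightarrow> even (card Y)"
proof -
  obtain \<tau> where \<tau>: "\<tau> permutes V" "\<tau> \<circ> perm X = perm Y \<circ> \<tau>"
    using feasible_conjugate[OF assms] by blast
  have "permutation \<tau>" "permutation (perm X)" "permutation (perm Y)"
    using \<tau>(1) perm_permutes finite_V permutation_permutes by blast+
  then have "sign \<tau> * sign (perm X) = sign (perm Y) * sign \<tau>"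
    using \<tau>(2) sign_compose by metis
  then have "sign (perm X) = sign (perm Y)" by simp
  then have "(- 1 :: int) ^ card X = (- 1) ^ card Y"
    using assms by (simp add: feasible_def sign_perm)
  then show ?thesis by (cases "even (card X)"; cases "even (card Y)") auto
qed

lemma laplacian_apply:
  assumes "i \<in> V"
  shows "(\<Sum>j\<in>V. laplacian M i j * v j)
    = v i - (\<Sum>j\<in>V. M i j * v j) + (\<Sum>j | j \<in> V \<and> cl j = cl i. v j)"
proof -
  have "(\<Sum>j\<in>V. laplacian M i j * v j) = (\<Sum>j\<in>V. of_bool (i = j) * v j)
      - (\<Sum>j\<in>V. M i j * v j) + (\<Sum>j\<in>V. of_bool (cl i = cl j) * v j)"
    by (simp add: laplacian_def algebra_simps sum.distrib sum_subtractf)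
  also have "(\<Sum>j\<in>V. of_bool (i = j) * v j) = v i"
    using assms finite_V by (simp add: of_bool_def if_distrib[of "\<lambda>z. z * _"] cong: if_cong)
  also have "(\<Sum>j\<in>V. of_bool (cl i = cl j) * v j) = (\<Sum>j | j \<in> V \<and> cl j = cl i. v j)"
    using finite_V by (intro sum.mono_neutral_cong_right) auto
  finally show ?thesis .
qed

lemma mix_mat_apply:
  assumes "i \<in> V"
  shows "(\<Sum>j\<in>V. mix_mat x i j * v j) = mix s t x es (\<lambda>k. v (p0 k)) i"
proof -
  have "(\<Sum>j\<in>V. mix_mat x i j * v j) = mix s t x es (\<lambda>k. \<Sum>j\<in>V. of_bool (j = p0 k) * v j) i"
    unfolding mix_mat_def by (rule sum_mix)
  also have "\<dots> = mix s t x es (\<lambda>k. v (p0 k)) i"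
  proof (rule mix_cong[of V])
    fix k assume "k \<in> V"
    then have "p0 k \<in> V" using p0 by (simp add: permutes_in_image)
    then show "(\<Sum>j\<in>V. of_bool (j = p0 k) * v j) = v (p0 k)"
      using finite_V by (simp add: of_bool_def if_distrib[of "\<lambda>z. z * _"] cong: if_cong)
  qed (use assms ends in auto)
  finally show ?thesis .
qed

lemma mix_mat_of_bool: "mix_mat (\<lambda>e. of_bool (e \<in> X)) i j = of_bool (j = perm X i)"
  by (simp add: mix_mat_def mix_of_bool perm_def)

text \<open>The class-preserving conjugation relabels rows and columns simultaneously. The common
  value is the constant in front of the generating function.\<close>

lemma stable_det_feasible_eq:
  assumes "feasible X" "feasible Y"
  shows "stable_det (\<lambda>e. of_bool (e \<in> X)) = stable_det (\<lambda>e. of_bool (e \<in> Y))"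
proof -
  obtain \<tau> where \<tau>: "\<tau> permutes V" "\<And>i. i \<in> V \<Longrightarrow> cl (\<tau> i) = cl i" "\<tau> \<circ> perm X = perm Y \<circ> \<tau>"
    using feasible_conjugate[OF assms] by blast
  let ?A = "\<lambda>X. laplacian (mix_mat (\<lambda>e. of_bool (e \<in> X)))"
  have "?A Y (\<tau> i) (\<tau> j) = ?A X i j" if "i \<in> V" "j \<in> V" for i j
  proof -
    have "perm Y (\<tau> i) = \<tau> (perm X i)" using \<tau>(3) by (metis comp_apply)
    then show ?thesis
      using \<tau>(2) that permutes_inj[OF \<tau>(1)]
      by (simp add: laplacian_def mix_mat_of_bool inj_eq)
  qed
  then have "det_on V (?A X) = det_on V (\<lambda>i j. ?A Y (\<tau> i) (\<tau> j))"
    by (intro det_on_cong finite_V) simp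
  also have "\<dots> = det_on V (?A Y)" by (rule det_on_conjugate[OF finite_V \<tau>(1)])
  finally show ?thesis by (simp add: stable_det_def)
qed

text \<open>Take an invariant function that is not constant on some class and subtract its class
  averages. The result is nonzero, still invariant, and has zero class sums, so it lies in the
  kernel.\<close>

lemma stable_det_infeasible:
  assumes "X \<subseteq> set es" "\<not> feasible X"
  shows "stable_det (\<lambda>e. of_bool (e \<in> X)) = 0"
proof -
  obtain v :: "'v \<Rightarrow> complex" and a b where v: "\<And>i. i \<in> V \<Longrightarrow> v (perm X i) = v i"
    and ab: "a \<in> V" "b \<in> V" "cl a = cl b" "v a \<noteq> v b"
    using assms unfolding feasible_def ergodic_on_def by blast
  define K where "K = (\<lambda>i. {j \<in> V. cl j = cl i})"
  define u where "u = (\<lambda>i. v i - (\<Sum>j\<in>K i. v j) / of_nat (card (K i)))"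
  have K_cong: "K i = K j" if "cl i = cl j" for i j using that by (simp add: K_def)
  have fin: "finite (K i)" for i using finite_V by (simp add: K_def)
  have u_perm: "u (perm X i) = u i" if "i \<in> V" for i
    using v[OF that] K_cong[OF cl_perm[OF that]] by (simp add: u_def)
  have u_sum: "(\<Sum>j\<in>K i. u j) = 0" if "i \<in> V" for i
  proof -
    have "(\<Sum>j\<in>K i. u j) = (\<Sum>j\<in>K i. v j - (\<Sum>k\<in>K i. v k) / of_nat (card (K i)))"
      unfolding u_def by (rule sum.cong) (auto simp: K_def)
    moreover have "card (K i) \<noteq> 0" using fin[of i] that by (auto simp: K_def)
    ultimately show ?thesis by (simp add: sum_subtractf)
  qed
  have "u a \<noteq> u b" using ab(4) K_cong[OF ab(3)] by (simp add: u_def)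
  then have "\<exists>i\<in>V. u i \<noteq> 0" using ab by metis
  moreover have "(\<Sum>j\<in>V. laplacian (mix_mat (\<lambda>e. of_bool (e \<in> X))) i j * u j) = 0"
    if i: "i \<in> V" for i
  proof -
    have "perm X i \<in> V" using i perm_permutes by (simp add: permutes_in_image)
    then have "(\<Sum>j\<in>V. mix_mat (\<lambda>e. of_bool (e \<in> X)) i j * u j) = u (perm X i)"
      using finite_V unfolding mix_mat_of_bool
      by (simp add: of_bool_def if_distrib[of "\<lambda>z. z * _"] cong: if_cong)
    then show ?thesis using u_sum[OF i] u_perm[OF i] laplacian_apply[OF i] by (simp add: K_def)
  qed
  ultimately show ?thesis
    unfolding stable_det_def det_on_eq_0_iff[OF finite_V] by blast
qed

text \<open>A kernel vector has zero class sums, so it is fixed by a contraction that is strict across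
  every pair of ends; hence it is constant on classes and vanishes.\<close>

lemma stable_det_nonzero:
  assumes x: "\<And>e. e \<in> set es \<Longrightarrow> cmod (1 - 2 * x e) < 1"
  shows "stable_det x \<noteq> 0"
proof
  assume "stable_det x = 0"
  then obtain v i0 where v0: "i0 \<in> V" "v i0 \<noteq> 0"
    and v: "\<And>i. i \<in> V \<Longrightarrow> (\<Sum>j\<in>V. laplacian (mix_mat x) i j * v j) = 0"
    unfolding stable_det_def det_on_eq_0_iff[OF finite_V] by blast
  define K where "K = (\<lambda>i. {j \<in> V. cl j = cl i})"
  define w where "w = (\<lambda>k. v (p0 k))"
  have K: "finite (K i)" "K i \<subseteq> V" for i using finite_V by (auto simp: K_def)
  have eq: "v i - mix s t x es w i + (\<Sum>j\<in>K i. v j) = 0" if "i \<in> V" for i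
    using v[OF that] laplacian_apply[OF that] mix_mat_apply[OF that] by (simp add: K_def w_def)
  \<comment> \<open>Summing the kernel equation over a class: mixing and \<open>p0\<close> preserve
    class sums, so the first two terms cancel, leaving the size of the class times the class
    sum.\<close>
  have sum0: "(\<Sum>j\<in>K i. v j) = 0" if i: "i \<in> V" for i
  proof -
    have "(\<Sum>k\<in>K i. mix s t x es w k) = (\<Sum>k\<in>K i. w k)"
      by (rule sum_mix_invariant) (use ends cl_ends in \<open>auto simp: K_def\<close>)
    also have "\<dots> = (\<Sum>k\<in>K i. v k)"
    proof -
      have "inj_on p0 (K i)" using permutes_inj[OF p0] by (simp add: inj_on_def)
      moreover have "p0 ` K i \<subseteq> K i"
        using cl_p0 p0 by (auto simp: K_def permutes_in_image)
      ultimately have "bij_betw p0 (K i) (K i)" using K(1) by (simp add: bij_betw_def endo_inj_surj)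
      then show ?thesis unfolding w_def by (rule sum.reindex_bij_betw)
    qed
    finally have *: "(\<Sum>k\<in>K i. mix s t x es w k) = (\<Sum>k\<in>K i. v k)" .
    have "(\<Sum>k\<in>K i. v k - mix s t x es w k + (\<Sum>j\<in>K k. v j)) = 0"
      using K(2) eq by (intro sum.neutral) blast
    moreover have "(\<Sum>k\<in>K i. \<Sum>j\<in>K k. v j) = (\<Sum>k\<in>K i. \<Sum>j\<in>K i. v j)"
      by (rule sum.cong) (auto simp: K_def)
    ultimately have "of_nat (card (K i)) * (\<Sum>j\<in>K i. v j) = 0"
      using * by (simp add: sum.distrib sum_subtractf)
    moreover have "card (K i) \<noteq> 0" using K(1)[of i] i by (auto simp: K_def)
    ultimately show ?thesis by simp
  qed
  have fix_v: "mix s t x es w i = v i" if "i \<in> V" for i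
    using eq[OF that] sum0[OF that] by simp
  \<comment> \<open>Composing with \<open>p0\<close> only permutes the coordinates, so
    \<open>w\<close> and its mixed image have equal norm: the equality case of the
    contraction.\<close>
  have "(\<Sum>i\<in>V. (cmod (mix s t x es w i))\<^sup>2) = (\<Sum>i\<in>V. (cmod (v i))\<^sup>2)"
    using fix_v by simp
  also have "\<dots> = (\<Sum>i\<in>V. (cmod (w i))\<^sup>2)"
    unfolding w_def by (rule sum.reindex_bij_betw[OF permutes_imp_bij[OF p0], symmetric])
  finally have w: "\<forall>i\<in>V. mix s t x es w i = w i" "\<forall>e\<in>set es. w (s e) = w (t e)"
    using mix_contraction[OF finite_V, of es s t x w] ends x by auto
  then have vw: "v i = w i" if "i \<in> V" for i using fix_v that by metis
  have "\<forall>i\<in>V. \<forall>j\<in>V. cl i = cl j \<longrightarrow> v i = v j"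
  proof (rule cl_generated)
    show "v (p0 i) = v i" if "i \<in> V" for i using vw[OF that] by (simp add: w_def)
    show "v (s e) = v (t e)" if "e \<in> set es" for e
      using w(2) vw ends[OF that] that by metis
  qed
  then have "v j = v i0" if "j \<in> K i0" for j
    using v0(1) that unfolding K_def by blast
  then have "(\<Sum>j\<in>K i0. v j) = (\<Sum>j\<in>K i0. v i0)" by (rule sum.cong[OF refl])
  then have "of_nat (card (K i0)) * v i0 = 0" using sum0[OF v0(1)] by simp
  moreover have "card (K i0) \<noteq> 0" using K(1)[of i0] v0(1) by (auto simp: K_def)
  ultimately show False using v0(2) by simp
qed

text \<open>Each weight enters the matrix through a rank-one term, so the determinant is affine in
  it, and only its values at 0/1 points matter.\<close>

lemma stable_det_expansion:
  "stable_det x = (\<Sum>X\<in>Pow (set es). (\<Prod>e\<in>X. x e) * (\<Prod>e\<in>set es - X. 1 - x e) *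
     stable_det (\<lambda>e. of_bool (e \<in> X)))"
proof -
  have "stable_det x = (\<Sum>X\<in>Pow (set es). (\<Prod>e\<in>X. x e) * (\<Prod>e\<in>set es - X. 1 - x e) *
     stable_det (\<lambda>e. if e \<in> set es then of_bool (e \<in> X) else x e))"
  proof (rule multiaffine_expansion)
    fix e and x :: "'e \<Rightarrow> complex"
    obtain C p q where C: "\<And>z i j. mix s t (x(e := z)) es (\<lambda>k. of_bool (j = p0 k)) i
        = C i j + z * (p i * q j)"
      using mix_rank_one[OF distinct_es, of s t x e "\<lambda>j k. of_bool (j = p0 k)"] by blast
    have "laplacian (mix_mat (x(e := z))) = (\<lambda>i j. (of_bool (i = j) - C i j + of_bool (cl i = cl j))
        + z * (- p i * q j))" for z
      by (simp add: fun_eq_iff laplacian_def mix_mat_def C)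
    then show "\<exists>\<alpha> \<beta>. \<forall>z. stable_det (x(e := z)) = \<alpha> + z * \<beta>"
      unfolding stable_det_def by (simp only: det_on_rank_one_affine)
  qed simp
  moreover have "stable_det (\<lambda>e. if e \<in> set es then of_bool (e \<in> X) else x e)
      = stable_det (\<lambda>e. of_bool (e \<in> X))" for X
  proof -
    have "mix_mat (\<lambda>e. if e \<in> set es then of_bool (e \<in> X) else x e) = mix_mat (\<lambda>e. of_bool (e \<in> X))"
      unfolding mix_mat_def fun_eq_iff by (auto intro!: fun_cong[OF mix_cong_weights])
    then show ?thesis by (simp add: stable_det_def)
  qed
  ultimately show ?thesis by simp
qed

text \<open>With the chosen weights an element of \<open>es\<close> contributes
  \<open>z / (1 + z)\<close> to the term of \<open>X\<close> if it lies in the symmetric difference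
  of \<open>S\<close> and \<open>X\<close>, and \<open>1 / (1 + z)\<close> otherwise. All terms
  share the denominator, which leaves the distance generating function.\<close>

lemma feasible_stable:
  fixes z :: complex
  assumes z: "Re z > 0" and S: "S \<subseteq> set es"
  shows "(\<Sum>X | feasible X. z ^ card ((S - X) \<union> (X - S))) \<noteq> 0"
proof
  let ?E = "set es" and ?D = "\<lambda>X. stable_det (\<lambda>e. of_bool (e \<in> X))"
  assume zero: "(\<Sum>X | feasible X. z ^ card ((S - X) \<union> (X - S))) = 0"
  define x where "x = (\<lambda>e. (if e \<in> S then 1 else z) / (1 + z))"
  have nz: "1 + z \<noteq> 0"
  proof
    assume "1 + z = 0"
    then have "Re (1 + z) = 0" by simp
    with z show False by simp
  qed
  have lt: "cmod (1 - z) < cmod (1 + z)"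
  proof -
    have "(cmod (1 - z))\<^sup>2 < (cmod (1 + z))\<^sup>2"
      unfolding cmod_power2 using z by (simp add: power2_eq_square algebra_simps)
    then show ?thesis by (rule power2_less_imp_less) simp
  qed
  have "cmod (1 - 2 * x e) < 1" for e
  proof -
    have "1 - 2 * x e = (if e \<in> S then - (1 - z) else 1 - z) / (1 + z)"
      using nz by (simp add: x_def field_simps)
    then have "cmod (1 - 2 * x e) = cmod (1 - z) / cmod (1 + z)"
      by (simp add: norm_divide norm_minus_commute)
    then show ?thesis using lt nz by (simp add: divide_less_eq)
  qed
  then have "stable_det x \<noteq> 0" by (intro stable_det_nonzero) simp
  moreover have weight: "(\<Prod>e\<in>X. x e) * (\<Prod>e\<in>?E - X. 1 - x e)
      = z ^ card ((S - X) \<union> (X - S)) / (1 + z) ^ card ?E" if X: "X \<subseteq> ?E" for X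
  proof -
    let ?g = "\<lambda>e. (if e \<in> (S - X) \<union> (X - S) then z else 1) / (1 + z)"
    have "(\<Prod>e\<in>X. x e) = (\<Prod>e\<in>X. ?g e)"
      by (rule prod.cong) (auto simp: x_def)
    moreover have "(\<Prod>e\<in>?E - X. 1 - x e) = (\<Prod>e\<in>?E - X. ?g e)"
      by (rule prod.cong) (use nz in \<open>auto simp: x_def field_simps\<close>)
    moreover have "(\<Prod>e\<in>X. ?g e) * (\<Prod>e\<in>?E - X. ?g e) = (\<Prod>e\<in>?E. ?g e)"
      using prod.subset_diff[OF X, of ?g] by (simp add: mult.commute)
    moreover have "(\<Prod>e\<in>?E. ?g e) = z ^ card ((S - X) \<union> (X - S)) / (1 + z) ^ card ?E"
    proof -
      have "?E \<inter> {e. e \<in> (S - X) \<union> (X - S)} = (S - X) \<union> (X - S)" using S X by auto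
      then show ?thesis by (simp add: prod_dividef prod.If_cases)
    qed
    ultimately show ?thesis by simp
  qed
  moreover have "stable_det x = 0"
  proof (cases "\<exists>Y. feasible Y")
    case True
    then obtain Y where Y: "feasible Y" by blast
    have "(\<Prod>e\<in>X. x e) * (\<Prod>e\<in>?E - X. 1 - x e) * ?D X
        = (if feasible X then z ^ card ((S - X) \<union> (X - S)) else 0) * (?D Y / (1 + z) ^ card ?E)"
      if "X \<in> Pow ?E" for X
      using that weight[of X] stable_det_infeasible[of X] stable_det_feasible_eq[of X Y] Y by auto
    then have "stable_det x = (\<Sum>X\<in>Pow ?E. (if feasible X then z ^ card ((S - X) \<union> (X - S)) else 0)
        * (?D Y / (1 + z) ^ card ?E))"
      by (subst stable_det_expansion) (rule sum.cong, auto)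
    also have "\<dots> = (\<Sum>X\<in>Pow ?E. (if feasible X then z ^ card ((S - X) \<union> (X - S)) else 0))
        * (?D Y / (1 + z) ^ card ?E)"
      by (rule sum_distrib_right[symmetric])
    also have "(\<Sum>X\<in>Pow ?E. (if feasible X then z ^ card ((S - X) \<union> (X - S)) else 0))
        = (\<Sum>X | feasible X. z ^ card ((S - X) \<union> (X - S)))"
      by (rule sum.mono_neutral_cong_right) (auto simp: feasible_def)
    finally show ?thesis using zero by simp
  next
    \<comment> \<open>Without feasible sets the expansion would vanish as well, so nonvanishing also
      shows that a feasible set exists.\<close>
    case False
    then show ?thesis by (subst stable_det_expansion) (simp add: stable_det_infeasible)
  qed
  ultimately show False by simp
qed

end

subsection \<open>Newton's inequalities\<close>

text \<open>Strict positivity up to \<open>d\<close> is carried through the induction and later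
  gives the absence of internal zeros. Above \<open>d\<close> the quotients are 0 divided by 0, that
  is 0.\<close>

definition ulc_upto :: "nat \<Rightarrow> (nat \<Rightarrow> real) \<Rightarrow> bool" where
  "ulc_upto d a \<longleftrightarrow> (\<forall>k\<le>d. a k > 0) \<and> (\<forall>k>d. a k = 0) \<and>
     (\<forall>k. a k / real (d choose k) * (a (k + 2) / real (d choose (k + 2)))
        \<le> (a (k + 1) / real (d choose (k + 1)))\<^sup>2)"

text \<open>The right side minus the left side is the sum of the slacks in the three product
  inequalities, weighted by \<open>r\<^sup>2\<close>, \<open>r\<close> and 1, plus the square of
  \<open>r * C - B\<close>. The identity behind it is
  \<open>2 J K - (J + 1)(K + 1) = (J - 1)(K - 1) - 2\<close>.\<close>

lemma newton_step_inequality: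
  fixes r A B C D K J :: real
  assumes "r \<ge> 0" and "(J\<^sup>2 - 1) * (B * D) \<le> (J\<^sup>2 - 1) * C\<^sup>2"
    and "(K - 1) * (J - 1) * (A * D) \<le> (K - 1) * (J - 1) * (B * C)"
    and "(K\<^sup>2 - 1) * (A * C) \<le> (K\<^sup>2 - 1) * B\<^sup>2"
  shows "((J + 1) * r * B + (K - 1) * A) * ((J - 1) * r * D + (K + 1) * C) \<le> (J * r * C + K * B)\<^sup>2"
proof -
  have "r\<^sup>2 * ((J\<^sup>2 - 1) * (B * D)) \<le> r\<^sup>2 * ((J\<^sup>2 - 1) * C\<^sup>2)"
    using assms(2) by (rule mult_left_mono) simp
  moreover have "r * ((K - 1) * (J - 1) * (A * D)) \<le> r * ((K - 1) * (J - 1) * (B * C))"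
    using assms(3,1) by (rule mult_left_mono)
  moreover have "(r * C - B)\<^sup>2 \<ge> 0" by simp
  ultimately show ?thesis using assms(4) by (simp add: power2_eq_square algebra_simps)
qed

text \<open>Passage from a polynomial to its product with \<open>x + r\<close>. By the absorption
  identities, \<open>Suc d\<close> times the new normalised coefficient at \<open>k\<close> is
  \<open>(Suc d - k) r \<alpha> k + k \<alpha> (k - 1)\<close>; this is the origin of the
  coefficients in \<open>newton_step_inequality\<close>, with \<open>J = d - k\<close> and
  \<open>K = k + 1\<close>.\<close>

lemma ulc_upto_mult_linear:
  assumes a: "ulc_upto d a" and r: "r > 0"
  shows "ulc_upto (Suc d) (\<lambda>k. r * a k + (if k = 0 then 0 else a (k - 1)))"
proof -
  define \<alpha> where "\<alpha> = (\<lambda>k. a k / real (d choose k))"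
  define b where "b = (\<lambda>k. r * a k + (if k = 0 then 0 else a (k - 1)))"
  have pos: "a k > 0" if "k \<le> d" for k using a that by (simp add: ulc_upto_def)
  have zero: "a k = 0" if "k > d" for k using a that by (simp add: ulc_upto_def)
  have \<alpha>_pos: "\<alpha> k > 0" if "k \<le> d" for k using pos[OF that] that by (simp add: \<alpha>_def)
  have lc: "\<alpha> k * \<alpha> (k + 2) \<le> (\<alpha> (k + 1))\<^sup>2" for k using a by (simp add: ulc_upto_def \<alpha>_def)
  have \<alpha>_nonneg: "\<alpha> k \<ge> 0" for k
    using pos[of k] zero[of k] by (cases "k \<le> d") (auto simp: \<alpha>_def)
  have a_eq: "a k = \<alpha> k * real (d choose k)" for k
    using zero[of k] by (cases "k \<le> d") (auto simp: \<alpha>_def)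
  have ch1: "real (Suc d) * real (d choose k) = (real (Suc d) - real k) * real (Suc d choose k)" for k
  proof (cases "k \<le> Suc d")
    case True
    have "Suc d * (d choose k) = (Suc d - k) * (Suc d choose k)"
      using binomial_absorb_comp[of "Suc d" k] by simp
    then have "real (Suc d * (d choose k)) = real ((Suc d - k) * (Suc d choose k))" by (rule arg_cong)
    then show ?thesis unfolding of_nat_mult using True by (simp only: of_nat_diff)
  qed (simp add: binomial_eq_0)
  have ch2: "real (Suc d) * real (d choose k) = real (Suc k) * real (Suc d choose Suc k)" for k
    using Suc_times_binomial_eq[of d k] by (metis of_nat_mult mult.commute)
  have \<beta>0: "real (Suc d) * (b 0 / real (Suc d choose 0)) = real (Suc d) * r * \<alpha> 0"
    by (simp add: b_def a_eq)
  have \<beta>: "real (Suc d) * (b (Suc k) / real (Suc d choose Suc k))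
      = (real (Suc d) - real (Suc k)) * r * \<alpha> (Suc k) + real (Suc k) * \<alpha> k" if "k \<le> d" for k
  proof -
    have "real (Suc d) * b (Suc k) = r * \<alpha> (Suc k) * (real (Suc d) * real (d choose Suc k))
        + \<alpha> k * (real (Suc d) * real (d choose k))"
      by (simp add: b_def a_eq algebra_simps)
    also have "\<dots> = ((real (Suc d) - real (Suc k)) * r * \<alpha> (Suc k) + real (Suc k) * \<alpha> k)
        * real (Suc d choose Suc k)"
      unfolding ch1[of "Suc k"] ch2[of k] by (simp only: algebra_simps)
    finally have "real (Suc d) * b (Suc k) = \<dots>" .
    moreover have "real (Suc d choose Suc k) \<noteq> 0"
      using that by (simp del: binomial_Suc_Suc)
    ultimately show ?thesis by (simp add: field_simps del: binomial_Suc_Suc of_nat_Suc)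
  qed
  have main: "b k / real (Suc d choose k) * (b (k + 2) / real (Suc d choose (k + 2)))
      \<le> (b (k + 1) / real (Suc d choose (k + 1)))\<^sup>2" for k
  proof (cases "k < d")
    case False
    then have "b (k + 2) = 0" by (simp add: b_def zero)
    then show ?thesis by simp
  next
    case k: True
    let ?J = "real d - real k" and ?K = "real k + 1"
    \<comment> \<open>At \<open>k = 0\<close> there is no predecessor, but its coefficient
      \<open>?K - 1\<close> is 0 there, so 0 is a safe default.\<close>
    let ?A = "if k = 0 then 0 else \<alpha> (k - 1)"
    let ?N = "real (Suc d)"
    have J: "?J \<ge> 1" using k by linarith
    have sqJ: "?J\<^sup>2 - 1 \<ge> 0" using J by simp
    have e0: "?N * (b k / real (Suc d choose k)) = (?J + 1) * r * \<alpha> k + (?K - 1) * ?A"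
    proof (cases k)
      case 0
      then show ?thesis using \<beta>0 by simp
    next
      case (Suc l)
      then show ?thesis using \<beta>[of l] k by (simp del: binomial_Suc_Suc)
    qed
    have e1: "?N * (b (k + 1) / real (Suc d choose (k + 1))) = ?J * r * \<alpha> (k + 1) + ?K * \<alpha> k"
      using \<beta>[of k] k by (simp del: binomial_Suc_Suc)
    have e2: "?N * (b (k + 2) / real (Suc d choose (k + 2)))
        = (?J - 1) * r * \<alpha> (k + 2) + (?K + 1) * \<alpha> (k + 1)"
      using \<beta>[of "k + 1"] k by (simp del: binomial_Suc_Suc)
    have A: "?A * \<alpha> (k + 1) \<le> (\<alpha> k)\<^sup>2"
    proof (cases k)
      case (Suc l)
      then show ?thesis using lc[of l] by simp
    qed simp
    \<comment> \<open>The product of two neighbouring log-concavity inequalities, divided by the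
      positive number \<open>\<alpha> k * \<alpha> (k + 1)\<close>.\<close>
    have AD: "?A * \<alpha> (k + 2) \<le> \<alpha> k * \<alpha> (k + 1)"
    proof -
      have BC: "\<alpha> k * \<alpha> (k + 1) > 0" using \<alpha>_pos[of k] \<alpha>_pos[of "k + 1"] k by simp
      have "(?A * \<alpha> (k + 1)) * (\<alpha> k * \<alpha> (k + 2)) \<le> (\<alpha> k)\<^sup>2 * (\<alpha> (k + 1))\<^sup>2"
        using A lc[of k] \<alpha>_nonneg by (intro mult_mono) auto
      then have "(?A * \<alpha> (k + 2)) * (\<alpha> k * \<alpha> (k + 1)) \<le> (\<alpha> k * \<alpha> (k + 1)) * (\<alpha> k * \<alpha> (k + 1))"
        by (simp add: power2_eq_square ac_simps)
      then show ?thesis using BC by (rule mult_right_le_imp_le)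
    qed
    have "((?J + 1) * r * \<alpha> k + (?K - 1) * ?A) * ((?J - 1) * r * \<alpha> (k + 2) + (?K + 1) * \<alpha> (k + 1))
        \<le> (?J * r * \<alpha> (k + 1) + ?K * \<alpha> k)\<^sup>2"
    proof (rule newton_step_inequality)
      show "r \<ge> 0" using r by simp
      show "(?J\<^sup>2 - 1) * (\<alpha> k * \<alpha> (k + 2)) \<le> (?J\<^sup>2 - 1) * (\<alpha> (k + 1))\<^sup>2"
        using lc sqJ by (rule mult_left_mono)
      show "(?K - 1) * (?J - 1) * (?A * \<alpha> (k + 2)) \<le> (?K - 1) * (?J - 1) * (\<alpha> k * \<alpha> (k + 1))"
        using AD J by (intro mult_left_mono) auto
      show "(?K\<^sup>2 - 1) * (?A * \<alpha> (k + 1)) \<le> (?K\<^sup>2 - 1) * (\<alpha> k)\<^sup>2"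
        using A by (intro mult_left_mono) auto
    qed
    then have "(?N * (b k / real (Suc d choose k))) * (?N * (b (k + 2) / real (Suc d choose (k + 2))))
        \<le> (?N * (b (k + 1) / real (Suc d choose (k + 1))))\<^sup>2"
      unfolding e0 e1 e2 .
    then have "?N\<^sup>2 * (b k / real (Suc d choose k) * (b (k + 2) / real (Suc d choose (k + 2))))
        \<le> ?N\<^sup>2 * (b (k + 1) / real (Suc d choose (k + 1)))\<^sup>2"
      by (simp only: power_mult_distrib power2_eq_square ac_simps)
    then show ?thesis by (rule mult_left_le_imp_le) simp
  qed
  have "b k > 0" if "k \<le> Suc d" for k
  proof (cases "k \<le> d")
    case True
    have "a (k - 1) > 0" using pos[of "k - 1"] True by simp
    then have "(if k = 0 then 0 else a (k - 1)) \<ge> 0" by simp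
    then show ?thesis using pos[OF True] r by (simp add: b_def add_pos_nonneg)
  next
    case False
    then have "k = Suc d" using that by simp
    then show ?thesis using pos[of d] zero[of "Suc d"] by (simp add: b_def)
  qed
  moreover have "b k = 0" if "k > Suc d" for k using that zero by (simp add: b_def)
  ultimately show ?thesis using main unfolding ulc_upto_def b_def[symmetric] by blast
qed

section \<open>Polynomials with nonpositive real roots and their coefficient sequences\<close>

lemma map_poly_complex_of_real_mult:
  "map_poly complex_of_real (p * q) = map_poly complex_of_real p * map_poly complex_of_real q"
  by (intro poly_eqI) (simp add: coeff_map_poly coeff_mult)

lemma poly_map_poly_complex_of_real:
  "poly (map_poly complex_of_real p) (complex_of_real x) = complex_of_real (poly p x)"
  by (simp add: poly_altdef degree_map_poly coeff_map_poly)

text \<open>Induction on the degree: the fundamental theorem of algebra supplies a complex root, the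
  hypothesis makes it \<open>- r\<close> with \<open>r > 0\<close>, and splitting off the factor
  \<open>x + r\<close> leaves a quotient satisfying the same hypotheses.\<close>

lemma ulc_upto_negative_roots:
  fixes h :: "real poly"
  assumes "lead_coeff h > 0"
    and "\<And>z. poly (map_poly complex_of_real h) z = 0 \<Longrightarrow> \<exists>r > 0. z = - complex_of_real r"
  shows "ulc_upto (degree h) (coeff h)"
  using assms
proof (induction "degree h" arbitrary: h)
  case 0
  then obtain c where "h = [:c:]" by (metis degree_eq_zeroE)
  with 0 show ?case by (auto simp: ulc_upto_def coeff_pCons split: nat.splits)
next
  case (Suc d)
  let ?c = "map_poly complex_of_real"
  have "\<not> constant (poly (?c h))"
    using Suc.hyps(2) by (simp add: constant_degree degree_map_poly)
  then obtain z where z: "poly (?c h) z = 0" using fundamental_theorem_of_algebra by blast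
  then obtain r where r: "r > 0" "z = complex_of_real (- r)" using Suc.prems(2) by force
  have "poly h (- r) = 0" using z unfolding r(2) by (simp only: poly_map_poly_complex_of_real of_real_eq_0_iff)
  then obtain g where g: "h = [:r, 1:] * g" by (metis poly_eq_0_iff_dvd dvdE minus_minus)
  then have g0: "g \<noteq> 0" using Suc.hyps(2) by auto
  have deg: "degree h = Suc (degree g)"
    unfolding g using g0 by (subst degree_mult_eq) auto
  have "ulc_upto (degree g) (coeff g)"
  proof (rule Suc.hyps(1))
    show "d = degree g" using deg Suc.hyps(2) by simp
    have "lead_coeff h = lead_coeff g" unfolding g by (simp only: lead_coeff_mult) simp
    then show "lead_coeff g > 0" using Suc.prems(1) by simp
    show "\<exists>r > 0. z = - complex_of_real r" if "poly (?c g) z = 0" for z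
    proof (rule Suc.prems(2))
      have "?c h = ?c [:r, 1:] * ?c g" unfolding g by (rule map_poly_complex_of_real_mult)
      then show "poly (?c h) z = 0" using that by (simp only: poly_mult mult_zero_right)
    qed
  qed
  then have "ulc_upto (Suc (degree g)) (\<lambda>k. r * coeff g k + (if k = 0 then 0 else coeff g (k - 1)))"
    using r(1) by (rule ulc_upto_mult_linear)
  moreover have "coeff h = (\<lambda>k. r * coeff g k + (if k = 0 then 0 else coeff g (k - 1)))"
    unfolding g by (auto simp: fun_eq_iff coeff_pCons split: nat.splits)
  ultimately show ?case using deg by simp
qed

text \<open>The support of \<open>b\<close> is the interval from \<open>l\<close> to
  \<open>l + d\<close>, so the binomials in the definition are exactly those of
  \<open>ulc_upto d\<close> after a shift by \<open>l\<close>.\<close>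

lemma ultra_log_concave_shift:
  assumes a: "ulc_upto d a"
    and b: "\<And>i. b i = (if i < int l then 0 else a (nat (i - int l)))"
  shows "ultra_log_concave b \<and> no_internal_zeros b"
proof -
  have b_zero: "b i \<noteq> 0 \<longleftrightarrow> int l \<le> i \<and> i \<le> int l + int d" for i
  proof (cases "i < int l")
    case False
    have "a k \<noteq> 0 \<longleftrightarrow> k \<le> d" for k
      using a unfolding ulc_upto_def by (metis less_irrefl not_le)
    then show ?thesis using False by (simp add: b) linarith
  qed (simp add: b)
  then have supp: "supp_seq b = {int l..int l + int d}"
    unfolding supp_seq_def by (simp add: atLeastAtMost_def atLeast_def atMost_def Collect_conj_eq)
  have mm: "Min (supp_seq b) = int l" "Max (supp_seq b) = int l + int d"
    unfolding supp by (auto intro!: Min_eqI Max_eqI)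
  have "b (i - 1) / real (d choose nat (i - 1 - int l)) * (b (i + 1) / real (d choose nat (i + 1 - int l)))
      \<le> (b i / real (d choose nat (i - int l)))\<^sup>2" for i
  proof (cases "int l \<le> i - 1")
    case True
    define k where "k = nat (i - 1 - int l)"
    have k: "nat (i - 1 - int l) = k" "nat (i - int l) = k + 1" "nat (i + 1 - int l) = k + 2"
      using True by (simp_all add: k_def nat_eq_iff)
    have "b (i - 1) = a k" "b i = a (k + 1)" "b (i + 1) = a (k + 2)"
      using True k by (simp_all add: b)
    then show ?thesis using a unfolding k ulc_upto_def by simp
  next
    \<comment> \<open>Here \<open>nat\<close> truncates the index at 0, but the left factor lies
      below the support and vanishes.\<close>
    case False
    then have "b (i - 1) = 0" using b_zero by blast
    then show ?thesis by simp
  qed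
  then show ?thesis
    unfolding ultra_log_concave_def no_internal_zeros_def log_concave_def mm
    using b_zero by (simp add: Let_def)
qed

text \<open>The principal square root of a root has nonnegative real part, so by stability it is
  purely imaginary and the root is real and nonpositive. After division by the power of
  \<open>x\<close> at 0 all roots are negative.\<close>

lemma ultra_log_concave_stable:
  fixes h :: "real poly" and b :: "int \<Rightarrow> real"
  assumes nonneg: "\<And>k. coeff h k \<ge> 0"
    and stable: "\<And>z. Re z > 0 \<Longrightarrow> poly (map_poly complex_of_real h) (z\<^sup>2) \<noteq> 0"
    and b: "\<And>i. b i = (if i < 0 then 0 else coeff h (nat i))"
  shows "ultra_log_concave b \<and> no_internal_zeros b"
proof -
  let ?c = "map_poly complex_of_real"
  have h0: "h \<noteq> 0" using stable[of 1] by auto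
  have roots: "\<exists>r\<ge>0. w = - complex_of_real r" if w: "poly (?c h) w = 0" for w
  proof -
    have "\<not> Re (csqrt w) > 0" using stable[of "csqrt w"] w by auto
    then have Re0: "Re (csqrt w) = 0" using csqrt_principal[of w] by auto
    have "w = (csqrt w)\<^sup>2" by simp
    also have "\<dots> = - complex_of_real ((Im (csqrt w))\<^sup>2)"
      using Re0 by (simp add: complex_eq_iff power2_eq_square)
    finally show ?thesis by (metis zero_le_power2)
  qed
  \<comment> \<open>The multiplicity of the root 0, which is the lowest index of the
    support.\<close>
  define l where "l = order 0 h"
  obtain g where g: "h = [:- 0, 1:] ^ l * g" "\<not> [:- 0, 1:] dvd g"
    using order_decomp[OF h0, of 0] unfolding l_def by blast
  have coeff_h: "coeff h k = (if k < l then 0 else coeff g (k - l))" for k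
    unfolding g(1) by (simp add: coeff_monom_mult monom_altdef[symmetric, of 1, simplified])
  have "ulc_upto (degree g) (coeff g)"
  proof (rule ulc_upto_negative_roots)
    have "g \<noteq> 0" using g(2) by auto
    then have "lead_coeff g \<noteq> 0" by simp
    moreover have "lead_coeff g = coeff h (degree g + l)" using coeff_h[of "degree g + l"] by simp
    ultimately show "lead_coeff g > 0" using nonneg[of "degree g + l"] by simp
    show "\<exists>r > 0. z = - complex_of_real r" if z: "poly (?c g) z = 0" for z
    proof -
      have "?c h = ?c ([:- 0, 1:] ^ l) * ?c g"
        unfolding g(1) by (simp add: map_poly_complex_of_real_mult)
      then obtain r where r: "r \<ge> 0" "z = - complex_of_real r" using roots[of z] z by auto
      have "r \<noteq> 0"
      proof
        assume "r = 0"
        then have "complex_of_real (poly g 0) = 0"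
          using z r poly_map_poly_complex_of_real[of g 0] by simp
        then show False using g(2) by (simp add: poly_eq_0_iff_dvd)
      qed
      then show ?thesis using r by (intro exI[of _ r]) auto
    qed
  qed
  moreover have "b i = (if i < int l then 0 else coeff g (nat (i - int l)))" for i
    unfolding b coeff_h by (auto simp: nat_diff_distrib)
  ultimately show ?thesis by (rule ultra_log_concave_shift)
qed

lemma even_card_sym_diff:
  assumes "finite A" "finite B"
  shows "even (card ((A - B) \<union> (B - A))) \<longleftrightarrow> (even (card A) \<longleftrightarrow> even (card B))"
proof -
  have "card A = card (A - B) + card (A \<inter> B)"
    using assms card_Diff_subset_Int[of A B] card_mono[of A "A \<inter> B"] by simp
  moreover have "card B = card (B - A) + card (A \<inter> B)"
    using assms card_Diff_subset_Int[of B A] card_mono[of B "A \<inter> B"] by (simp add: Int_commute)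
  moreover have "card ((A - B) \<union> (B - A)) = card (A - B) + card (B - A)"
    using assms by (intro card_Un_disjoint) auto
  ultimately show ?thesis by auto
qed

context swap_family
begin

lemma finite_feasible: "finite {X. feasible X}"
  by (rule finite_subset[of _ "Pow (set es)"]) (auto simp: feasible_def)

text \<open>By the common parity, \<open>2 * m X\<close> equals \<open>N X\<close> for all feasible
  \<open>X\<close> or \<open>N X + 1\<close> for all of them. So \<open>h\<close> at
  \<open>z\<^sup>2\<close> is the stable generating function or \<open>z\<close> times it.\<close>

lemma feasible_ultra_log_concave:
  assumes S: "S \<subseteq> set es"
    and b: "\<And>i. b i = (if i < 0 then 0 else
      real (card {X. feasible X \<and> int (card ((S - X) \<union> (X - S))) \<in> {2 * i - 1, 2 * i}}))"
  shows "ultra_log_concave b \<and> no_internal_zeros b"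
proof -
  define N where "N = (\<lambda>X. card ((S - X) \<union> (X - S)))"
  \<comment> \<open>The index \<open>i\<close> with \<open>N X\<close> in
    \<open>{2 * i - 1, 2 * i}\<close>: half of \<open>N X\<close>, rounded up.\<close>
  define m where "m = (\<lambda>X. (N X + 1) div 2)"
  define h :: "real poly" where "h = (\<Sum>X | feasible X. monom 1 (m X))"
  have coeff_h: "coeff h k = real (card {X. feasible X \<and> m X = k})" for k
  proof -
    have "coeff h k = (\<Sum>X | feasible X. if m X = k then 1 else 0)"
      by (simp add: h_def coeff_sum)
    also have "\<dots> = real (card {X. feasible X \<and> m X = k})"
      by (simp add: sum.If_cases[OF finite_feasible] Collect_conj_eq[symmetric])
    finally show ?thesis .
  qed
  have parity: "even (N X) \<longleftrightarrow> even (N Y)" if "feasible X" "feasible Y" for X Y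
  proof -
    have "finite S" "finite X" "finite Y"
      using S that finite_subset[OF _ finite_set] unfolding feasible_def by blast+
    then show ?thesis
      unfolding N_def using feasible_parity[OF that] by (simp add: even_card_sym_diff)
  qed
  show ?thesis
  proof (rule ultra_log_concave_stable)
    show "coeff h k \<ge> 0" for k by (simp add: coeff_h)
    show "b i = (if i < 0 then 0 else coeff h (nat i))" for i
    proof (cases "i < 0")
      case False
      then obtain j where j: "i = int j" by (metis nonneg_int_cases not_less)
      have "int n \<in> {2 * i - 1, 2 * i} \<longleftrightarrow> (n + 1) div 2 = nat i" for n
        unfolding j by simp presburger
      then show ?thesis using False by (simp add: b coeff_h m_def N_def)
    qed (simp add: b)
    show "poly (map_poly complex_of_real h) (z\<^sup>2) \<noteq> 0" if z: "Re z > 0" for z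
    proof -
      have nz: "(\<Sum>X | feasible X. z ^ N X) \<noteq> 0"
        using feasible_stable[OF z S] by (simp add: N_def)
      have "map_poly complex_of_real h = (\<Sum>X | feasible X. monom 1 (m X))"
        by (rule poly_eqI) (simp add: h_def coeff_map_poly coeff_sum if_distrib cong: if_cong)
      then have eq: "poly (map_poly complex_of_real h) (z\<^sup>2) = (\<Sum>X | feasible X. z ^ (2 * m X))"
        by (simp add: poly_sum poly_monom power_mult)
      show ?thesis
      proof (cases "\<exists>Y. feasible Y \<and> odd (N Y)")
        case True
        then obtain Y where Y: "feasible Y" "odd (N Y)" by blast
        have "2 * m X = N X + 1" if "feasible X" for X
          using parity[OF that Y(1)] Y(2) by (simp add: m_def)
        then have "(\<Sum>X | feasible X. z ^ (2 * m X)) = z * (\<Sum>X | feasible X. z ^ N X)"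
          by (simp add: sum_distrib_left)
        then show ?thesis using eq nz z by auto
      next
        case False
        have "2 * m X = N X" if "feasible X" for X
          using False that by (auto simp: m_def elim!: evenE)
        then show ?thesis using eq nz by simp
      qed
    qed
  qed
qed

end

subsection \<open>Ribbon graphs\<close>

lemma card_quotient_rtrancl_eq_1:
  assumes "K \<noteq> {}" "r \<subseteq> K \<times> K"
  shows "card (K // r\<^sup>*) = 1 \<longleftrightarrow> (\<forall>x\<in>K. \<forall>y\<in>K. (x, y) \<in> r\<^sup>*)"
proof
  assume "card (K // r\<^sup>*) = 1"
  then obtain S where S: "K // r\<^sup>* = {S}" by (auto simp: card_1_singleton_iff)
  have "r\<^sup>* `` {x} = S" if "x \<in> K" for x using that quotientI[of x K "r\<^sup>*"] S by auto
  then show "\<forall>x\<in>K. \<forall>y\<in>K. (x, y) \<in> r\<^sup>*" by blast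
next
  assume conn: "\<forall>x\<in>K. \<forall>y\<in>K. (x, y) \<in> r\<^sup>*"
  have "y \<in> K" if "(x, y) \<in> r\<^sup>*" "x \<in> K" for x y
    using that assms(2) by (induction rule: rtrancl_induct) auto
  then have "r\<^sup>* `` {x} = K" if "x \<in> K" for x using conn that by blast
  then have "K // r\<^sup>* = {K}" using assms(1) by (auto simp: quotient_def)
  then show "card (K // r\<^sup>*) = 1" by simp
qed

text \<open>One step of boundary tracing across an edge. The same map is the end involution
  \<open>sg\<close> of the partial dual, and \<open>side G (- X)\<close> is its
  \<open>bt\<close>.\<close>

definition side :: "('f, 'e) rg \<Rightarrow> 'e set \<Rightarrow> 'f \<Rightarrow> 'f" where
  "side G X x = (if edg G x \<in> X then bt G x else sg G x)"

lemma ribbon_graphD: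
  assumes "ribbon_graph G" "x \<in> flags G"
  shows "alph G x \<in> flags G" "alph G (alph G x) = x" "alph G x \<noteq> x"
    "sg G x \<in> flags G" "sg G (sg G x) = x" "sg G x \<noteq> x"
    "bt G x \<in> flags G" "bt G (bt G x) = x" "bt G x \<noteq> x"
    "sg G (bt G x) = bt G (sg G x)" "sg G x \<noteq> bt G x"
    "edg G (sg G x) = edg G x" "edg G (bt G x) = edg G x"
proof -
  show *: "alph G x \<in> flags G" "alph G (alph G x) = x" "alph G x \<noteq> x"
    "sg G x \<in> flags G" "sg G (sg G x) = x" "sg G x \<noteq> x"
    "bt G x \<in> flags G" "bt G (bt G x) = x" "bt G x \<noteq> x"
    "sg G (bt G x) = bt G (sg G x)" "sg G x \<noteq> bt G x"
    using assms unfolding ribbon_graph_def fpf_inv_def by blast+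
  have "edg G x = edg G y" if "y \<in> flags G" "y \<in> {x, sg G x, bt G x, sg G (bt G x)}" for y
    using assms that unfolding ribbon_graph_def by blast
  from this[of "sg G x"] this[of "bt G x"] *
  show "edg G (sg G x) = edg G x" "edg G (bt G x) = edg G x" by simp_all
qed

lemma ribbon_graph_edgD:
  assumes "ribbon_graph G" "x \<in> flags G" "y \<in> flags G" "edg G x = edg G y"
  shows "y \<in> {x, sg G x, bt G x, sg G (bt G x)}"
  using assms unfolding ribbon_graph_def by blast

lemma finite_flags: "ribbon_graph G \<Longrightarrow> finite (flags G)"
  by (simp add: ribbon_graph_def)

lemma sideD:
  assumes "ribbon_graph G" "x \<in> flags G"
  shows "side G X x \<in> flags G" "side G X (side G X x) = x"
  using ribbon_graphD[OF assms] by (simp_all add: side_def)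

section \<open>Components, restriction and partial duals\<close>

lemma cstep_flags: "ribbon_graph G \<Longrightarrow> cstep G \<subseteq> flags G \<times> flags G"
  using ribbon_graphD by (auto simp: cstep_def)

lemma sym_cstep: "ribbon_graph G \<Longrightarrow> sym (cstep G)"
  using ribbon_graphD by (fastforce simp: cstep_def intro!: symI)

lemma cstep_rtrancl_flags: "ribbon_graph G \<Longrightarrow> (x, y) \<in> (cstep G)\<^sup>* \<Longrightarrow> x \<in> flags G \<Longrightarrow> y \<in> flags G"
  by (erule rtrancl_induct) (use cstep_flags in auto)

lemma cstep_class_eq_iff:
  assumes "ribbon_graph G"
  shows "(cstep G)\<^sup>* `` {x} = (cstep G)\<^sup>* `` {y} \<longleftrightarrow> (x, y) \<in> (cstep G)\<^sup>*"
  using sym_rtrancl[OF sym_cstep[OF assms]]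
  by (auto dest: symD rtrancl_trans)

lemma cstepI:
  assumes "x \<in> flags G"
  shows "(x, alph G x) \<in> (cstep G)\<^sup>*" "(x, sg G x) \<in> (cstep G)\<^sup>*" "(x, bt G x) \<in> (cstep G)\<^sup>*"
    "(x, side G X x) \<in> (cstep G)\<^sup>*"
  using assms by (auto simp: cstep_def side_def intro!: r_into_rtrancl)

lemma bstep_eq: "bstep G X = {(x, y). x \<in> flags G \<and> (y = alph G x \<or> y = side G X x)}"
  by (simp add: bstep_def side_def)

lemma flag_compsE:
  assumes "K \<in> flag_comps G"
  obtains x where "x \<in> flags G" "K = (cstep G)\<^sup>* `` {x}"
  using assms by (auto simp: flag_comps_def quotient_def)

lemma flag_comps_subset: "ribbon_graph G \<Longrightarrow> K \<in> flag_comps G \<Longrightarrow> K \<subseteq> flags G"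
  by (elim flag_compsE) (auto dest: cstep_rtrancl_flags)

lemma flag_comps_closed:
  assumes "ribbon_graph G" "K \<in> flag_comps G" "x \<in> K"
  shows "alph G x \<in> K" "sg G x \<in> K" "bt G x \<in> K"
proof -
  have "x \<in> flags G" using flag_comps_subset[OF assms(1,2)] assms(3) by blast
  then show "alph G x \<in> K" "sg G x \<in> K" "bt G x \<in> K"
    using assms(2,3) cstepI[of x G] by (auto elim!: flag_compsE intro: rtrancl_trans)
qed

lemma flag_comps_connected:
  assumes "ribbon_graph G" "K \<in> flag_comps G" "x \<in> K" "y \<in> K"
  shows "(x, y) \<in> (cstep G)\<^sup>*"
  using assms by (elim flag_compsE) (metis Image_singleton_iff cstep_class_eq_iff)

lemma flag_comps_disjoint:
  assumes "ribbon_graph G" "K \<in> flag_comps G" "L \<in> flag_comps G" "x \<in> K" "x \<in> L"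
  shows "K = L"
  using assms by (elim flag_compsE) (metis Image_singleton_iff cstep_class_eq_iff)

lemma restrict_rg_simps [simp]:
  "flags (restrict_rg G K) = K" "alph (restrict_rg G K) = alph G" "sg (restrict_rg G K) = sg G"
  "bt (restrict_rg G K) = bt G" "edg (restrict_rg G K) = edg G" "rg.iso (restrict_rg G K) = 0"
  by (simp_all add: restrict_rg_def)

lemma pdual_simps [simp]:
  "flags (pdual G X) = flags G" "alph (pdual G X) = alph G" "sg (pdual G X) = side G X"
  "bt (pdual G X) = side G (- X)" "edg (pdual G X) = edg G" "rg.iso (pdual G X) = rg.iso G"
  by (auto simp: pdual_def side_def fun_eq_iff)

lemma ribbon_graph_restrict_rg:
  assumes "ribbon_graph G" "K \<in> flag_comps G"
  shows "ribbon_graph (restrict_rg G K)"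
proof -
  have sub: "K \<subseteq> flags G" by (rule flag_comps_subset[OF assms])
  then have fin: "finite K" using finite_flags[OF assms(1)] finite_subset by blast
  show ?thesis
    unfolding ribbon_graph_def fpf_inv_def restrict_rg_simps
  proof (intro conjI ballI)
    fix x y assume xy: "x \<in> K" "y \<in> K"
    then show "edg G x = edg G y \<longleftrightarrow> y \<in> {x, sg G x, bt G x, sg G (bt G x)}"
      using assms(1) sub unfolding ribbon_graph_def by blast
  next
    fix x assume x: "x \<in> K"
    then have "x \<in> flags G" using sub by blast
    then show "alph G x \<in> K" "alph G (alph G x) = x" "alph G x \<noteq> x"
      "sg G x \<in> K" "sg G (sg G x) = x" "sg G x \<noteq> x"
      "bt G x \<in> K" "bt G (bt G x) = x" "bt G x \<noteq> x"
      "sg G (bt G x) = bt G (sg G x)" "sg G x \<noteq> bt G x"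
      using ribbon_graphD[OF assms(1)] flag_comps_closed[OF assms x] by simp_all
  qed (rule fin)
qed

lemma ribbon_graph_pdual:
  assumes "ribbon_graph G"
  shows "ribbon_graph (pdual G X)"
  unfolding ribbon_graph_def fpf_inv_def pdual_simps
proof (intro conjI ballI)
  fix x y assume xy: "x \<in> flags G" "y \<in> flags G"
  have "edg G x = edg G y \<longleftrightarrow> y \<in> {x, sg G x, bt G x, sg G (bt G x)}"
    using assms xy unfolding ribbon_graph_def by blast
  moreover have "{x, sg G x, bt G x, sg G (bt G x)}
      = {x, side G X x, side G (- X) x, side G X (side G (- X) x)}"
    using ribbon_graphD[OF assms xy(1)] by (auto simp: side_def)
  ultimately show "edg G x = edg G y
      \<longleftrightarrow> y \<in> {x, side G X x, side G (- X) x, side G X (side G (- X) x)}" by simp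
next
  fix x assume x: "x \<in> flags G"
  show "alph G x \<in> flags G" "alph G (alph G x) = x" "alph G x \<noteq> x"
    "side G X x \<in> flags G" "side G X (side G X x) = x" "side G X x \<noteq> x"
    "side G (- X) x \<in> flags G" "side G (- X) (side G (- X) x) = x" "side G (- X) x \<noteq> x"
    "side G X (side G (- X) x) = side G (- X) (side G X x)" "side G X x \<noteq> side G (- X) x"
    using ribbon_graphD[OF assms x] by (auto simp: side_def)
qed (rule finite_flags[OF assms])

text \<open>Boundary tracing never leaves a component, so one boundary component per component means
  that tracing connects all flags of that component. Isolated vertices carry no flags and impose no
  condition.\<close>

lemma quasi_tree_iff_connected:
  assumes G: "ribbon_graph G"
  shows "quasi_tree G X \<longleftrightarrow> X \<subseteq> edges G \<and>
    (\<forall>x\<in>flags G. \<forall>y. (x, y) \<in> (cstep G)\<^sup>* \<longrightarrow> (x, y) \<in> (bstep G X)\<^sup>*)"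
proof -
  have comp: "quasi_tree_conn (restrict_rg G K) (X \<inter> edges (restrict_rg G K))
      \<longleftrightarrow> (\<forall>x\<in>K. \<forall>y\<in>K. (x, y) \<in> (bstep G X)\<^sup>*)" if K: "K \<in> flag_comps G" for K
  proof -
    let ?H = "restrict_rg G K"
    let ?r = "bstep ?H (X \<inter> edges ?H)"
    have sub: "K \<subseteq> flags G" by (rule flag_comps_subset[OF G K])
    have r: "?r = {(x, y). x \<in> K \<and> (y = alph G x \<or> y = side G X x)}"
      by (auto simp: bstep_eq side_def edges_def)
    have closed: "side G X x \<in> K" "alph G x \<in> K" if "x \<in> K" for x
      using flag_comps_closed[OF G K that] by (simp_all add: side_def)
    have "K \<noteq> {}" using K by (auto elim!: flag_compsE)
    moreover have "?r \<subseteq> K \<times> K" unfolding r using closed by auto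
    ultimately have "card (K // ?r\<^sup>*) = 1 \<longleftrightarrow> (\<forall>x\<in>K. \<forall>y\<in>K. (x, y) \<in> ?r\<^sup>*)"
      by (rule card_quotient_rtrancl_eq_1)
    moreover have "(x, y) \<in> ?r\<^sup>* \<longleftrightarrow> (x, y) \<in> (bstep G X)\<^sup>*" if "x \<in> K" for x y
    proof
      have "?r \<subseteq> bstep G X" unfolding r unfolding bstep_eq using sub by auto
      then show "(x, y) \<in> ?r\<^sup>* \<Longrightarrow> (x, y) \<in> (bstep G X)\<^sup>*" using rtrancl_mono by blast
    next
      assume "(x, y) \<in> (bstep G X)\<^sup>*"
      then have "(x, y) \<in> ?r\<^sup>* \<and> y \<in> K"
      proof (induction rule: rtrancl_induct)
        case (step y z)
        then have "(y, z) \<in> ?r" unfolding r by (auto simp: bstep_eq)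
        then show ?case using step.IH \<open>?r \<subseteq> K \<times> K\<close> by (auto intro: rtrancl_into_rtrancl)
      qed (simp add: that)
      then show "(x, y) \<in> ?r\<^sup>*" ..
    qed
    ultimately show ?thesis by (simp add: quasi_tree_conn_def num_bc_def)
  qed
  have "(\<forall>K\<in>flag_comps G. \<forall>x\<in>K. \<forall>y\<in>K. (x, y) \<in> (bstep G X)\<^sup>*) \<longleftrightarrow>
    (\<forall>x\<in>flags G. \<forall>y. (x, y) \<in> (cstep G)\<^sup>* \<longrightarrow> (x, y) \<in> (bstep G X)\<^sup>*)" (is "?L \<longleftrightarrow> ?R")
  proof
    assume L: ?L
    show ?R
    proof (intro ballI allI impI)
      fix x y assume xy: "x \<in> flags G" "(x, y) \<in> (cstep G)\<^sup>*"
      then have "(cstep G)\<^sup>* `` {x} \<in> flag_comps G" by (auto simp: flag_comps_def quotientI)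
      then show "(x, y) \<in> (bstep G X)\<^sup>*" using L xy by blast
    qed
  next
    assume R: ?R
    show ?L
      using R flag_comps_connected[OF G] flag_comps_subset[OF G] by blast
  qed
  then show ?thesis unfolding quasi_tree_def using comp by simp
qed

text \<open>Reachability in dual form, matching \<open>ergodic_on\<close>. For the converse, the
  indicator of the set reachable from \<open>x\<close> is the separating function.\<close>

lemma quasi_tree_iff_invariant:
  fixes G :: "('f, 'e) rg"
  assumes G: "ribbon_graph G"
  shows "quasi_tree G X \<longleftrightarrow> X \<subseteq> edges G \<and>
    (\<forall>u :: 'f \<Rightarrow> complex. (\<forall>x\<in>flags G. u (alph G x) = u x \<and> u (side G X x) = u x) \<longrightarrow>
      (\<forall>x\<in>flags G. \<forall>y. (x, y) \<in> (cstep G)\<^sup>* \<longrightarrow> u x = u y))"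
proof -
  have "(\<forall>x\<in>flags G. \<forall>y. (x, y) \<in> (cstep G)\<^sup>* \<longrightarrow> (x, y) \<in> (bstep G X)\<^sup>*) \<longleftrightarrow>
    (\<forall>u :: 'f \<Rightarrow> complex. (\<forall>x\<in>flags G. u (alph G x) = u x \<and> u (side G X x) = u x) \<longrightarrow>
      (\<forall>x\<in>flags G. \<forall>y. (x, y) \<in> (cstep G)\<^sup>* \<longrightarrow> u x = u y))" (is "?L \<longleftrightarrow> ?R")
  proof
    assume L: ?L
    show ?R
    proof (intro allI impI ballI)
      fix u :: "'f \<Rightarrow> complex" and x y
      assume u: "\<forall>x\<in>flags G. u (alph G x) = u x \<and> u (side G X x) = u x"
        and xy: "x \<in> flags G" "(x, y) \<in> (cstep G)\<^sup>*"
      from L xy have "(x, y) \<in> (bstep G X)\<^sup>*" by blast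
      then show "u x = u y"
        by (induction rule: rtrancl_induct) (use u in \<open>auto simp: bstep_eq\<close>)
    qed
  next
    assume R: ?R
    show ?L
    proof (intro allI impI ballI)
      fix x y assume xy: "x \<in> flags G" "(x, y) \<in> (cstep G)\<^sup>*"
      define u :: "'f \<Rightarrow> complex" where "u = (\<lambda>w. of_bool ((x, w) \<in> (bstep G X)\<^sup>*))"
      have step: "(w, alph G w) \<in> bstep G X" "(alph G w, w) \<in> bstep G X"
        "(w, side G X w) \<in> bstep G X" "(side G X w, w) \<in> bstep G X" if "w \<in> flags G" for w
        using ribbon_graphD[OF G that] sideD[OF G that] that by (auto simp: bstep_eq)
      have "u (alph G w) = u w \<and> u (side G X w) = u w" if "w \<in> flags G" for w
      proof -
        have "(x, alph G w) \<in> (bstep G X)\<^sup>* \<longleftrightarrow> (x, w) \<in> (bstep G X)\<^sup>*"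
          "(x, side G X w) \<in> (bstep G X)\<^sup>* \<longleftrightarrow> (x, w) \<in> (bstep G X)\<^sup>*"
          using step[OF that] by (blast intro: rtrancl_into_rtrancl)+
        then show ?thesis by (simp add: u_def)
      qed
      then have "u x = u y" using R xy by blast
      then show "(x, y) \<in> (bstep G X)\<^sup>*" by (simp add: u_def split: if_splits)
    qed
  qed
  then show ?thesis by (simp add: quasi_tree_iff_connected[OF G])
qed

subsection \<open>Colourings of flags\<close>

text \<open>Peeling one application off each end of the equation \<open>(f g)^k y = g y\<close>
  lowers \<open>k\<close> by 2. It ends at \<open>k = 0\<close> or \<open>k = 1\<close>, where it
  would give a fixed point of \<open>g\<close> or of \<open>f\<close>.\<close>

lemma involutions_alternate:
  assumes f: "\<And>x. x \<in> K \<Longrightarrow> f x \<in> K \<and> f (f x) = x \<and> f x \<noteq> x"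
    and g: "\<And>x. x \<in> K \<Longrightarrow> g x \<in> K \<and> g (g x) = x \<and> g x \<noteq> x"
    and y: "y \<in> K"
  shows "((\<lambda>x. f (g x)) ^^ k) y \<noteq> g y"
  using y
proof (induction k arbitrary: y rule: less_induct)
  case (less k)
  let ?p = "\<lambda>x. f (g x)"
  have powK: "(?p ^^ n) x \<in> K" if "x \<in> K" for n x
    using that by (induction n) (auto simp: f g)
  consider "k = 0" | "k = 1" | l where "k = Suc (Suc l)" by (metis One_nat_def not0_implies_Suc)
  then show ?case
  proof cases
    case 1
    then show ?thesis using g[OF less.prems] not_sym[of "g y" y] by simp
  next
    case 2
    then show ?thesis using g[OF less.prems] f[of "g y"] by simp
  next
    case 3
    show ?thesis
    proof
      assume eq: "(?p ^^ k) y = g y"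
      define z where "z = (?p ^^ l) (?p y)"
      have py: "?p y \<in> K" using less.prems f g by blast
      then have zK: "z \<in> K" unfolding z_def by (rule powK)
      have "?p z = (?p ^^ k) y" unfolding z_def 3 using funpow_swap1[of ?p l y] by simp
      then have "f (g z) = g y" using eq by simp
      then have "g z = f (g y)" using f[of "g z"] g[OF zK] by metis
      then have "z = g (?p y)" using g[OF zK] by metis
      then show False using less.IH[of l "?p y"] 3 py unfolding z_def by simp
    qed
  qed
qed

text \<open>By \<open>conn\<close>, the set \<open>K\<close> is a single cycle whose links come
  alternately from \<open>f\<close> and \<open>g\<close>, such as a vertex circle. An orbit
  \<open>D\<close> of the composite consists of every second point, and \<open>g\<close> maps it
  onto the others.\<close>

lemma alternating_colouring:
  assumes fin: "finite K"
    and f: "\<And>x. x \<in> K \<Longrightarrow> f x \<in> K \<and> f (f x) = x \<and> f x \<noteq> x"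
    and g: "\<And>x. x \<in> K \<Longrightarrow> g x \<in> K \<and> g (g x) = x \<and> g x \<noteq> x"
    and conn: "\<And>C x y. \<lbrakk>C \<subseteq> K; \<And>z. z \<in> C \<Longrightarrow> f z \<in> C \<and> g z \<in> C; x \<in> C; y \<in> K\<rbrakk> \<Longrightarrow> y \<in> C"
  obtains c where "\<And>x. x \<in> K \<Longrightarrow> c (f x) = (\<not> c x)" "\<And>x. x \<in> K \<Longrightarrow> c (g x) = (\<not> c x)"
proof (cases "K = {}")
  case False
  then obtain x0 where x0: "x0 \<in> K" by blast
  define p where "p = (\<lambda>x. if x \<in> K then f (g x) else x)"
  have "inj_on p K"
  proof (rule inj_onI)
    fix x y assume "x \<in> K" "y \<in> K" "p x = p y"
    then show "x = y" using f g by (simp add: p_def) metis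
  qed
  moreover have "p ` K \<subseteq> K" using f g by (auto simp: p_def)
  ultimately have "bij_betw p K K" using fin by (simp add: bij_betw_def endo_inj_surj)
  then have perm: "p permutes K" by (rule bij_imp_permutes) (simp add: p_def)
  then have permn: "permutation p" using fin permutation_permutes by blast
  define D where "D = orbit p x0"
  have DK: "D \<subseteq> K" unfolding D_def by (rule permutes_orbit_subset[OF perm x0])
  have pD: "p z \<in> D \<longleftrightarrow> z \<in> D" for z
    unfolding D_def
    by (metis orbit.step orbit_trans orbit_swap permutation_orbit_step permutation_self_in_orbit permn)
  have pow: "(p ^^ n) z = ((\<lambda>x. f (g x)) ^^ n) z \<and> (p ^^ n) z \<in> K" if "z \<in> K" for n z
    using that by (induction n) (auto simp: p_def f g)
  have gD: "g z \<notin> D" if z: "z \<in> D" for z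
  proof
    assume "g z \<in> D"
    then have "g z \<in> orbit p z"
      using z unfolding D_def by (metis orbit_trans orbit_swap permutation_self_in_orbit permn)
    then obtain n where "g z = (p ^^ n) z"
      unfolding orbit_altdef_permutation[OF permn] by blast
    then show False
      using involutions_alternate[of K f g z n] f g pow[of z n] DK z by auto
  qed
  have in_D: "x0 \<in> D" unfolding D_def by (rule permutation_self_in_orbit[OF permn])
  have gfD: "g (f z) \<in> D" if z: "z \<in> D" for z
  proof -
    have zK: "z \<in> K" using z DK by blast
    have "p (g (f z)) = z" using f[OF zK] g[of "f z"] by (simp add: p_def)
    then show ?thesis using pD[of "g (f z)"] z by simp
  qed
  have cover: "y \<in> D \<union> g ` D" if "y \<in> K" for y
  proof (rule conn[of "D \<union> g ` D" x0 y])
    show "D \<union> g ` D \<subseteq> K" using DK g by auto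
    show "f z \<in> D \<union> g ` D \<and> g z \<in> D \<union> g ` D" if "z \<in> D \<union> g ` D" for z
      using that
    proof
      assume z: "z \<in> D"
      then have "f z = g (g (f z))" using DK f[of z] g[of "f z"] by auto
      then show ?thesis using z gfD[OF z] by auto
    next
      assume "z \<in> g ` D"
      then obtain w where w: "w \<in> D" "z = g w" by blast
      then have "f z = p w" "g z = w" using DK g[of w] by (auto simp: p_def)
      then show ?thesis using w pD by auto
    qed
  qed (use in_D that in auto)
  define c where "c = (\<lambda>x. x \<in> D)"
  have g_alt: "c (g x) = (\<not> c x)" if x: "x \<in> K" for x
    using cover[OF x] gD[of x] DK g by (auto simp: c_def)
  moreover have "c (f x) = (\<not> c x)" if x: "x \<in> K" for x
  proof -
    have "c (f x) = c (g (g (f x)))" using f[OF x] g[of "f x"] by simp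
    also have "\<dots> = (\<not> c (g (f x)))" using g_alt[of "g (f x)"] f[OF x] g[of "f x"] by blast
    also have "c (g (f x)) = c (p (g (f x)))" using pD by (simp add: c_def)
    also have "p (g (f x)) = x" using f[OF x] g[of "f x"] by (simp add: p_def)
    finally show ?thesis .
  qed
  ultimately show thesis using that by blast
qed (use that in auto)

lemma card_colour_classes:
  assumes fin: "finite C" and \<sigma>: "\<And>x. x \<in> C \<Longrightarrow> \<sigma> x \<in> C \<and> \<sigma> (\<sigma> x) = x \<and> c (\<sigma> x) = (\<not> c x)"
  shows "card {x \<in> C. c x} = card {x \<in> C. \<not> c x}"
  by (rule bij_betw_same_card[of \<sigma>], rule bij_betw_byWitness[where f' = \<sigma>]) (use \<sigma> in auto)

text \<open>The exceptional set is where the vertex arcs fail to alternate; the edges balance the two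
  colours, so it cannot consist of one arc only.\<close>

lemma exceptional_arcs:
  assumes fin: "finite K"
    and \<sigma>: "\<And>x. x \<in> K \<Longrightarrow> \<sigma> x \<in> K \<and> \<sigma> (\<sigma> x) = x \<and> c (\<sigma> x) = (\<not> c x)"
    and f: "\<And>x. x \<in> K \<Longrightarrow> f x \<in> K \<and> f (f x) = x \<and> f x \<noteq> x"
    and exc: "\<And>x. x \<in> K \<Longrightarrow> c (f x) = c x \<Longrightarrow> x \<in> {a, f a, b, f b}"
  obtains "\<And>x. x \<in> K \<Longrightarrow> c (f x) = (\<not> c x)"
  | u w where "u \<in> K" "w \<in> K" "c u" "\<not> c w" "c (f u)" "\<not> c (f w)"
      "\<And>x. x \<in> K \<Longrightarrow> c (f x) = c x \<Longrightarrow> x \<in> {u, f u, w, f w}"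
proof -
  define E where "E = {x \<in> K. c (f x) = c x}"
  have E: "E \<subseteq> {a, f a, b, f b}" using exc by (auto simp: E_def)
  then have finE: "finite E" by (rule finite_subset) simp
  have fE: "f x \<in> E" if "x \<in> E" for x using that f by (auto simp: E_def)
  have out: "card {x \<in> K - E. c x} = card {x \<in> K - E. \<not> c x}"
    by (rule card_colour_classes[where \<sigma> = f]) (use fin f in \<open>auto simp: E_def\<close>)
  have all: "card {x \<in> K. c x} = card {x \<in> K. \<not> c x}"
    by (rule card_colour_classes[where \<sigma> = \<sigma>]) (use fin \<sigma> in auto)
  have split: "card {x \<in> K. P x} = card {x \<in> E. P x} + card {x \<in> K - E. P x}" for P
  proof -
    have "{x \<in> K. P x} = {x \<in> E. P x} \<union> {x \<in> K - E. P x}" by (auto simp: E_def)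
    moreover have "card ({x \<in> E. P x} \<union> {x \<in> K - E. P x}) = card {x \<in> E. P x} + card {x \<in> K - E. P x}"
      using fin finE by (intro card_Un_disjoint) auto
    ultimately show ?thesis by simp
  qed
  \<comment> \<open>\<open>f\<close> pairs opposite colours outside \<open>E\<close> and
    \<open>\<sigma>\<close> does so on all of \<open>K\<close>; the difference is the balance on
    \<open>E\<close>.\<close>
  have bal: "card {x \<in> E. c x} = card {x \<in> E. \<not> c x}"
    using out all split[of c] split[of "\<lambda>x. \<not> c x"] by linarith
  show thesis
  proof (cases "E = {}")
    case True
    then show thesis using that(1) unfolding E_def by blast
  next
    case False
    have "finite {x \<in> E. c x}" "finite {x \<in> E. \<not> c x}" using finE by auto
    then have "{x \<in> E. c x} = {} \<longleftrightarrow> {x \<in> E. \<not> c x} = {}" using bal card_0_eq by metis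
    then have "{x \<in> E. c x} \<noteq> {}" "{x \<in> E. \<not> c x} \<noteq> {}" using False by blast+
    then obtain u w where uw: "u \<in> E" "c u" "w \<in> E" "\<not> c w" by blast
    then have K: "u \<in> K" "w \<in> K" "c (f u)" "\<not> c (f w)" by (auto simp: E_def)
    have sub: "{u, f u, w, f w} \<subseteq> E" using uw fE by auto
    have "f u \<noteq> u" "f w \<noteq> w" using f K by auto
    moreover have "u \<noteq> w" "u \<noteq> f w" "f u \<noteq> w" "f u \<noteq> f w" using uw K by auto
    ultimately have "card {u, f u, w, f w} = 4" by auto
    moreover have "card E \<le> 4"
    proof -
      have "card E \<le> card {a, f a, b, f b}" using E by (intro card_mono) auto
      also have "\<dots> \<le> 4" using card_length[of "[a, f a, b, f b]"] by simp
      finally show ?thesis .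
    qed
    ultimately have "{u, f u, w, f w} = E" using sub finE by (intro card_seteq) auto
    then have "x \<in> {u, f u, w, f w}" if "x \<in> K" "c (f x) = c x" for x
      using that by (auto simp: E_def)
    then show thesis using that(2)[of u w] K uw by blast
  qed
qed

section \<open>Colourings of orientable and pseudo-orientable graphs\<close>

definition colouring :: "('f, 'e) rg \<Rightarrow> ('f \<Rightarrow> bool) \<Rightarrow> bool" where
  "colouring G c \<longleftrightarrow> (\<forall>x\<in>flags G. c (sg G x) = (\<not> c x) \<and> c (bt G x) = (\<not> c x))"

definition flat_colouring :: "('f, 'e) rg \<Rightarrow> ('f \<Rightarrow> bool) \<Rightarrow> bool" where
  "flat_colouring G c \<longleftrightarrow> colouring G c \<and> (\<forall>x\<in>flags G. c (alph G x) = (\<not> c x))"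

text \<open>The two exceptional arcs have opposite colours, so joining an end of one to an end of
  the other restores alternation.\<close>

definition bent_colouring :: "('f, 'e) rg \<Rightarrow> ('f \<Rightarrow> bool) \<Rightarrow> 'f \<Rightarrow> 'f \<Rightarrow> bool" where
  "bent_colouring G c a b \<longleftrightarrow> colouring G c \<and> a \<in> flags G \<and> b \<in> flags G \<and>
     c a \<and> c (alph G a) \<and> \<not> c b \<and> \<not> c (alph G b) \<and>
     (\<forall>x\<in>flags G. c (alph G x) = c x \<longrightarrow> x \<in> {a, alph G a, b, alph G b})"

text \<open>A colouring treats end segments and long sides alike, so exchanging them on
  \<open>X\<close> changes nothing. This brings the colouring of a bouquet back to the graph it is
  dual to.\<close>

lemma colouring_pdual: "colouring (pdual G X) c \<longleftrightarrow> colouring G c"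
  unfolding colouring_def pdual_simps by (auto simp: side_def)

lemma orientable_imp_flat_colouring:
  fixes G :: "('f, 'e) rg"
  assumes "orientable G"
  shows "\<exists>c. flat_colouring G c"
proof -
  obtain c :: "'f \<Rightarrow> bool" where c: "\<forall>x\<in>flags G. c (alph G x) \<noteq> c x \<and> c (sg G x) \<noteq> c x \<and>
      (edg G x \<in> edges G \<longrightarrow> c (bt G x) \<noteq> c x)"
    using assms unfolding orientable_def orientable_sub_def by blast
  then have "flat_colouring G c"
    by (auto simp: flat_colouring_def colouring_def edges_def)
  then show ?thesis by blast
qed

text \<open>Flipping the canonical colouring of a vertex circle on one of the two arcs makes every loop
  alternate, at the price of the two cut points.\<close>

lemma pseudo_orientable_bouquet_colouring:
  fixes H :: "('f, 'e) rg"
  assumes H: "ribbon_graph H" and po: "pseudo_orientable_bouquet H" and ne: "flags H \<noteq> {}"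
  shows "(\<exists>c. flat_colouring H c) \<or> (\<exists>c a b. bent_colouring H c a b)"
proof -
  let ?K = "flags H"
  note rgD = ribbon_graphD[OF H]
  obtain lab :: "'f \<Rightarrow> bool" and a b where l: "\<forall>x\<in>?K. lab (sg H x) = lab x"
    "\<forall>x\<in>?K. lab (alph H x) \<noteq> lab x \<longrightarrow> x \<in> {a, alph H a, b, alph H b}"
    "\<forall>x\<in>?K. (lab (bt H x) = lab x) \<longleftrightarrow> orientable_loop H (edg H x)"
    using po unfolding pseudo_orientable_bouquet_def by (elim conjE exE) (rule that)
  note lab = l[rule_format]
  have card: "card (?K // (vstep H)\<^sup>*) + rg.iso H = 1"
    using po by (simp add: pseudo_orientable_bouquet_def bouquet_def num_vertices_def)
  have "finite (?K // (vstep H)\<^sup>*)" using finite_flags[OF H] by (simp add: quotient_def)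
  moreover have "?K // (vstep H)\<^sup>* \<noteq> {}" using ne by (simp add: quotient_def)
  ultimately have "card (?K // (vstep H)\<^sup>*) \<noteq> 0" by (simp add: card_eq_0_iff)
  then have "card (?K // (vstep H)\<^sup>*) = 1" using card by linarith
  moreover have "vstep H \<subseteq> ?K \<times> ?K" using rgD by (auto simp: vstep_def)
  ultimately have vconn: "(x, y) \<in> (vstep H)\<^sup>*" if "x \<in> ?K" "y \<in> ?K" for x y
    using card_quotient_rtrancl_eq_1[OF ne, of "vstep H"] that by blast
  have conn: "y \<in> C" if "C \<subseteq> ?K" "\<And>z. z \<in> C \<Longrightarrow> alph H z \<in> C \<and> sg H z \<in> C" "x \<in> C" "y \<in> ?K"
    for C x y
  proof -
    have "(x, y) \<in> (vstep H)\<^sup>*" using vconn that by blast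
    then show ?thesis
      by (induction rule: rtrancl_induct) (use that in \<open>auto simp: vstep_def\<close>)
  qed
  have "\<exists>c0. \<forall>x\<in>?K. c0 (alph H x) = (\<not> c0 x) \<and> c0 (sg H x) = (\<not> c0 x)"
  proof (rule alternating_colouring[of ?K "alph H" "sg H"])
    show "alph H x \<in> ?K \<and> alph H (alph H x) = x \<and> alph H x \<noteq> x" if "x \<in> ?K" for x
      using rgD[OF that] by simp
    show "sg H x \<in> ?K \<and> sg H (sg H x) = x \<and> sg H x \<noteq> x" if "x \<in> ?K" for x
      using rgD[OF that] by simp
  qed (use finite_flags[OF H] conn in blast)+
  then obtain c0 where c0: "\<And>x. x \<in> ?K \<Longrightarrow> c0 (alph H x) = (\<not> c0 x)"
    "\<And>x. x \<in> ?K \<Longrightarrow> c0 (sg H x) = (\<not> c0 x)" by blast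
  \<comment> \<open>On a connected circle the alternating colouring is unique up to a global swap,
    so \<open>c0\<close> alone decides which loops are orientable.\<close>
  have unique: "(c x = c0 x) = (c y = c0 y)"
    if c: "\<And>x. x \<in> ?K \<Longrightarrow> c (alph H x) = (\<not> c x)" "\<And>x. x \<in> ?K \<Longrightarrow> c (sg H x) = (\<not> c x)"
      and xy: "x \<in> ?K" "y \<in> ?K" for c x y
  proof -
    let ?C = "{z \<in> ?K. (c z = c0 z) = (c x = c0 x)}"
    have "y \<in> ?C"
    proof (rule conn[of ?C x])
      show "alph H z \<in> ?C \<and> sg H z \<in> ?C" if "z \<in> ?C" for z
      proof -
        have z: "z \<in> ?K" using that by simp
        show ?thesis using that c[OF z] c0[OF z] rgD(1,4)[OF z] by auto
      qed
    qed (use xy in auto)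
    then show ?thesis by auto
  qed
  have loop: "orientable_loop H (edg H x) \<longleftrightarrow> c0 (bt H x) = (\<not> c0 x)" if x: "x \<in> ?K" for x
  proof
    assume "orientable_loop H (edg H x)"
    then obtain c :: "'f \<Rightarrow> bool" where c: "\<forall>y\<in>?K. c (alph H y) \<noteq> c y \<and> c (sg H y) \<noteq> c y \<and>
        (edg H y \<in> {edg H x} \<longrightarrow> c (bt H y) \<noteq> c y)"
      unfolding orientable_loop_def orientable_sub_def by blast
    have "(c x = c0 x) = (c (bt H x) = c0 (bt H x))"
      by (rule unique) (use c x rgD(7)[OF x] in auto)
    then show "c0 (bt H x) = (\<not> c0 x)" using c x by auto
  next
    assume bt: "c0 (bt H x) = (\<not> c0 x)"
    have "c0 (bt H y) \<noteq> c0 y" if y: "y \<in> ?K" "edg H y = edg H x" for y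
    proof -
      have "y \<in> {x, sg H x, bt H x, sg H (bt H x)}"
        using ribbon_graph_edgD[OF H x y(1)] y(2) by simp
      moreover have "c0 (sg H x) = (\<not> c0 x)" "c0 (sg H (bt H x)) = c0 x"
        using bt c0(2)[OF x] c0(2)[OF rgD(7)[OF x]] by simp_all
      moreover have "bt H (sg H (bt H x)) = sg H x" "bt H (sg H x) = sg H (bt H x)" "bt H (bt H x) = x"
        using rgD(8,10)[OF x] rgD(8)[OF rgD(4)[OF x]] by simp_all
      ultimately show ?thesis using bt by (elim insertE emptyE) (simp_all only:, simp_all)
    qed
    then show "orientable_loop H (edg H x)"
      unfolding orientable_loop_def orientable_sub_def using c0 by (intro exI[of _ c0]) auto
  qed
  define c where "c = (\<lambda>x. c0 x = lab x)"
  have col: "c (sg H x) = (\<not> c x)" "c (bt H x) = (\<not> c x)" if "x \<in> ?K" for x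
    using c0(2)[OF that] lab(1)[OF that] lab(3)[OF that] loop[OF that] by (auto simp: c_def)
  then have "colouring H c" by (simp add: colouring_def)
  have exc: "x \<in> {a, alph H a, b, alph H b}" if "x \<in> ?K" "c (alph H x) = c x" for x
    using that c0(1)[OF that(1)] by (intro lab(2)) (auto simp: c_def)
  show ?thesis
  proof (rule exceptional_arcs[of ?K "sg H" c "alph H" a b])
    show "sg H x \<in> ?K \<and> sg H (sg H x) = x \<and> c (sg H x) = (\<not> c x)" if "x \<in> ?K" for x
      using rgD[OF that] col[OF that] by simp
    show "alph H x \<in> ?K \<and> alph H (alph H x) = x \<and> alph H x \<noteq> x" if "x \<in> ?K" for x
      using rgD[OF that] by simp
    show ?thesis if "\<And>x. x \<in> ?K \<Longrightarrow> c (alph H x) = (\<not> c x)"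
      using that \<open>colouring H c\<close> unfolding flat_colouring_def by blast
    show ?thesis if "u \<in> ?K" "w \<in> ?K" "c u" "\<not> c w" "c (alph H u)" "\<not> c (alph H w)"
      "\<And>x. x \<in> ?K \<Longrightarrow> c (alph H x) = c x \<Longrightarrow> x \<in> {u, alph H u, w, alph H w}" for u w
    proof -
      have "bent_colouring H c u w" unfolding bent_colouring_def
        by (intro conjI ballI impI that \<open>colouring H c\<close>)
      then show ?thesis by blast
    qed
  qed (rule finite_flags[OF H], rule exc)
qed

text \<open>Colourings of the components are glued along \<open>?cls\<close>. If some component has
  no flat colouring, it is the distinguished one; it then has a bent colouring, and both exceptional
  arcs lie in it.\<close>

lemma pseudo_orientable_imp_colouring:
  assumes G: "ribbon_graph G" and po: "pseudo_orientable G"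
  shows "(\<exists>c. flat_colouring G c) \<or>
    (\<exists>c a b. bent_colouring G c a b \<and> (a, b) \<in> (cstep G)\<^sup>*)"
proof -
  let ?cls = "\<lambda>x. (cstep G)\<^sup>* `` {x}"
  have cls: "?cls x \<in> flag_comps G" "x \<in> ?cls x" if "x \<in> flags G" for x
    using that by (auto simp: flag_comps_def quotientI)
  define ori where "ori = (\<lambda>K. SOME c. flat_colouring (restrict_rg G K) c)"
  have ori: "flat_colouring (restrict_rg G K) (ori K)" if "orientable (restrict_rg G K)" for K
    unfolding ori_def by (rule someI_ex[OF orientable_imp_flat_colouring[OF that]])
  show ?thesis
  proof (cases "\<forall>K\<in>flag_comps G. \<exists>c. flat_colouring (restrict_rg G K) c")
    case True
    then obtain cc where cc: "\<And>K. K \<in> flag_comps G \<Longrightarrow> flat_colouring (restrict_rg G K) (cc K)"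
      by metis
    define c where "c = (\<lambda>x. cc (?cls x) x)"
    have c_eq: "c y = cc (?cls x) y" if "x \<in> flags G" "y \<in> ?cls x" for x y
      using that cstep_class_eq_iff[OF G, of x y] by (simp add: c_def)
    have "c (sg G x) = (\<not> c x) \<and> c (bt G x) = (\<not> c x) \<and> c (alph G x) = (\<not> c x)"
      if x: "x \<in> flags G" for x
      using cc[OF cls(1)[OF x]] c_eq[OF x] cls(2)[OF x] flag_comps_closed[OF G cls[OF x]]
      unfolding flat_colouring_def colouring_def by simp
    then have "flat_colouring G c" by (simp add: flat_colouring_def colouring_def)
    then show ?thesis by blast
  next
    case False
    \<comment> \<open>This also excludes the alternative in which an isolated vertex is the
      distinguished component.\<close>
    then have "\<not> (\<forall>K\<in>flag_comps G. orientable (restrict_rg G K))" using ori by blast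
    then obtain K where K: "K \<in> flag_comps G" "pseudo_orientable_conn (restrict_rg G K)"
      and others: "\<And>K'. K' \<in> flag_comps G \<Longrightarrow> K' \<noteq> K \<Longrightarrow> orientable (restrict_rg G K')"
      using po unfolding pseudo_orientable_def by blast
    let ?H = "restrict_rg G K"
    have noflat: "\<not> flat_colouring ?H c" for c
      using False others ori by blast
    have H: "ribbon_graph ?H" by (rule ribbon_graph_restrict_rg[OF G K(1)])
    obtain X where X: "pseudo_orientable_bouquet (pdual ?H X)"
      using K(2) unfolding pseudo_orientable_conn_def by blast
    have "flags (pdual ?H X) \<noteq> {}" using K(1) by (auto elim!: flag_compsE)
    then have "(\<exists>c. flat_colouring (pdual ?H X) c) \<or> (\<exists>c a b. bent_colouring (pdual ?H X) c a b)"
      by (rule pseudo_orientable_bouquet_colouring[OF ribbon_graph_pdual[OF H] X])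
    moreover have "\<not> flat_colouring (pdual ?H X) c" for c
      using noflat[of c] by (simp add: flat_colouring_def colouring_pdual)
    ultimately obtain c1 a b where "bent_colouring (pdual ?H X) c1 a b" by blast
    then have c1: "bent_colouring ?H c1 a b"
      by (simp add: bent_colouring_def colouring_pdual)
    define c where "c = (\<lambda>x. if x \<in> K then c1 x else ori (?cls x) x)"
    have sub: "K \<subseteq> flags G" by (rule flag_comps_subset[OF G K(1)])
    have in_K: "c (sg G x) = (\<not> c x)" "c (bt G x) = (\<not> c x)" if x: "x \<in> K" for x
      using c1 x flag_comps_closed[OF G K(1) x]
      by (simp_all add: c_def bent_colouring_def colouring_def)
    have out_K: "c (sg G x) = (\<not> c x)" "c (bt G x) = (\<not> c x)" "c (alph G x) = (\<not> c x)"
      if x: "x \<in> flags G" "x \<notin> K" for x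
    proof -
      have ne: "?cls x \<noteq> K" using x cls(2) by blast
      have notK: "y \<notin> K" if "y \<in> ?cls x" for y
        using flag_comps_disjoint[OF G cls(1)[OF x(1)] K(1) that] ne by blast
      have c_eq: "c y = ori (?cls x) y" if "y \<in> ?cls x" for y
        using notK[OF that] that cstep_class_eq_iff[OF G, of x y] by (simp add: c_def)
      have "flat_colouring (restrict_rg G (?cls x)) (ori (?cls x))"
        by (rule ori[OF others[OF cls(1)[OF x(1)] ne]])
      then show "c (sg G x) = (\<not> c x)" "c (bt G x) = (\<not> c x)" "c (alph G x) = (\<not> c x)"
        using c_eq cls(2)[OF x(1)] flag_comps_closed[OF G cls[OF x(1)]]
        unfolding flat_colouring_def colouring_def by simp_all
    qed
    have ab: "a \<in> K" "b \<in> K" using c1 by (simp_all add: bent_colouring_def)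
    have "colouring G c" unfolding colouring_def using in_K out_K by blast
    moreover have "x \<in> {a, alph G a, b, alph G b}" if x: "x \<in> flags G" "c (alph G x) = c x" for x
    proof -
      have xK: "x \<in> K" using out_K(3)[OF x(1)] x(2) by blast
      then have "c1 (alph G x) = c1 x"
        using x(2) flag_comps_closed[OF G K(1) xK] by (simp add: c_def)
      then show ?thesis using c1 xK unfolding bent_colouring_def restrict_rg_simps by blast
    qed
    ultimately have "bent_colouring G c a b"
      using ab sub c1 flag_comps_closed[OF G K(1)] by (auto simp: bent_colouring_def c_def)
    moreover have "(a, b) \<in> (cstep G)\<^sup>*" by (rule flag_comps_connected[OF G K(1) ab])
    ultimately show ?thesis by blast
  qed
qed

subsection \<open>Quasi-trees as feasible sets\<close>

lemma ergodic_on_cong: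
  "(\<And>i. i \<in> V \<Longrightarrow> p i = q i) \<Longrightarrow> ergodic_on V cl p \<longleftrightarrow> ergodic_on V cl q"
  by (simp add: ergodic_on_def)

lemma twist_append: "twist s t X (es @ fs) = twist s t X fs \<circ> twist s t X es"
  by (induction es) (auto simp: o_assoc)

text \<open>The quasi-tree criterion with the arc involution as a parameter: rerouted arcs may
  replace \<open>alph G\<close>, while the components remain those of \<open>G\<close>.\<close>

definition inv_connected :: "('f, 'e) rg \<Rightarrow> ('f \<Rightarrow> 'f) \<Rightarrow> 'e set \<Rightarrow> bool" where
  "inv_connected G f X \<longleftrightarrow> (\<forall>u :: 'f \<Rightarrow> complex.
     (\<forall>x\<in>flags G. u (f x) = u x \<and> u (side G X x) = u x) \<longrightarrow>
     (\<forall>x\<in>flags G. \<forall>y. (x, y) \<in> (cstep G)\<^sup>* \<longrightarrow> u x = u y))"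

lemma quasi_tree_iff_inv_connected:
  "ribbon_graph G \<Longrightarrow> quasi_tree G X \<longleftrightarrow> X \<subseteq> edges G \<and> inv_connected G (alph G) X"
  unfolding inv_connected_def by (rule quasi_tree_iff_invariant)

lemma side_empty: "side G {} = sg G"
  by (simp add: side_def fun_eq_iff)

text \<open>\<open>f\<close> is either the vertex-arc involution itself or a rerouting of it; what
  matters is that it alternates colours and stays inside components.\<close>

locale alternating_rg =
  fixes G :: "('f, 'e) rg" and c :: "'f \<Rightarrow> bool" and f :: "'f \<Rightarrow> 'f"
  assumes G: "ribbon_graph G" and col: "colouring G c"
    and f: "\<And>x. x \<in> flags G \<Longrightarrow> f x \<in> flags G \<and> f (f x) = x \<and> c (f x) = (\<not> c x)"
    and f_cstep: "\<And>x. x \<in> flags G \<Longrightarrow> (x, f x) \<in> (cstep G)\<^sup>*"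
begin

definition T :: "'f set" where "T = {x \<in> flags G. c x}"

definition cls :: "'f \<Rightarrow> 'f set" where "cls x = (cstep G)\<^sup>* `` {x}"

text \<open>Two alternating steps return to the same colour, so boundary tracing becomes a
  permutation of \<open>T\<close>.\<close>

definition rot :: "'e set \<Rightarrow> 'f \<Rightarrow> 'f" where
  "rot X x = (if x \<in> T then f (side G X x) else x)"

text \<open>Exactly two of the four flags of an edge lie in \<open>T\<close>, at diagonally opposite
  corners. \<open>rep\<close> chooses one and \<open>mate\<close> is the other; their transposition
  represents the edge.\<close>

definition rep :: "'e \<Rightarrow> 'f" where "rep e = (SOME x. x \<in> T \<and> edg G x = e)"

definition mate :: "'e \<Rightarrow> 'f" where "mate e = sg G (bt G (rep e))"

lemma T_flags: "x \<in> T \<Longrightarrow> x \<in> flags G" by (simp add: T_def)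

lemma finite_T: "finite T" using finite_flags[OF G] by (simp add: T_def)

lemma sg_col: "x \<in> flags G \<Longrightarrow> c (sg G x) = (\<not> c x)" and bt_col: "x \<in> flags G \<Longrightarrow> c (bt G x) = (\<not> c x)"
  using col by (simp_all add: colouring_def)

lemma side_col: "x \<in> flags G \<Longrightarrow> c (side G X x) = (\<not> c x)"
  by (simp add: side_def sg_col bt_col)

lemma cls_eq_iff: "cls x = cls y \<longleftrightarrow> (x, y) \<in> (cstep G)\<^sup>*"
  unfolding cls_def by (rule cstep_class_eq_iff[OF G])

lemma rot_permutes: "rot X permutes T"
proof -
  have "rot X x \<in> T" if "x \<in> T" for x
    using that f[of "side G X x"] sideD[OF G] side_col by (simp add: rot_def T_def)
  moreover have "inj_on (rot X) T"
  proof (rule inj_onI)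
    fix x y assume xy: "x \<in> T" "y \<in> T" "rot X x = rot X y"
    then have F: "x \<in> flags G" "y \<in> flags G" by (simp_all add: T_flags)
    have "f (side G X x) = f (side G X y)" using xy by (simp add: rot_def)
    then have "side G X x = side G X y"
      using f[OF sideD(1)[OF G F(1), of X]] f[OF sideD(1)[OF G F(2), of X]] by metis
    then show "x = y" using sideD(2)[OF G F(1), of X] sideD(2)[OF G F(2), of X] by metis
  qed
  ultimately have "bij_betw (rot X) T T"
    using finite_T by (simp add: bij_betw_def endo_inj_surj image_subset_iff)
  then show ?thesis by (rule bij_imp_permutes) (simp add: rot_def)
qed

lemma cls_rot: "x \<in> T \<Longrightarrow> cls (rot X x) = cls x"
proof -
  assume x: "x \<in> T"
  then have F: "x \<in> flags G" by (rule T_flags)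
  have "(x, f (side G X x)) \<in> (cstep G)\<^sup>*"
    using cstepI(4)[OF F, of X] f_cstep[OF sideD(1)[OF G F, of X]] by (rule rtrancl_trans)
  then have "cls x = cls (f (side G X x))" unfolding cls_eq_iff .
  then show ?thesis using x by (simp add: rot_def)
qed

lemma rep:
  assumes "e \<in> edges G"
  shows "rep e \<in> T" "edg G (rep e) = e"
proof -
  obtain x where x: "x \<in> flags G" "edg G x = e" using assms by (auto simp: edges_def)
  have "\<exists>y. y \<in> T \<and> edg G y = e"
  proof (cases "c x")
    case False
    then show ?thesis using x ribbon_graphD[OF G x(1)] sg_col[OF x(1)]
      by (intro exI[of _ "sg G x"]) (simp add: T_def)
  qed (use x in \<open>auto simp: T_def\<close>)
  then have "rep e \<in> T \<and> edg G (rep e) = e" unfolding rep_def by (rule someI_ex)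
  then show "rep e \<in> T" "edg G (rep e) = e" by simp_all
qed

lemma opposite:
  assumes "x \<in> T"
  shows "sg G (bt G x) \<in> T" "sg G (bt G x) \<noteq> x" "edg G (sg G (bt G x)) = edg G x"
    "sg G (bt G (sg G (bt G x))) = x" "sg G (sg G (bt G x)) = bt G x"
proof -
  have x: "x \<in> flags G" "c x" using assms by (simp_all add: T_def)
  note X = ribbon_graphD[OF G x(1)]
  note B = ribbon_graphD[OF G X(7)]
  show "sg G (bt G x) \<in> T" using B(4) x(2) sg_col[OF X(7)] bt_col[OF x(1)] by (simp add: T_def)
  show "sg G (bt G x) \<noteq> x" using B(5) X(11) by metis
  show "edg G (sg G (bt G x)) = edg G x" using B(12) X(13) by simp
  have "bt G (sg G (bt G x)) = sg G x" using B(10) X(8) by simp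
  then show "sg G (bt G (sg G (bt G x))) = x" using X(5) by simp
  show "sg G (sg G (bt G x)) = bt G x" by (rule B(5))
qed

lemma mate:
  assumes "e \<in> edges G"
  shows "mate e \<in> T" "mate e \<noteq> rep e" "edg G (mate e) = e" "sg G (bt G (mate e)) = rep e"
  unfolding mate_def using opposite[OF rep(1)[OF assms]] rep(2)[OF assms] by simp_all

lemma T_edge_cases:
  assumes "x \<in> T"
  shows "x = rep (edg G x) \<or> x = mate (edg G x)"
proof -
  let ?r = "rep (edg G x)"
  have x: "x \<in> flags G" "c x" using assms by (simp_all add: T_def)
  then have e: "edg G x \<in> edges G" by (simp add: edges_def)
  have r: "?r \<in> flags G" "c ?r" using rep(1)[OF e] by (simp_all add: T_def)
  have "x \<in> {?r, sg G ?r, bt G ?r, sg G (bt G ?r)}"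
    by (rule ribbon_graph_edgD[OF G r(1) x(1)]) (simp add: rep(2)[OF e])
  moreover have "x \<noteq> sg G ?r" "x \<noteq> bt G ?r" using sg_col[OF r(1)] bt_col[OF r(1)] r(2) x(2) by auto
  ultimately show ?thesis by (auto simp: mate_def)
qed

lemma cls_mate:
  assumes "e \<in> edges G"
  shows "cls (rep e) = cls (mate e)"
proof -
  have r: "rep e \<in> flags G" using rep(1)[OF assms] by (rule T_flags)
  have "(rep e, mate e) \<in> (cstep G)\<^sup>*"
    unfolding mate_def using cstepI(3)[OF r] cstepI(2)[OF ribbon_graphD(7)[OF G r]]
    by (rule rtrancl_trans)
  then show ?thesis by (simp add: cls_eq_iff)
qed

text \<open>Different edges have disjoint pairs, so a flag is moved only by its own edge. Since
  \<open>bt G x = sg G (sg G (bt G x))\<close>, swapping \<open>x\<close> with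
  \<open>sg G (bt G x)\<close> before applying \<open>sg G\<close> amounts to following the long
  side.\<close>

lemma twist_edges:
  assumes "distinct el" "set el \<subseteq> edges G" "x \<in> T"
    and st: "\<And>e. s (Some e) = rep e" "\<And>e. t (Some e) = mate e"
  shows "twist s t X (map Some el) x
    = (if edg G x \<in> set el \<and> Some (edg G x) \<in> X then sg G (bt G x) else x)"
  using assms(1-3)
proof (induction el arbitrary: x)
  case (Cons e el)
  have e: "e \<in> edges G" using Cons.prems by simp
  let ?S = "Transposition.transpose (rep e) (mate e)"
  show ?case
  proof (cases "edg G x = e")
    case True
    have S: "?S x = sg G (bt G x)"
      using T_edge_cases[OF Cons.prems(3)] True mate(4)[OF e]
      by (metis mate_def transpose_apply_first transpose_apply_second)
    have fresh: "twist s t X (map Some el) y = y" if "y \<in> T" "edg G y = e" for y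
      using Cons.IH[of y] that Cons.prems by simp
    show ?thesis
      using True S fresh[OF opposite(1)[OF Cons.prems(3)]] fresh[OF Cons.prems(3)]
        opposite(3)[OF Cons.prems(3)] by (simp add: st)
  next
    case False
    then have "?S x = x" using rep(2)[OF e] mate(3)[OF e] by (intro transpose_apply_other) auto
    then show ?thesis using False Cons.IH[of x] Cons.prems by (simp add: st)
  qed
qed simp

text \<open>A flag outside \<open>T\<close> takes the value of its \<open>side\<close> partner.
  Invariance under \<open>side\<close> is then built in, and invariance under \<open>rot\<close>
  supplies invariance under \<open>f\<close>.\<close>

lemma extension:
  fixes v :: "'f \<Rightarrow> complex"
  assumes v: "\<And>x. x \<in> T \<Longrightarrow> v (rot X x) = v x" and x: "x \<in> flags G"
  defines "u \<equiv> \<lambda>x. if c x then v x else v (side G X x)"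
  shows "u (f x) = u x \<and> u (side G X x) = u x"
proof -
  note s = sideD[OF G x, of X]
  have inv: "v (f (side G X y)) = v y" if "y \<in> flags G" "c y" for y
    using v[of y] that by (simp add: rot_def T_def)
  have "u (f x) = u x"
  proof (cases "c x")
    case True
    let ?y = "side G X (f x)"
    have "?y \<in> flags G" "c ?y" "side G X ?y = f x"
      using f[OF x] sideD[OF G, of "f x" X] side_col[of "f x" X] True by simp_all
    then have "v x = v ?y" using inv[of ?y] f[OF x] by simp
    then show ?thesis using True f[OF x] by (simp add: u_def)
  next
    case False
    have "v (f x) = v (side G X x)" using inv[of "side G X x"] s side_col[OF x] False by simp
    then show ?thesis using False f[OF x] by (simp add: u_def)
  qed
  moreover have "u (side G X x) = u x" using s side_col[OF x, of X] by (simp add: u_def)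
  ultimately show ?thesis ..
qed

text \<open>Restriction to \<open>T\<close> and \<open>extension\<close> translate between the two
  kinds of invariant functions; every flag is at most one \<open>side\<close> step away from
  \<open>T\<close>.\<close>

lemma ergodic_on_rot_iff: "ergodic_on T cls (rot X) \<longleftrightarrow> inv_connected G f X"
proof
  assume erg: "ergodic_on T cls (rot X)"
  show "inv_connected G f X"
    unfolding inv_connected_def
  proof (intro allI impI ballI)
    fix u :: "'f \<Rightarrow> complex" and x y
    assume u: "\<forall>x\<in>flags G. u (f x) = u x \<and> u (side G X x) = u x"
      and xy: "x \<in> flags G" "(x, y) \<in> (cstep G)\<^sup>*"
    have yF: "y \<in> flags G" by (rule cstep_rtrancl_flags[OF G xy(2,1)])
    have "u (rot X z) = u z" if "z \<in> T" for z
      using that u sideD(1)[OF G T_flags[OF that], of X] T_flags[OF that] by (simp add: rot_def)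
    then have const: "u z = u w" if "z \<in> T" "w \<in> T" "cls z = cls w" for z w
      using erg that unfolding ergodic_on_def by blast
    define h where "h = (\<lambda>z. if c z then z else side G X z)"
    have h: "h z \<in> T" "u (h z) = u z" "cls (h z) = cls z" if z: "z \<in> flags G" for z
    proof -
      have "(z, side G X z) \<in> (cstep G)\<^sup>*" by (rule cstepI(4)[OF z])
      then have "cls z = cls (side G X z)" unfolding cls_eq_iff .
      then show "cls (h z) = cls z" by (simp add: h_def)
      show "h z \<in> T" "u (h z) = u z"
        using sideD(1)[OF G z, of X] side_col[OF z, of X] u z by (auto simp: h_def T_def)
    qed
    have "cls x = cls y" using xy(2) by (simp add: cls_eq_iff)
    then show "u x = u y" using const[of "h x" "h y"] h[OF xy(1)] h[OF yF] by simp
  qed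
next
  assume conn: "inv_connected G f X"
  show "ergodic_on T cls (rot X)"
    unfolding ergodic_on_def
  proof (intro allI impI ballI)
    fix v :: "'f \<Rightarrow> complex" and x y
    assume v: "\<forall>x\<in>T. v (rot X x) = v x" and xy: "x \<in> T" "y \<in> T" "cls x = cls y"
    define u where "u = (\<lambda>x. if c x then v x else v (side G X x))"
    have "\<forall>x\<in>flags G. u (f x) = u x \<and> u (side G X x) = u x"
      using extension[of v X] v unfolding u_def by blast
    then have "u x = u y"
      using conn xy T_flags[OF xy(1)] cls_eq_iff unfolding inv_connected_def by blast
    then show "v x = v y" using xy by (simp add: u_def T_def)
  qed
qed

text \<open>Supplies \<open>cl_generated\<close>: agreement across each edge pair is what makes the
  extension along \<open>sg G\<close> invariant under \<open>bt G\<close> too.\<close>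

lemma invariant_extension:
  fixes v :: "'f \<Rightarrow> complex"
  assumes v: "\<And>x. x \<in> T \<Longrightarrow> v (rot {} x) = v x" and ends: "\<And>e. e \<in> edges G \<Longrightarrow> v (rep e) = v (mate e)"
  obtains u where "\<And>x. x \<in> T \<Longrightarrow> u x = v x"
    "\<And>x. x \<in> flags G \<Longrightarrow> u (f x) = u x \<and> u (sg G x) = u x \<and> u (bt G x) = u x"
proof -
  define u where "u = (\<lambda>x. if c x then v x else v (sg G x))"
  have opp: "v (sg G (bt G x)) = v x" if x: "x \<in> T" for x
  proof -
    have e: "edg G x \<in> edges G" using T_flags[OF x] by (simp add: edges_def)
    show ?thesis using T_edge_cases[OF x] ends[OF e] mate(4)[OF e] by (metis mate_def)
  qed
  have "u (f x) = u x \<and> u (sg G x) = u x \<and> u (bt G x) = u x" if x: "x \<in> flags G" for x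
  proof -
    note X = ribbon_graphD[OF G x]
    have "u (f x) = u x \<and> u (sg G x) = u x"
      unfolding u_def using extension[of v "{}" x] v x unfolding side_empty by blast
    moreover have "u (bt G x) = u x"
    proof (cases "c x")
      case True
      then show ?thesis using opp[of x] x bt_col[OF x] by (simp add: u_def T_def)
    next
      case False
      then have "sg G x \<in> T" using X(4) sg_col[OF x] by (simp add: T_def)
      moreover have "sg G (bt G (sg G x)) = bt G x"
        using X(10) ribbon_graphD(5)[OF G X(7)] by simp
      ultimately have "v (bt G x) = v (sg G x)" using opp[of "sg G x"] by simp
      then show ?thesis using False bt_col[OF x] by (simp add: u_def)
    qed
    ultimately show ?thesis by blast
  qed
  then show thesis using that[of u] by (simp add: u_def T_def)
qed

end

section \<open>The orientable case as a swap family\<close>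

lemma invariant_cstep:
  assumes "\<And>x. x \<in> flags G \<Longrightarrow> u (alph G x) = u x \<and> u (sg G x) = u x \<and> u (bt G x) = u x"
    and "(x, y) \<in> (cstep G)\<^sup>*"
  shows "u x = u y"
  using assms(2)
proof (induction rule: rtrancl_induct)
  case (step y z)
  then show ?case using assms(1)[of y] by (auto simp: cstep_def)
qed simp

text \<open>The edges are wrapped in \<open>Some\<close> to share a type with the pseudo-orientable
  case, where \<open>None\<close> is the extra edge. By \<open>twist_edges\<close>, the permutation
  attached to \<open>X\<close> is \<open>rot X\<close> on \<open>T\<close>.\<close>

lemma flat_colouring_swap_family:
  fixes G :: "('f, 'e) rg"
  assumes G: "ribbon_graph G" and flat: "flat_colouring G c"
  obtains V :: "'f set" and p0 es s t and cl :: "'f \<Rightarrow> 'f set"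
  where "swap_family V p0 (es :: 'e option list) s t cl" "set es = Some ` edges G"
    "\<And>X. X \<subseteq> edges G \<Longrightarrow> quasi_tree G X \<longleftrightarrow> swap_family.feasible V p0 es s t cl (Some ` X)"
proof -
  interpret alternating_rg G c "alph G"
    by unfold_locales
      (use G flat ribbon_graphD[OF G] cstepI in \<open>auto simp: flat_colouring_def\<close>)
  have "finite (edges G)" using finite_flags[OF G] by (simp add: edges_def)
  then obtain el where el: "set el = edges G" "distinct el" using finite_distinct_list by blast
  let ?es = "map Some el" and ?s = "rep \<circ> the" and ?t = "mate \<circ> the"
  interpret sf: swap_family T "rot {}" ?es ?s ?t cls
  proof unfold_locales
    show "?s e \<in> T \<and> ?t e \<in> T \<and> ?s e \<noteq> ?t e" if "e \<in> set ?es" for e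
      using that el rep mate by fastforce
    show "cls (?s e) = cls (?t e)" if "e \<in> set ?es" for e
      using that el cls_mate by auto
    show "\<forall>i\<in>T. \<forall>j\<in>T. cls i = cls j \<longrightarrow> v i = v j"
      if v: "\<And>i. i \<in> T \<Longrightarrow> v (rot {} i) = v i" "\<And>e. e \<in> set ?es \<Longrightarrow> v (?s e) = v (?t e)"
      for v :: "'f \<Rightarrow> complex"
    proof (intro ballI impI)
      fix i j assume ij: "i \<in> T" "j \<in> T" "cls i = cls j"
      have "v (rep e) = v (mate e)" if "e \<in> edges G" for e
        using v(2)[of "Some e"] that el by simp
      then obtain u where u: "\<And>x. x \<in> T \<Longrightarrow> u x = v x"
        "\<And>x. x \<in> flags G \<Longrightarrow> u (alph G x) = u x \<and> u (sg G x) = u x \<and> u (bt G x) = u x"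
        using invariant_extension[of v] v(1) by blast
      have "u i = u j" by (rule invariant_cstep[OF u(2)]) (use ij cls_eq_iff in auto)
      then show "v i = v j" using u(1) ij by simp
    qed
  qed (use finite_T rot_permutes el cls_rot in \<open>auto simp: distinct_map\<close>)
  have "quasi_tree G X \<longleftrightarrow> sf.feasible (Some ` X)" if X: "X \<subseteq> edges G" for X
  proof -
    have "sf.perm (Some ` X) x = rot X x" if x: "x \<in> T" for x
    proof -
      have e: "edg G x \<in> set el" using T_flags[OF x] el by (simp add: edges_def)
      have "twist ?s ?t (Some ` X) ?es x = (if edg G x \<in> X then sg G (bt G x) else x)"
        using twist_edges[of el x ?s ?t "Some ` X"] el e x by auto
      then show ?thesis
        using x opposite[OF x] by (auto simp: sf.perm_def rot_def side_def)
    qed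
    then have "ergodic_on T cls (sf.perm (Some ` X)) \<longleftrightarrow> inv_connected G (alph G) X"
      using ergodic_on_cong[of T "sf.perm (Some ` X)" "rot X" cls] ergodic_on_rot_iff by simp
    moreover have "Some ` X \<subseteq> set ?es" using X el by auto
    ultimately show ?thesis
      using X by (simp add: sf.feasible_def quasi_tree_iff_inv_connected[OF G])
  qed
  then show thesis using that[OF sf.swap_family_axioms] el by simp
qed

text \<open>\<open>\<sigma>\<close> balances the two colours on \<open>C\<close> and
  \<open>g\<close> balances them on \<open>C - D\<close>, although the nonempty difference
  \<open>D\<close> has only one colour.\<close>

lemma unbalanced_False:
  assumes fin: "finite C"
    and \<sigma>: "\<And>x. x \<in> C \<Longrightarrow> \<sigma> x \<in> C \<and> \<sigma> (\<sigma> x) = x \<and> c (\<sigma> x) = (\<not> c x)"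
    and g: "\<And>x. x \<in> C - D \<Longrightarrow> g x \<in> C - D \<and> g (g x) = x \<and> c (g x) = (\<not> c x)"
    and D: "D \<subseteq> C" "D \<noteq> {}" "\<And>x. x \<in> D \<Longrightarrow> c x"
  shows False
proof -
  have "card {x \<in> C. c x} = card {x \<in> C. \<not> c x}"
    by (rule card_colour_classes[where \<sigma> = \<sigma>]) (use fin \<sigma> in auto)
  moreover have "card {x \<in> C - D. c x} = card {x \<in> C - D. \<not> c x}"
    by (rule card_colour_classes[where \<sigma> = g]) (use fin g in auto)
  moreover have "{x \<in> C - D. \<not> c x} = {x \<in> C. \<not> c x}" using D by auto
  moreover have "card {x \<in> C - D. c x} < card {x \<in> C. c x}"
    using fin D by (intro psubset_card_mono) auto
  ultimately show False by simp
qed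

text \<open>One of the two ways of rerouting the exceptional arcs so that they alternate; replacing \<open>b\<close> by
  \<open>alph G b\<close> gives the other.\<close>

definition reroute :: "('f, 'e) rg \<Rightarrow> 'f \<Rightarrow> 'f \<Rightarrow> 'f \<Rightarrow> 'f" where
  "reroute G a b x = (if x = a then alph G b else if x = alph G a then b
     else if x = b then alph G a else if x = alph G b then a else alph G x)"

lemma bent_colouring_alph:
  assumes "ribbon_graph G" "bent_colouring G c a b"
  shows "bent_colouring G c a (alph G b)"
  using assms ribbon_graphD[OF assms(1), of b]
  unfolding bent_colouring_def by (auto simp: insert_commute)

locale bent_rg =
  fixes G :: "('f, 'e) rg" and c :: "'f \<Rightarrow> bool" and a b :: 'f
  assumes G: "ribbon_graph G" and bent: "bent_colouring G c a b" and ab: "(a, b) \<in> (cstep G)\<^sup>*"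
begin

lemma flags_ab: "a \<in> flags G" "b \<in> flags G" "alph G a \<in> flags G" "alph G b \<in> flags G"
  and colours_ab: "c a" "c (alph G a)" "\<not> c b" "\<not> c (alph G b)"
  and col: "colouring G c"
  and alternating: "\<And>x. x \<in> flags G \<Longrightarrow> x \<notin> {a, alph G a, b, alph G b} \<Longrightarrow> c (alph G x) = (\<not> c x)"
  using bent ribbon_graphD(1)[OF G] unfolding bent_colouring_def by blast+

lemma alph_alph: "x \<in> flags G \<Longrightarrow> alph G (alph G x) = x"
  by (rule ribbon_graphD(2)[OF G])

lemma exceptional_distinct: "a \<noteq> b" "a \<noteq> alph G b" "alph G a \<noteq> b" "alph G a \<noteq> alph G b"
    "alph G a \<noteq> a" "alph G b \<noteq> b"
  using colours_ab ribbon_graphD(3)[OF G] flags_ab by auto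

lemma alph_not_exceptional:
  assumes "x \<in> flags G" "x \<notin> {a, alph G a, b, alph G b}"
  shows "alph G x \<notin> {a, alph G a, b, alph G b}"
  using assms alph_alph[OF assms(1)] alph_alph[OF flags_ab(1)] alph_alph[OF flags_ab(2)] by auto

lemma reroute_values:
  "reroute G a b a = alph G b" "reroute G a b (alph G a) = b" "reroute G a b b = alph G a"
  "reroute G a b (alph G b) = a"
  "x \<notin> {a, alph G a, b, alph G b} \<Longrightarrow> reroute G a b x = alph G x"
  using exceptional_distinct by (auto simp: reroute_def)

lemma cstep_ab: "(x, y) \<in> (cstep G)\<^sup>*"
  if "x \<in> {a, alph G a, b, alph G b}" "y \<in> {a, alph G a, b, alph G b}"
proof -
  have sym: "(y, x) \<in> (cstep G)\<^sup>*" if "(x, y) \<in> (cstep G)\<^sup>*" for x y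
    using that sym_rtrancl[OF sym_cstep[OF G]] by (blast dest: symD)
  have "(a, z) \<in> (cstep G)\<^sup>*" if "z \<in> {a, alph G a, b, alph G b}" for z
    using that ab cstepI(1)[OF flags_ab(1)] cstepI(1)[OF flags_ab(2)] by (auto intro: rtrancl_trans)
  then show ?thesis using that sym by (meson rtrancl_trans)
qed

sublocale alternating_rg G c "reroute G a b"
proof
  fix x assume x: "x \<in> flags G"
  show "reroute G a b x \<in> flags G \<and> reroute G a b (reroute G a b x) = x \<and> c (reroute G a b x) = (\<not> c x)"
  proof (cases "x \<in> {a, alph G a, b, alph G b}")
    case True
    then show ?thesis using flags_ab colours_ab by (auto simp: reroute_values)
  next
    case False
    then show ?thesis
      using x alph_not_exceptional[OF x False] alternating[OF x False] alph_alph[OF x]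
        ribbon_graphD(1)[OF G x] by (simp add: reroute_values(5))
  qed
  show "(x, reroute G a b x) \<in> (cstep G)\<^sup>*"
  proof (cases "x \<in> {a, alph G a, b, alph G b}")
    case True
    then have "reroute G a b x \<in> {a, alph G a, b, alph G b}" by (auto simp: reroute_values)
    then show ?thesis using True cstep_ab by blast
  next
    case False
    then show ?thesis using cstepI(1)[OF x] by (simp add: reroute_values(5))
  qed
qed (rule G, rule col)

text \<open>Rerouted arcs join \<open>a\<close> to \<open>alph G b\<close> and
  \<open>alph G a\<close> to \<open>b\<close>. Once \<open>a\<close> and \<open>alph G a\<close>
  agree, all four exceptional flags agree, so the original arcs are respected as well.\<close>

lemma reroute_invariant_imp:
  assumes u: "\<And>x. x \<in> flags G \<Longrightarrow> u (reroute G a b x) = u x" and a: "u a = u (alph G a)"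
    and x: "x \<in> flags G"
  shows "u (alph G x) = u x"
proof (cases "x \<in> {a, alph G a, b, alph G b}")
  case True
  have "u (alph G b) = u a" "u b = u (alph G a)"
    using u[OF flags_ab(1)] u[OF flags_ab(3)] by (simp_all add: reroute_values)
  then show ?thesis using True a alph_alph[OF flags_ab(1)] alph_alph[OF flags_ab(2)] by auto
next
  case False
  then show ?thesis using u[OF x] by (simp add: reroute_values(5))
qed

text \<open>If \<open>u\<close> separated \<open>a\<close> from \<open>b\<close>, its level set through \<open>a\<close> would contain just one of the two
  exceptional arcs.\<close>

lemma alph_invariant_imp:
  fixes u :: "'f \<Rightarrow> complex"
  assumes u: "\<And>x. x \<in> flags G \<Longrightarrow> u (alph G x) = u x \<and> u (side G X x) = u x" and x: "x \<in> flags G"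
  shows "u (reroute G a b x) = u x"
proof -
  have ua: "u (alph G a) = u a" "u (alph G b) = u b" using u flags_ab by auto
  have "u a = u b"
  proof (rule ccontr)
    assume ne: "u a \<noteq> u b"
    let ?C = "{x \<in> flags G. u x = u a}"
    show False
    proof (rule unbalanced_False[of ?C "side G X" c "{a, alph G a}" "alph G"])
      show "side G X x \<in> ?C \<and> side G X (side G X x) = x \<and> c (side G X x) = (\<not> c x)" if "x \<in> ?C" for x
        using that u sideD[OF G] side_col by simp
      show "alph G x \<in> ?C - {a, alph G a} \<and> alph G (alph G x) = x \<and> c (alph G x) = (\<not> c x)"
        if x: "x \<in> ?C - {a, alph G a}" for x
      proof -
        have xF: "x \<in> flags G" "u x = u a" using x by auto
        have ex: "x \<notin> {a, alph G a, b, alph G b}" using x ne ua by auto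
        show ?thesis
          using alph_not_exceptional[OF xF(1) ex] alternating[OF xF(1) ex] alph_alph[OF xF(1)]
            ribbon_graphD(1)[OF G xF(1)] u[OF xF(1)] xF by simp
      qed
    qed (use finite_flags[OF G] flags_ab colours_ab ua in auto)
  qed
  then show ?thesis
    using u[OF x] ua by (auto simp: reroute_def)
qed

lemma inv_connected_reroute_imp:
  assumes "inv_connected G (reroute G a b) X"
  shows "inv_connected G (alph G) X"
  unfolding inv_connected_def
proof (intro allI impI)
  fix u :: "'f \<Rightarrow> complex"
  assume u: "\<forall>x\<in>flags G. u (alph G x) = u x \<and> u (side G X x) = u x"
  have "\<forall>x\<in>flags G. u (reroute G a b x) = u x \<and> u (side G X x) = u x"
    using alph_invariant_imp[of u X] u by blast
  then show "\<forall>x\<in>flags G. \<forall>y. (x, y) \<in> (cstep G)\<^sup>* \<longrightarrow> u x = u y"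
    using assms unfolding inv_connected_def by blast
qed

text \<open>A function witnessing that the rerouting fails must separate \<open>a\<close> from
  \<open>alph G a\<close>; otherwise it would be invariant under the original arcs and contradict
  \<open>conn\<close>.\<close>

lemma inv_connected_alph_imp:
  assumes conn: "inv_connected G (alph G) X" and nr: "\<not> inv_connected G (reroute G a b) X"
  obtains v :: "'f \<Rightarrow> complex" where "v a \<noteq> v (alph G a)"
    "\<And>x. x \<in> flags G \<Longrightarrow> v (reroute G a b x) = v x \<and> v (side G X x) = v x"
proof -
  obtain v :: "'f \<Rightarrow> complex" where v: "\<forall>x\<in>flags G. v (reroute G a b x) = v x \<and> v (side G X x) = v x"
    and nc: "\<not> (\<forall>x\<in>flags G. \<forall>y. (x, y) \<in> (cstep G)\<^sup>* \<longrightarrow> v x = v y)"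
    using nr unfolding inv_connected_def by blast
  have "v a \<noteq> v (alph G a)"
  proof
    assume "v a = v (alph G a)"
    then have "\<forall>x\<in>flags G. v (alph G x) = v x \<and> v (side G X x) = v x"
      using reroute_invariant_imp[of v] v by blast
    then show False using conn nc unfolding inv_connected_def by blast
  qed
  then show thesis using that[of v] v by blast
qed

end

lemma (in bent_rg) bent_rg_other: "bent_rg G c a (alph G b)"
proof
  show "(a, alph G b) \<in> (cstep G)\<^sup>*" by (rule cstep_ab) auto
qed (rule G, rule bent_colouring_alph[OF G bent])

text \<open>If both reroutings failed, each would have a witness separating \<open>a\<close> from
  \<open>alph G a\<close>. The first takes equal values at \<open>b\<close> and
  \<open>alph G a\<close>, the second at \<open>alph G b\<close> and \<open>alph G a\<close>. Their
  common level set through \<open>a\<close> then meets the exceptional flags only in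
  \<open>a\<close>, which contradicts the colour balance.\<close>

lemma (in bent_rg) inv_connected_alph_iff:
  "inv_connected G (alph G) X \<longleftrightarrow>
     inv_connected G (reroute G a b) X \<or> inv_connected G (reroute G a (alph G b)) X"
proof -
  interpret o: bent_rg G c a "alph G b" by (rule bent_rg_other)
  have False if conn: "inv_connected G (alph G) X"
    and n: "\<not> inv_connected G (reroute G a b) X" "\<not> inv_connected G (reroute G a (alph G b)) X"
  proof -
    obtain v :: "'f \<Rightarrow> complex" where v: "v a \<noteq> v (alph G a)"
      "\<And>x. x \<in> flags G \<Longrightarrow> v (reroute G a b x) = v x \<and> v (side G X x) = v x"
      using inv_connected_alph_imp[OF conn n(1)] by blast
    obtain w :: "'f \<Rightarrow> complex" where w: "w a \<noteq> w (alph G a)"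
      "\<And>x. x \<in> flags G \<Longrightarrow> w (reroute G a (alph G b) x) = w x \<and> w (side G X x) = w x"
      using o.inv_connected_alph_imp[OF conn n(2)] by blast
    have bb: "alph G (alph G b) = b" by (rule alph_alph[OF flags_ab(2)])
    have vb: "v b = v (alph G a)" using v(2)[OF flags_ab(2)] by (simp add: reroute_values)
    have wb: "w (alph G b) = w (alph G a)"
      using w(2)[OF flags_ab(4)] by (simp add: o.reroute_values)
    let ?C = "{x \<in> flags G. v x = v a \<and> w x = w a}"
    show False
    proof (rule unbalanced_False[of ?C "side G X" c "{a}" "alph G"])
      show "side G X x \<in> ?C \<and> side G X (side G X x) = x \<and> c (side G X x) = (\<not> c x)" if "x \<in> ?C" for x
        using that v(2) w(2) sideD[OF G] side_col by simp
      show "alph G x \<in> ?C - {a} \<and> alph G (alph G x) = x \<and> c (alph G x) = (\<not> c x)"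
        if x: "x \<in> ?C - {a}" for x
      proof -
        have xF: "x \<in> flags G" "v x = v a" "w x = w a" "x \<noteq> a" using x by auto
        have ex: "x \<notin> {a, alph G a, b, alph G b}" using xF v(1) w(1) vb wb by auto
        have "v (alph G x) = v x" "w (alph G x) = w x"
          using v(2)[OF xF(1)] w(2)[OF xF(1)] reroute_values(5)[OF ex] o.reroute_values(5)[of x] ex bb
          by auto
        then show ?thesis
          using alph_not_exceptional[OF xF(1) ex] alternating[OF xF(1) ex] alph_alph[OF xF(1)]
            ribbon_graphD(1)[OF G xF(1)] xF by simp
      qed
    qed (use finite_flags[OF G] flags_ab colours_ab in auto)
  qed
  then show ?thesis using inv_connected_reroute_imp o.inv_connected_reroute_imp by blast
qed

text \<open>\<open>None\<close> is last in the list, so its transposition acts after those of the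
  edges and just before \<open>rot {}\<close>. There it turns the rerouting by \<open>b\<close> into
  the one by \<open>alph G b\<close>; the two disjuncts are the two reroutings.\<close>

lemma bent_colouring_swap_family:
  fixes G :: "('f, 'e) rg"
  assumes G: "ribbon_graph G" and bent: "bent_colouring G c a b" and ab: "(a, b) \<in> (cstep G)\<^sup>*"
  obtains V :: "'f set" and p0 es s t and cl :: "'f \<Rightarrow> 'f set"
  where "swap_family V p0 (es :: 'e option list) s t cl" "set es = insert None (Some ` edges G)"
    "\<And>X. X \<subseteq> edges G \<Longrightarrow> quasi_tree G X \<longleftrightarrow> swap_family.feasible V p0 es s t cl (Some ` X)
      \<or> swap_family.feasible V p0 es s t cl (insert None (Some ` X))"
proof -
  interpret bent_rg G c a b by unfold_locales (rule G bent ab)+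
  interpret o: bent_rg G c a "alph G b" by (rule bent_rg_other)
  have "finite (edges G)" using finite_flags[OF G] by (simp add: edges_def)
  then obtain el where el: "set el = edges G" "distinct el" using finite_distinct_list by blast
  \<comment> \<open>\<open>rot {}\<close> sends these two ends to \<open>a\<close> and
    \<open>alph G a\<close>, the images of \<open>alph G b\<close> and \<open>b\<close>. The other
    rerouting has these two images exchanged.\<close>
  define s where "s = (\<lambda>e. case e of None \<Rightarrow> sg G (alph G b) | Some e \<Rightarrow> rep e)"
  define t where "t = (\<lambda>e. case e of None \<Rightarrow> sg G b | Some e \<Rightarrow> mate e)"
  have st: "s (Some e) = rep e" "t (Some e) = mate e" "s None = sg G (alph G b)" "t None = sg G b" for e
    by (simp_all add: s_def t_def)
  have sgb: "sg G (sg G b) = b" "sg G (sg G (alph G b)) = alph G b"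
    using ribbon_graphD(5)[OF G] flags_ab by auto
  have None: "s None \<in> T" "t None \<in> T" "s None \<noteq> t None"
  proof -
    show "s None \<in> T" "t None \<in> T"
      using sg_col flags_ab colours_ab ribbon_graphD(4)[OF G] by (auto simp: st T_def)
    show "s None \<noteq> t None" using sgb exceptional_distinct(6) unfolding st by metis
  qed
  let ?es = "map Some el @ [None]"
  interpret sf: swap_family T "rot {}" ?es s t cls
  proof unfold_locales
    show "s e \<in> T \<and> t e \<in> T \<and> s e \<noteq> t e" if "e \<in> set ?es" for e
      using that el rep mate None by (auto simp: st) (metis mate(2))
    show "cls (s e) = cls (t e)" if "e \<in> set ?es" for e
    proof (cases e)
      case None
      have F: "s None \<in> flags G" "t None \<in> flags G" using \<open>s None \<in> T\<close> \<open>t None \<in> T\<close> T_flags by auto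
      have "(s None, alph G b) \<in> (cstep G)\<^sup>*" "(b, t None) \<in> (cstep G)\<^sup>*"
        using cstepI(2)[OF F(1)] cstepI(2)[OF flags_ab(2)] sgb by (simp_all add: st)
      then have "(s None, t None) \<in> (cstep G)\<^sup>*"
        using cstep_ab[of "alph G b" b] by (meson insertI1 insertI2 rtrancl_trans)
      then show ?thesis using None by (simp add: cls_eq_iff)
    next
      case (Some e')
      then show ?thesis using that el cls_mate by (auto simp: st)
    qed
    show "\<forall>i\<in>T. \<forall>j\<in>T. cls i = cls j \<longrightarrow> v i = v j"
      if v: "\<And>i. i \<in> T \<Longrightarrow> v (rot {} i) = v i" "\<And>e. e \<in> set ?es \<Longrightarrow> v (s e) = v (t e)"
      for v :: "'f \<Rightarrow> complex"
    proof (intro ballI impI)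
      fix i j assume ij: "i \<in> T" "j \<in> T" "cls i = cls j"
      have "v (rep e) = v (mate e)" if "e \<in> edges G" for e
        using v(2)[of "Some e"] that el by (simp add: st)
      then obtain u where u: "\<And>x. x \<in> T \<Longrightarrow> u x = v x"
        "\<And>x. x \<in> flags G \<Longrightarrow> u (reroute G a b x) = u x \<and> u (sg G x) = u x \<and> u (bt G x) = u x"
        using invariant_extension[of v] v(1) by blast
      \<comment> \<open>Agreement across \<open>None\<close> thus means agreement of
        \<open>a\<close> and \<open>alph G a\<close>, which is what makes \<open>u\<close> invariant
        under the true vertex arcs.\<close>
      have "v a = v (s None)" "v (alph G a) = v (t None)"
        using v(1)[OF None(1)] v(1)[OF None(2)] None sgb by (simp_all add: rot_def side_empty st reroute_values)
      then have "u a = u (alph G a)"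
        using v(2)[of None] u(1) flags_ab colours_ab by (simp add: T_def)
      then have "u (alph G x) = u x \<and> u (sg G x) = u x \<and> u (bt G x) = u x" if "x \<in> flags G" for x
        using reroute_invariant_imp[of u x] u(2) that by blast
      then have "u i = u j" by (rule invariant_cstep) (use ij cls_eq_iff in auto)
      then show "v i = v j" using u(1) ij by simp
    qed
  qed (use finite_T rot_permutes el cls_rot in \<open>auto simp: distinct_map\<close>)
  have "quasi_tree G X \<longleftrightarrow> sf.feasible (Some ` X) \<or> sf.feasible (insert None (Some ` X))"
    if X: "X \<subseteq> edges G" for X
  proof -
    have mem: "Some e \<in> Some ` X \<longleftrightarrow> e \<in> X" "Some e \<in> insert None (Some ` X) \<longleftrightarrow> e \<in> X" for e
      by auto
    have tw: "sg G (twist s t Y (map Some el) x) = side G X x \<and> twist s t Y (map Some el) x \<in> T"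
      if x: "x \<in> T" and Y: "\<And>e. Some e \<in> Y \<longleftrightarrow> e \<in> X" for x Y
    proof -
      have e: "edg G x \<in> set el" using T_flags[OF x] el by (simp add: edges_def)
      have "twist s t Y (map Some el) x = (if edg G x \<in> X then sg G (bt G x) else x)"
        using twist_edges[of el x s t Y] el e x Y by (simp add: st)
      then show ?thesis using x opposite[OF x] by (simp add: side_def)
    qed
    have "sf.perm (Some ` X) x = rot X x" if x: "x \<in> T" for x
    proof -
      have "sf.perm (Some ` X) x = rot {} (twist s t (Some ` X) (map Some el) x)"
        by (simp add: sf.perm_def twist_append)
      then show ?thesis using tw[OF x mem(1)] x by (simp add: rot_def side_empty)
    qed
    then have "ergodic_on T cls (sf.perm (Some ` X)) \<longleftrightarrow> inv_connected G (reroute G a b) X"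
      using ergodic_on_cong[of T "sf.perm (Some ` X)" "rot X" cls] ergodic_on_rot_iff by simp
    moreover have "sf.perm (insert None (Some ` X)) x = o.rot X x" if x: "x \<in> T" for x
    proof -
      let ?Y = "insert None (Some ` X)"
      define y where "y = twist s t ?Y (map Some el) x"
      define z where "z = Transposition.transpose (s None) (t None) y"
      have y: "sg G y = side G X x" "y \<in> T" using tw[OF x mem(2)] by (simp_all add: y_def)
      have z: "z \<in> T" unfolding z_def using y(2) None by (simp add: transpose_in_iff)
      have "sf.perm ?Y x = rot {} z"
        by (simp add: sf.perm_def twist_append y_def z_def)
      also have "\<dots> = reroute G a b (sg G z)" using z by (simp add: rot_def side_empty)
      also have "\<dots> = reroute G a (alph G b) (sg G y)"
      proof -
        have bb: "alph G (alph G b) = b" by (rule alph_alph[OF flags_ab(2)])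
        consider "y = s None" | "y = t None" | "y \<noteq> s None" "y \<noteq> t None" by blast
        then show ?thesis
        proof cases
          case 1
          then have "sg G z = b" "sg G y = alph G b" using sgb by (simp_all add: z_def st)
          then show ?thesis using reroute_values(3) o.reroute_values(3) by simp
        next
          case 2
          then have "sg G z = alph G b" "sg G y = b" using sgb by (simp_all add: z_def st)
          then show ?thesis using reroute_values(4) o.reroute_values(4) bb by simp
        next
          case 3
          have yz: "z = y" using 3 by (simp add: z_def)
          have yF: "y \<in> flags G" "c y" using y(2) by (simp_all add: T_def)
          have yy: "sg G (sg G y) = y" by (rule ribbon_graphD(5)[OF G yF(1)])
          have "sg G y \<noteq> b" "sg G y \<noteq> alph G b" using 3 yy by (auto simp: st)
          \<comment> \<open>Flags reached by \<open>sg G\<close> from \<open>T\<close> have the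
            other colour, so the two reroutings are only compared away from \<open>a\<close> and
            \<open>alph G a\<close>.\<close>
          moreover have "sg G y \<noteq> a" "sg G y \<noteq> alph G a"
            using sg_col[OF yF(1)] yF(2) colours_ab by auto
          ultimately show ?thesis using yz bb by (simp add: reroute_def)
        qed
      qed
      also have "\<dots> = o.rot X x" using x y by (simp add: o.rot_def)
      finally show ?thesis .
    qed
    then have "ergodic_on T cls (sf.perm (insert None (Some ` X)))
        \<longleftrightarrow> inv_connected G (reroute G a (alph G b)) X"
      using ergodic_on_cong[of T "sf.perm (insert None (Some ` X))" "o.rot X" cls] o.ergodic_on_rot_iff
      by simp
    moreover have "Some ` X \<subseteq> set ?es" "insert None (Some ` X) \<subseteq> set ?es" using X el by auto
    ultimately show ?thesis
      using X inv_connected_alph_iff[of X]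
      by (simp add: sf.feasible_def quasi_tree_iff_inv_connected[OF G])
  qed
  then show thesis using that[OF sf.swap_family_axioms] el by simp
qed

section \<open>Distances to \<open>Q\<close> in the presence of the extra element\<close>

lemma card_Some_sym_diff:
  assumes "finite Q" "finite Y"
  shows "card ((Some ` Q - Y) \<union> (Y - Some ` Q))
      = card ((Q - Some -` Y) \<union> (Some -` Y - Q)) + of_bool (None \<in> Y)"
    and "card ((insert None (Some ` Q) - Y) \<union> (Y - insert None (Some ` Q)))
      = card ((Q - Some -` Y) \<union> (Some -` Y - Q)) + of_bool (None \<notin> Y)"
proof -
  let ?D = "(Q - Some -` Y) \<union> (Some -` Y - Q)"
  have fin: "finite ?D" using assms by (auto intro: finite_vimageI)
  have card: "card (Some ` ?D) = card ?D" by (simp add: card_image)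
  have "y \<in> (Some ` Q - Y) \<union> (Y - Some ` Q)
      \<longleftrightarrow> y \<in> (if None \<in> Y then insert None (Some ` ?D) else Some ` ?D)" for y
    by (cases y) auto
  then have "(Some ` Q - Y) \<union> (Y - Some ` Q) = (if None \<in> Y then insert None (Some ` ?D) else Some ` ?D)"
    by (rule Set.set_eqI)
  then show "card ((Some ` Q - Y) \<union> (Y - Some ` Q)) = card ?D + of_bool (None \<in> Y)"
    using fin card by auto
  have "y \<in> (insert None (Some ` Q) - Y) \<union> (Y - insert None (Some ` Q))
      \<longleftrightarrow> y \<in> (if None \<in> Y then Some ` ?D else insert None (Some ` ?D))" for y
    by (cases y) auto
  then have "(insert None (Some ` Q) - Y) \<union> (Y - insert None (Some ` Q))
      = (if None \<in> Y then Some ` ?D else insert None (Some ` ?D))"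
    by (rule Set.set_eqI)
  then show "card ((insert None (Some ` Q) - Y) \<union> (Y - insert None (Some ` Q)))
      = card ?D + of_bool (None \<notin> Y)"
    using fin card by auto
qed

text \<open>Since the feasible sets all have the same parity, the extra element \<open>None\<close> is determined by
  the rest; adding it to \<open>Q\<close> if necessary makes all distances even, which merges the sizes
  \<open>2 * i - 1\<close> and \<open>2 * i\<close>.\<close>

lemma qt_seq_swap_family:
  fixes G :: "('f, 'e) rg" and es :: "'e option list"
  assumes sf: "swap_family V p0 es s t cl"
    and es: "set es = Some ` edges G \<or> set es = insert None (Some ` edges G)"
    and qt: "\<And>X. X \<subseteq> edges G \<Longrightarrow> quasi_tree G X \<longleftrightarrow> swap_family.feasible V p0 es s t cl (Some ` X)
      \<or> swap_family.feasible V p0 es s t cl (insert None (Some ` X))"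
    and Q: "Q \<subseteq> edges G"
  shows "ultra_log_concave (qt_seq G Q) \<and> no_internal_zeros (qt_seq G Q)"
proof -
  interpret swap_family V p0 es s t cl by (rule sf)
  have "finite (Some ` edges G)" using es finite_set[of es] by (metis finite_insert)
  then have finE: "finite (edges G)" by (simp add: finite_image_iff)
  then have finQ: "finite Q" using Q finite_subset by blast
  have feas: "finite Y" "Some -` Y \<subseteq> edges G" if "feasible Y" for Y
    using that es finite_subset[OF _ finite_set, of Y es] unfolding feasible_def by auto
  have shape: "Y = (if None \<in> Y then insert None (Some ` (Some -` Y)) else Some ` (Some -` Y))"
    (is "Y = ?R") for Y :: "'e option set"
  proof (rule Set.set_eqI)
    show "y \<in> Y \<longleftrightarrow> y \<in> ?R" for y by (cases y) auto
  qed
  define d where "d = (\<lambda>X. card ((Q - X) \<union> (X - Q)))"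
  define N where "N = (\<lambda>S Y :: 'e option set. card ((S - Y) \<union> (Y - S)))"
  have N: "N (Some ` Q) Y = d (Some -` Y) + of_bool (None \<in> Y)"
    "N (insert None (Some ` Q)) Y = d (Some -` Y) + of_bool (None \<notin> Y)" if "feasible Y" for Y
    unfolding N_def d_def by (rule card_Some_sym_diff[OF finQ feas(1)[OF that]])+
  have N_parity: "even (N (Some ` Q) Y) \<longleftrightarrow> even (N (Some ` Q) Z)" if "feasible Y" "feasible Z" for Y Z
    unfolding N_def using feas(1)[OF that(1)] feas(1)[OF that(2)] finQ feasible_parity[OF that]
    by (simp add: even_card_sym_diff)
  have SQ: "Some ` Q \<subseteq> set es" using es Q by auto
  obtain S where S: "S \<subseteq> set es"
    "\<And>Y i. feasible Y \<Longrightarrow> int (N S Y) \<in> {2 * i - 1, 2 * i} \<longleftrightarrow> int (d (Some -` Y)) \<in> {2 * i - 1, 2 * i}"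
  proof (cases "None \<in> set es")
    case False
    have "None \<notin> Y" if "feasible Y" for Y using False that by (auto simp: feasible_def)
    then show thesis using that[OF SQ] N(1) by simp
  next
    case True
    \<comment> \<open>An even number lying in \<open>{2 * i - 1, 2 * i}\<close> equals
      \<open>2 * i\<close>, and rounding \<open>m\<close> up to an even number lands there exactly
      when \<open>m\<close> is in this set.\<close>
    have merge: "int (m + of_bool P) \<in> {2 * i - 1, 2 * i} \<longleftrightarrow> int m \<in> {2 * i - 1, 2 * i}"
      if "even (m + of_bool P)" for m P i
      using that by (cases P; simp; presburger)
    show thesis
    proof (cases "\<exists>Z. feasible Z \<and> odd (N (Some ` Q) Z)")
      case odd: True
      then have odd_N: "odd (N (Some ` Q) Y)" if "feasible Y" for Y using N_parity that by blast
      have ev: "even (d (Some -` Y) + of_bool (None \<notin> Y))" if "feasible Y" for Y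
        using N(1)[OF that] odd_N[OF that] by (cases "None \<in> Y") auto
      have "int (N (insert None (Some ` Q)) Y) \<in> {2 * i - 1, 2 * i}
          \<longleftrightarrow> int (d (Some -` Y)) \<in> {2 * i - 1, 2 * i}" if "feasible Y" for Y i
        unfolding N(2)[OF that] by (rule merge[OF ev[OF that]])
      moreover have "insert None (Some ` Q) \<subseteq> set es" using es Q True by auto
      ultimately show thesis using that by blast
    next
      case False
      have ev: "even (d (Some -` Y) + of_bool (None \<in> Y))" if "feasible Y" for Y
        using N(1)[OF that] that False by metis
      have "int (N (Some ` Q) Y) \<in> {2 * i - 1, 2 * i}
          \<longleftrightarrow> int (d (Some -` Y)) \<in> {2 * i - 1, 2 * i}" if "feasible Y" for Y i
        unfolding N(1)[OF that] by (rule merge[OF ev[OF that]])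
      then show thesis using that[OF SQ] by blast
    qed
  qed
  \<comment> \<open>Two feasible sets with the same edges can differ only in \<open>None\<close>,
    which their common parity forbids. So \<open>X\<close> and \<open>X\<close> plus the extra edge
    are never both feasible.\<close>
  have inj: "inj_on (\<lambda>Y. Some -` Y) {Y. feasible Y}"
  proof (rule inj_onI)
    fix Y Z assume YZ: "Y \<in> {Y. feasible Y}" "Z \<in> {Y. feasible Y}" "Some -` Y = Some -` Z"
    then have "N (Some ` Q) Y + of_bool (None \<in> Z) = N (Some ` Q) Z + of_bool (None \<in> Y)"
      using N(1) by simp
    then have "even (N (Some ` Q) Y + of_bool (None \<in> Z)) \<longleftrightarrow> even (N (Some ` Q) Z + of_bool (None \<in> Y))"
      by (rule arg_cong)
    moreover have "even (N (Some ` Q) Y) \<longleftrightarrow> even (N (Some ` Q) Z)"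
      by (rule N_parity) (use YZ in auto)
    ultimately have "None \<in> Y \<longleftrightarrow> None \<in> Z"
      by (cases "None \<in> Y"; cases "None \<in> Z") simp_all
    then show "Y = Z" using shape[of Y] shape[of Z] YZ(3) by metis
  qed
  have img: "{X. quasi_tree G X \<and> int (d X) \<in> {2 * i - 1, 2 * i}}
      = (\<lambda>Y. Some -` Y) ` {Y. feasible Y \<and> int (N S Y) \<in> {2 * i - 1, 2 * i}}" for i
  proof (intro Set.set_eqI iffI)
    fix X assume X: "X \<in> {X. quasi_tree G X \<and> int (d X) \<in> {2 * i - 1, 2 * i}}"
    then have "X \<subseteq> edges G" by (simp add: quasi_tree_def)
    then obtain Y where Y: "feasible Y" "Y = Some ` X \<or> Y = insert None (Some ` X)"
      using X qt by blast
    have "Some -` Y = X" using Y(2) by auto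
    then show "X \<in> (\<lambda>Y. Some -` Y) ` {Y. feasible Y \<and> int (N S Y) \<in> {2 * i - 1, 2 * i}}"
      using X S(2)[OF Y(1), of i] Y(1) by (intro image_eqI[of _ _ Y]) simp_all
  next
    fix X assume "X \<in> (\<lambda>Y. Some -` Y) ` {Y. feasible Y \<and> int (N S Y) \<in> {2 * i - 1, 2 * i}}"
    then obtain Y where Y: "X = Some -` Y" "feasible Y" "int (N S Y) \<in> {2 * i - 1, 2 * i}" by blast
    have "feasible (Some ` X) \<or> feasible (insert None (Some ` X))"
      using Y(2) shape[of Y] unfolding Y(1) by metis
    then have "quasi_tree G X" using qt[of X] feas(2)[OF Y(2)] Y(1) by simp
    then show "X \<in> {X. quasi_tree G X \<and> int (d X) \<in> {2 * i - 1, 2 * i}}"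
      using S(2)[OF Y(2), of i] Y by simp
  qed
  show ?thesis
  proof (rule feasible_ultra_log_concave[OF S(1)])
    fix i
    have "card {X. quasi_tree G X \<and> int (d X) \<in> {2 * i - 1, 2 * i}}
        = card {Y. feasible Y \<and> int (N S Y) \<in> {2 * i - 1, 2 * i}}"
      unfolding img by (rule card_image, rule inj_on_subset[OF inj]) auto
    then show "qt_seq G Q i = (if i < 0 then 0 else
        real (card {X. feasible X \<and> int (card ((S - X) \<union> (X - S))) \<in> {2 * i - 1, 2 * i}}))"
      unfolding qt_seq_def d_def N_def by simp
  qed
qed

theorem theorem1p4:
  fixes G :: "('f, 'e) rg" and Q :: "'e set"
  assumes "ribbon_graph G" and "pseudo_orientable G" and "Q \<subseteq> edges G"
  shows "ultra_log_concave (qt_seq G Q) \<and> no_internal_zeros (qt_seq G Q)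
       \<and> ultra_log_concave (qt_seq G {}) \<and> no_internal_zeros (qt_seq G {})"
proof -
  have "ultra_log_concave (qt_seq G S) \<and> no_internal_zeros (qt_seq G S)" if S: "S \<subseteq> edges G" for S
    using pseudo_orientable_imp_colouring[OF assms(1,2)]
  proof (elim disjE exE conjE)
    fix c assume flat: "flat_colouring G c"
    show ?thesis
    proof (rule flat_colouring_swap_family[OF assms(1) flat])
      fix V :: "'f set" and p0 s t and es :: "'e option list" and cl :: "'f \<Rightarrow> 'f set"
      assume sf: "swap_family V p0 es s t cl" "set es = Some ` edges G"
        "\<And>X. X \<subseteq> edges G \<Longrightarrow> quasi_tree G X \<longleftrightarrow> swap_family.feasible V p0 es s t cl (Some ` X)"
      \<comment> \<open>Feasible sets lie inside \<open>set es\<close>, which lacks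
        \<open>None\<close> here; the second disjunct expected by \<open>qt_seq_swap_family\<close>
        is therefore false.\<close>
      have "\<not> swap_family.feasible V p0 es s t cl (insert None Y)" for Y
        using sf(2) by (auto simp: swap_family.feasible_def[OF sf(1)])
      then show ?thesis by (intro qt_seq_swap_family[OF sf(1) _ _ S]) (use sf(2,3) in auto)
    qed
  next
    fix c a b assume bent: "bent_colouring G c a b" "(a, b) \<in> (cstep G)\<^sup>*"
    show ?thesis
    proof (rule bent_colouring_swap_family[OF assms(1) bent])
      fix V :: "'f set" and p0 s t and es :: "'e option list" and cl :: "'f \<Rightarrow> 'f set"
      assume sf: "swap_family V p0 es s t cl" "set es = insert None (Some ` edges G)"
        "\<And>X. X \<subseteq> edges G \<Longrightarrow> quasi_tree G X \<longleftrightarrow> swap_family.feasible V p0 es s t cl (Some ` X)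
          \<or> swap_family.feasible V p0 es s t cl (insert None (Some ` X))"
      show ?thesis by (intro qt_seq_swap_family[OF sf(1) _ _ S]) (use sf(2,3) in auto)
    qed
  qed
  then show ?thesis using assms(3) by blast
qed

end
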